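(* Let $\mathbb{F}=\mathbb{R}$ or $\mathbb{F}=\mathbb{C}$, and let $\mathcal{D}_A \subseteq SM(\mathbb{F})^g$ be a bounded generalized free spectrahedron which is closed under complex conjugation. Let $X \in \mathcal{D}_A(n)$. Then there exists an integer $\ell\ge 0$ satisfying $$\ell \leq \dim \mathfrak{D}_X(\mathcal{D}_A) \leq ng \quad \text{if } \mathbb{F}=\mathbb{R},$$ $$\ell \leq n+2 \dim \mathfrak{D}_X(\mathcal{D}_A) \leq n+2ng \quad \text{if } \mathbb{F}=\mathbb{C},$$ and an $\ell$-dilation $Y \in \mathcal{D}_A(n+\ell)$ of $X$ such that $Y$ is an Arveson extreme point of $\mathcal{D}_A$. As a consequence, $X$ can be written as a matrix convex combination $$X = \sum_{i=1}^k V_i^* F^i V_i, \qquad \sum_{i=1}^k V_i^* V_i = I_n,$$ of free extreme points $F^i \in \mathcal{D}_A(n_i)$ of $\mathcal{D}_A$ with $\sum_{i=1}^k n_i \leq n+\ell$. Thus $\mathcal{D}_A$ is the matrix convex hull of its free extreme points.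
   Context: Notation. $M_{m\times n}(\mathbb{F})^g$ is the set of $g$-tuples of $m\times n$ matrices over $\mathbb{F}$; $M_n(\mathbb F)=M_{n\times n}(\mathbb F)$; $SM_n(\mathbb{F})^g$ is the set of $g$-tuples of self-adjoint $n\times n$ matrices over $\mathbb{F}$ (real symmetric if $\mathbb{F}=\mathbb{R}$); $SM(\mathbb{F})^g=\bigcup_{n\ge1} SM_n(\mathbb{F})^g$. For $K\subseteq SM(\mathbb{F})^g$, $K(n)=K\cap SM_n(\mathbb{F})^g$. Operations on tuples (multiplication by matrices, adjoints, direct sums, complex conjugation, block matrices) are entrywise. $*$ is the conjugate transpose (transpose if $\mathbb{F}=\mathbb{R}$), and unitaries have entries in $\mathbb{F}$. $X,Y$ are unitarily equivalent if $U^*XU=Y$ for some unitary $U$ over $\mathbb{F}$. Generalized free spectrahedra. Let $\mathcal{H}$ be a separable infinite-dimensional Hilbert space over $\mathbb{F}$ and $A=(A_1,\dots,A_g)$ a tuple of compact self-adjoint operators on $\mathcal{H}$. For $X\in SM_n(\mathbb{F})^g$ put $L_A(X)=I_{\mathcal{H}}\otimes I_n-\sum_{i=1}^g A_i\otimes X_i$. Then $\mathcal{D}_A(n)=\{X\in SM_n(\mathbb{F})^g: L_A(X)\succeq 0\}$ and $\mathcal{D}_A=\bigcup_{n\ge1}\mathcal{D}_A(n)$ is called a generalized free spectrahedron. Matrix convexity. A matrix convex combination of $X^i\in SM_{n_i}(\mathbb{F})^g$, $i=1,\dots,k$, is a finite sum $\sum_i V_i^*X^iV_i\in SM_n(\mathbb{F})^g$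 with $V_i\in M_{n_i\times n}(\mathbb{F})$ and $\sum_i V_i^*V_i=I_n$. $K\subseteq SM(\mathbb{F})^g$ is matrix convex if it is closed under matrix convex combinations; the matrix convex hull of a set is the set of all matrix convex combinations of its elements. Generalized free spectrahedra are matrix convex. $K$ is bounded if there is a real $C$ with $CI_n-\sum_{i=1}^g X_i^2\succeq0$ for all $n$ and all $X\in K(n)$. $K$ is closed under complex conjugation if $X\in K$ implies $\overline{X}\in K$ (automatic if $\mathbb{F}=\mathbb{R}$). Dilations. For $K$ matrix convex, $X\in K(n)$ and $\ell\geq 1$, an $\ell$-dilation of $X$ is a tuple $Y=\begin{pmatrix}X&\beta\\ \beta^*&\gamma\end{pmatrix}\in K(n+\ell)$ with $\beta\in M_{n\times\ell}(\mathbb{F})^g$, $\gamma\in SM_\ell(\mathbb{F})^g$; for $\ell=0$ it means $Y=X$. $X$ is an Arveson extreme point of $K$ if, for all $\ell\ge1$, every $\ell$-dilation of $X$ in $K$ has $\beta=0$. The dilation subspace of $K$ at $X$ is the $\mathbb{F}$-linear span $$\mathfrak{D}_X(K)=\operatorname{span}\Big\{\beta\in M_{n\times1}(\mathbb{F})^g:\ \exists\,\gamma\in\mathbb{R}^g \text{ with }\begin{pmatrix}X&\beta\\ \beta^*&\gamma\end{pmatrix}\in K\Big\},$$ and $\dim$ is the dimension over $\mathbb{F}$. Free extreme points. $X\in K(n)$ is a free extreme point of $K$ if whenever $X=\sum_{i=1}^k V_i^*X^iV_i$ is a matrix convex combination of $X^i\in K(n_i)$ with $V_i\in M_{n_i\times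 n}(\mathbb{F})$ and every $V_i\neq0$, then for each $i$ either $n_i=n$ and $X$ is unitarily equivalent to $X^i$, or $n_i>n$ and there is $Z^i\in K$ such that $X\oplus Z^i$ is unitarily equivalent to $X^i$. *)

theory Defs
  imports
    "HOL-Analysis.Elementary_Normed_Spaces"
    "HOL-Library.Function_Algebras"
    "Jordan_Normal_Form.Schur_Decomposition"
begin

text \<open>
  The definitions are generic in the scalar type; they are used for \<open>real\<close> and \<open>complex\<close> only. There
  \<^const>\<open>conjugate\<close> is the identity, respectively \<^const>\<open>cnj\<close>, and \<open>0 \<le> z\<close> says for
  complex \<open>z\<close> that \<open>z\<close> is a nonnegative real number.

  A \<open>g\<close>-tuple of matrices is a function from a finite type \<open>'g\<close> to matrices; \<open>g\<close> is \<open>CARD('g)\<close>.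
\<close>


section \<open>Hilbert spaces over the scalar field\<close>

text \<open>
  A Hilbert space over \<open>'f\<close> is a real Banach space with an \<open>'f\<close>-vector space structure extending
  the real one and an \<open>'f\<close>-valued inner product, linear in the first argument, that induces the norm.
\<close>

locale hilbert_space_over =
  vector_space smul
  for smul :: "'f::{conjugatable_ordered_field,real_normed_field} \<Rightarrow> 'h::banach \<Rightarrow> 'h" +
  fixes ip :: "'h \<Rightarrow> 'h \<Rightarrow> 'f"
  assumes smul_of_real: "smul (of_real r) x = r *\<^sub>R x"
    and ip_add_left: "ip (x + y) z = ip x z + ip y z"
    and ip_smul_left: "ip (smul c x) y = c * ip x y"
    and ip_conjugate: "ip y x = conjugate (ip x y)"
    and ip_norm: "ip x x = of_real ((norm x)\<^sup>2)"

locale separable_infinite_dim_hilbert_space_over =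
  hilbert_space_over smul ip
  for smul :: "'f::{conjugatable_ordered_field,real_normed_field} \<Rightarrow> 'h::banach \<Rightarrow> 'h"
    and ip :: "'h \<Rightarrow> 'h \<Rightarrow> 'f" +
  assumes separable: "\<exists>D :: 'h set. countable D \<and> closure D = UNIV"
    and infinite_dim: "\<not> (\<exists>B. finite B \<and> span B = UNIV)"

definition compact_selfadjoint ::
  "('f::field \<Rightarrow> 'h::real_normed_vector \<Rightarrow> 'h) \<Rightarrow> ('h \<Rightarrow> 'h \<Rightarrow> 'f) \<Rightarrow> ('h \<Rightarrow> 'h) \<Rightarrow> bool"
  where
  "compact_selfadjoint smul ip T \<longleftrightarrow>
     Vector_Spaces.linear smul smul T \<and>
     compact (closure (T ` cball 0 1)) \<and>
     (\<forall>x y. ip (T x) y = ip x (T y))"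


section \<open>Tuples of matrices\<close>

definition mat_sum :: "nat \<Rightarrow> nat \<Rightarrow> ('i \<Rightarrow> 'f::comm_monoid_add mat) \<Rightarrow> 'i set \<Rightarrow> 'f mat" where
  "mat_sum m n M I = mat m n (\<lambda>(j, k). \<Sum>i\<in>I. M i $$ (j, k))"

definition mat_tuples :: "nat \<Rightarrow> nat \<Rightarrow> ('g \<Rightarrow> 'f mat) set" where
  "mat_tuples m n = {X. \<forall>a. X a \<in> carrier_mat m n}"

definition SM :: "nat \<Rightarrow> ('g \<Rightarrow> 'f::conjugatable_field mat) set" where
  "SM n = {X \<in> mat_tuples n n. \<forall>a. mat_adjoint (X a) = X a}"

definition level :: "('g \<Rightarrow> 'f::conjugatable_field mat) set \<Rightarrow> nat \<Rightarrow> ('g \<Rightarrow> 'f mat) set" where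
  "level K n = K \<inter> SM n"

definition psd :: "nat \<Rightarrow> 'f::conjugatable_ordered_field mat \<Rightarrow> bool" where
  "psd n M \<longleftrightarrow>
     M \<in> carrier_mat n n \<and> mat_adjoint M = M \<and>
     (\<forall>v \<in> carrier_vec n. 0 \<le> (M *\<^sub>v v) \<bullet>c v)"

definition bounded_tuples ::
  "('g::finite \<Rightarrow> 'f::{conjugatable_ordered_field,real_normed_field} mat) set \<Rightarrow> bool" where
  "bounded_tuples K \<longleftrightarrow>
     (\<exists>C::real. \<forall>n. \<forall>X \<in> level K n.
        psd n (of_real C \<cdot>\<^sub>m 1\<^sub>m n - mat_sum n n (\<lambda>a. X a * X a) UNIV))"

definition closed_under_conjugation :: "('g \<Rightarrow> 'f::conjugate mat) set \<Rightarrow> bool" where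
  "closed_under_conjugation K \<longleftrightarrow> (\<forall>X \<in> K. (\<lambda>a. map_mat conjugate (X a)) \<in> K)"

definition unitary :: "nat \<Rightarrow> 'f::conjugatable_field mat \<Rightarrow> bool" where
  "unitary n U \<longleftrightarrow>
     U \<in> carrier_mat n n \<and> mat_adjoint U * U = 1\<^sub>m n \<and> U * mat_adjoint U = 1\<^sub>m n"

definition unitarily_equivalent ::
  "('g \<Rightarrow> 'f::conjugatable_field mat) \<Rightarrow> ('g \<Rightarrow> 'f mat) \<Rightarrow> bool" where
  "unitarily_equivalent X Y \<longleftrightarrow>
     (\<exists>n U. X \<in> mat_tuples n n \<and> Y \<in> mat_tuples n n \<and> unitary n U \<and>
        (\<forall>a. mat_adjoint U * X a * U = Y a))"

definition direct_sum :: "('g \<Rightarrow> 'f::zero mat) \<Rightarrow> ('g \<Rightarrow> 'f mat) \<Rightarrow> ('g \<Rightarrow> 'f mat)" where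
  "direct_sum X Y =
     (\<lambda>a. four_block_mat
        (X a) (0\<^sub>m (dim_row (X a)) (dim_col (Y a)))
        (0\<^sub>m (dim_row (Y a)) (dim_col (X a))) (Y a))"


section \<open>Generalized free spectrahedra\<close>

text \<open>
  The Hilbert space tensor product of \<open>H\<close> with the scalar \<open>n\<close>-space is realised as the \<open>n\<close>-fold
  direct sum of \<open>H\<close>. Its elements are functions \<open>v :: nat \<Rightarrow> 'h\<close> of which only the values at
  \<open>j < n\<close> matter; the simple tensor of \<open>h\<close> and \<open>x\<close> has components \<open>x\<^sub>j h\<close>.
\<close>

definition tensor_op ::
  "('f \<Rightarrow> 'h \<Rightarrow> 'h::comm_monoid_add) \<Rightarrow> nat \<Rightarrow> ('h \<Rightarrow> 'h) \<Rightarrow> 'f mat \<Rightarrow> (nat \<Rightarrow> 'h) \<Rightarrow> nat \<Rightarrow> 'h" where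
  "tensor_op smul n T M v j = (\<Sum>k<n. smul (M $$ (j, k)) (T (v k)))"

definition pencil ::
  "('f::field \<Rightarrow> 'h \<Rightarrow> 'h::ab_group_add) \<Rightarrow> ('g::finite \<Rightarrow> 'h \<Rightarrow> 'h) \<Rightarrow> nat \<Rightarrow> ('g \<Rightarrow> 'f mat) \<Rightarrow>
     (nat \<Rightarrow> 'h) \<Rightarrow> nat \<Rightarrow> 'h" where
  "pencil smul A n X v j =
     tensor_op smul n id (1\<^sub>m n) v j - (\<Sum>a\<in>UNIV. tensor_op smul n (A a) (X a) v j)"

definition psd_op ::
  "('h \<Rightarrow> 'h \<Rightarrow> 'f::conjugatable_ordered_field) \<Rightarrow> nat \<Rightarrow> ((nat \<Rightarrow> 'h) \<Rightarrow> nat \<Rightarrow> 'h) \<Rightarrow> bool" where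
  "psd_op ip n L \<longleftrightarrow> (\<forall>v. 0 \<le> (\<Sum>j<n. ip (L v j) (v j)))"

definition gen_free_spectrahedron ::
  "('f::conjugatable_ordered_field \<Rightarrow> 'h \<Rightarrow> 'h::ab_group_add) \<Rightarrow> ('h \<Rightarrow> 'h \<Rightarrow> 'f) \<Rightarrow>
     ('g::finite \<Rightarrow> 'h \<Rightarrow> 'h) \<Rightarrow> ('g \<Rightarrow> 'f mat) set" where
  "gen_free_spectrahedron smul ip A =
     (\<Union>n\<in>{1..}. {X \<in> SM n. psd_op ip n (pencil smul A n X)})"


section \<open>Matrix convex combinations and free extreme points\<close>

definition matrix_convex_combination ::
  "nat \<Rightarrow> nat \<Rightarrow> (nat \<Rightarrow> nat) \<Rightarrow> (nat \<Rightarrow> 'f::conjugatable_field mat) \<Rightarrow> (nat \<Rightarrow> 'g \<Rightarrow> 'f mat) \<Rightarrow>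
     ('g \<Rightarrow> 'f mat) \<Rightarrow> bool" where
  "matrix_convex_combination n k ns V Z X \<longleftrightarrow>
     (\<forall>i<k. V i \<in> carrier_mat (ns i) n \<and> Z i \<in> SM (ns i)) \<and>
     mat_sum n n (\<lambda>i. mat_adjoint (V i) * V i) {..<k} = 1\<^sub>m n \<and>
     X = (\<lambda>a. mat_sum n n (\<lambda>i. mat_adjoint (V i) * Z i a * V i) {..<k})"

definition matrix_convex_hull ::
  "('g \<Rightarrow> 'f::conjugatable_field mat) set \<Rightarrow> ('g \<Rightarrow> 'f mat) set" where
  "matrix_convex_hull S =
     {X. \<exists>n\<ge>1. \<exists>k ns V Z. (\<forall>i<k. Z i \<in> level S (ns i)) \<and>
        matrix_convex_combination n k ns V Z X}"

definition free_extreme_point ::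
  "('g \<Rightarrow> 'f::conjugatable_field mat) set \<Rightarrow> nat \<Rightarrow> ('g \<Rightarrow> 'f mat) \<Rightarrow> bool" where
  "free_extreme_point K n X \<longleftrightarrow>
     X \<in> level K n \<and>
     (\<forall>k ns V Z.
        (\<forall>i<k. Z i \<in> level K (ns i)) \<and>
        matrix_convex_combination n k ns V Z X \<and>
        (\<forall>i<k. V i \<noteq> 0\<^sub>m (ns i) n) \<longrightarrow>
        (\<forall>i<k.
           (ns i = n \<and> unitarily_equivalent X (Z i)) \<or>
           (ns i > n \<and> (\<exists>W \<in> K. unitarily_equivalent (direct_sum X W) (Z i)))))"


section \<open>Dilations and Arveson extreme points\<close>

definition block_tuple ::
  "('g \<Rightarrow> 'f::conjugatable_field mat) \<Rightarrow> ('g \<Rightarrow> 'f mat) \<Rightarrow> ('g \<Rightarrow> 'f mat) \<Rightarrow> ('g \<Rightarrow> 'f mat)" where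
  "block_tuple X \<beta> \<gamma> = (\<lambda>a. four_block_mat (X a) (\<beta> a) (mat_adjoint (\<beta> a)) (\<gamma> a))"

text \<open>For \<open>l = 0\<close> the blocks \<open>\<beta>\<close> and \<open>\<gamma>\<close> are empty; see the lemma below.\<close>

definition dilation ::
  "('g \<Rightarrow> 'f::conjugatable_field mat) set \<Rightarrow> nat \<Rightarrow> nat \<Rightarrow> ('g \<Rightarrow> 'f mat) \<Rightarrow> ('g \<Rightarrow> 'f mat) \<Rightarrow> bool" where
  "dilation K n l X Y \<longleftrightarrow>
     (\<exists>\<beta> \<in> mat_tuples n l. \<exists>\<gamma> \<in> SM l. Y = block_tuple X \<beta> \<gamma> \<and> Y \<in> level K (n + l))"

lemma dilation_0_iff:
  assumes "X \<in> level K n"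
  shows "dilation K n 0 X Y \<longleftrightarrow> Y = X"
proof -
  have X: "X a \<in> carrier_mat n n" for a
    using assms by (auto simp: level_def SM_def mat_tuples_def)
  have block: "block_tuple X \<beta> \<gamma> = X" if "\<beta> \<in> mat_tuples n 0" "\<gamma> \<in> SM 0" for \<beta> \<gamma>
  proof
    fix a
    have "\<beta> a \<in> carrier_mat n 0" "\<gamma> a \<in> carrier_mat 0 0"
      using that by (auto simp: SM_def mat_tuples_def)
    with X[of a] show "block_tuple X \<beta> \<gamma> a = X a"
      by (intro eq_matI) (auto simp: block_tuple_def)
  qed
  have "(\<lambda>_. 0\<^sub>m n 0) \<in> mat_tuples n 0" "(\<lambda>_. 0\<^sub>m 0 0) \<in> SM 0"
    by (auto simp: SM_def mat_tuples_def mat_adjoint_def intro!: eq_matI)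
  then show ?thesis
    using block assms unfolding dilation_def by (metis add_0_right)
qed

definition arveson_extreme_point ::
  "('g \<Rightarrow> 'f::conjugatable_field mat) set \<Rightarrow> nat \<Rightarrow> ('g \<Rightarrow> 'f mat) \<Rightarrow> bool" where
  "arveson_extreme_point K n X \<longleftrightarrow>
     X \<in> level K n \<and>
     (\<forall>l\<ge>1. \<forall>\<beta> \<in> mat_tuples n l. \<forall>\<gamma> \<in> SM l.
        block_tuple X \<beta> \<gamma> \<in> level K (n + l) \<longrightarrow> \<beta> = (\<lambda>_. 0\<^sub>m n l))"

text \<open>
  Matrices of all sizes share one type, which is therefore not a vector space. Spans and dimensions
  of sets of \<open>g\<close>-tuples of columns are taken in the vector space of scalar functions on
  \<open>'g \<times> nat\<close>, into which \<open>column_coords\<close> embeds the \<open>g\<close>-tuples of \<open>n \<times> 1\<close> matrices linearly.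
\<close>

definition scale_fun :: "'f::field \<Rightarrow> ('i \<Rightarrow> 'f) \<Rightarrow> 'i \<Rightarrow> 'f" where
  "scale_fun c f = (\<lambda>x. c * f x)"

lemma vector_space_scale_fun: "vector_space scale_fun"
  by unfold_locales (auto simp: scale_fun_def algebra_simps)

definition column_coords :: "('g \<Rightarrow> 'f::zero mat) \<Rightarrow> 'g \<times> nat \<Rightarrow> 'f" where
  "column_coords \<beta> = (\<lambda>(a, j). if j < dim_row (\<beta> a) then \<beta> a $$ (j, 0) else 0)"

definition dilation_subspace ::
  "('g \<Rightarrow> 'f::{conjugatable_ordered_field,real_normed_field} mat) set \<Rightarrow> nat \<Rightarrow> ('g \<Rightarrow> 'f mat) \<Rightarrow>
     ('g \<times> nat \<Rightarrow> 'f) set" where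
  "dilation_subspace K n X =
     Modules.module.span scale_fun
       (column_coords ` {\<beta> \<in> mat_tuples n 1.
          \<exists>c :: 'g \<Rightarrow> real. block_tuple X \<beta> (\<lambda>a. mat 1 1 (\<lambda>_. of_real (c a))) \<in> K})"

definition dilation_dim ::
  "('g \<Rightarrow> 'f::{conjugatable_ordered_field,real_normed_field} mat) set \<Rightarrow> nat \<Rightarrow> ('g \<Rightarrow> 'f mat) \<Rightarrow> nat"
  where
  "dilation_dim K n X = Vector_Spaces.vector_space.dim scale_fun (dilation_subspace K n X)"

end

theory Submission
  imports Defs "Jordan_Normal_Form.Spectral_Radius" "HOL-Analysis.L2_Norm"
begin

text \<open>
  Call a tuple Arveson extreme if all its dilations in the set are direct sums. The two claims are that
  every tuple dilates to an Arveson extreme one, at a controlled cost, and that an Arveson extreme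
  tuple is a direct sum of free extreme ones.
  
  Real scalars. The pencil \<open>L\<^sub>A(X)\<close> is the identity minus a compact operator, so its range is closed
  and its quadratic form controls the distance to its kernel (\<open>kernel_distance_le\<close>,
  \<open>form_controls_kernel_distance\<close>). Hence some positive multiple of a column \<open>\<beta>\<close> occurs in a dilation
  of \<open>X\<close> if and only if \<open>\<Lambda>\<^sub>A(\<beta>\<^sup>*)\<close> vanishes on that kernel (\<open>direction_dilates\<close>,
  \<open>added_row_vanishes_on_kernel\<close>): the dilation subspace is the set of these columns, and \<open>X\<close> is
  Arveson extreme once it is zero. If it contains some \<open>\<beta> \<noteq> 0\<close>, boundedness gives a dilation with the
  largest possible multiple of \<open>\<beta>\<close> and, for this multiple, a corner \<open>\<gamma>\<close> of largest norm. Restricting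
  the directions of the new tuple to the old coordinates is then injective, as a direction \<open>\<sigma>\<close> in the
  new coordinate alone would allow the corners \<open>\<gamma> \<plusminus> \<epsilon>\<sigma>\<close> (\<open>no_direction_in_corner\<close>), and it misses \<open>\<beta>\<close>,
  as otherwise a rotation would produce a larger multiple (\<open>maximal_direction_not_restricted\<close>). So the
  dimension of the dilation subspace drops with each added coordinate.
  
  Complex scalars. The corners are self-adjoint, so \<open>\<gamma> \<plusminus> \<epsilon>\<sigma>\<close> makes sense for real \<open>\<sigma>\<close> only, and the
  argument does not apply to complex tuples. But \<open>X \<oplus> X\<^sup>-\<close>, where \<open>X\<^sup>-\<close> is the complex conjugate, is unitarily equivalent to a real
  tuple of size \<open>2n\<close> (\<open>realification\<close>), and the real points of the spectrahedron form the spectrahedron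
  of the same operators on the underlying real Hilbert space
  (\<open>gen_free_spectrahedron_complexify_iff\<close>). A real Arveson extreme point remains Arveson extreme among
  complex tuples, since a dilation may be averaged with its complex conjugate
  (\<open>arveson_extreme_complexify\<close>). The doubling costs \<open>n\<close>, and the real dilation subspace at the real
  tuple has at most twice the complex dimension of the one at \<open>X\<close>.
  
  Free extreme points. A matrix convex combination is a compression of a direct sum, so Arveson
  extremality of \<open>X\<close> forces every \<open>V\<^sub>i\<close> in \<open>X = \<Sum> V\<^sub>i\<^sup>* X\<^sup>i V\<^sub>i\<close> to intertwine \<open>X\<close> and \<open>X\<^sup>i\<close>
  (\<open>rigid_intertwines\<close>), and \<open>V\<^sub>i\<^sup>* V\<^sub>i\<close> to commute with \<open>X\<close>. If only scalars commute with \<open>X\<close>, each \<open>V\<^sub>i\<close>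
  is a multiple of an isometry and \<open>X\<close> is free extreme
  (\<open>rigid_irreducible_imp_free_extreme\<close>). Otherwise an eigenspace of a commuting matrix splits \<open>X\<close> into
  smaller Arveson extreme tuples (\<open>rigid_decomposition\<close>).
\<close>

section \<open>Matrices over the real and complex numbers\<close>

text \<open>
  Nonnegative scalars are real, so that columns can be normalised, and self-adjoint matrices have
  eigenvectors. Axioms of a class speak about its operations only, hence \<open>r *\<^sub>R 1\<close> and the function \<open>h\<close>
  in place of \<open>of_real r\<close> and a matrix.
\<close>

class rc_scalar = conjugatable_ordered_field + real_normed_field +
  assumes conjugate_scaleR_one: "conjugate (r *\<^sub>R 1) = r *\<^sub>R 1"
    and nonneg_imp_scaleR_one: "0 \<le> x \<Longrightarrow> \<exists>r\<ge>0. x = r *\<^sub>R 1"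
    and hermitian_eigenvector:
      "(\<And>i j. h j i = conjugate (h i j)) \<Longrightarrow> 0 < (n::nat) \<Longrightarrow>
         \<exists>c v. (\<exists>i<n. v i \<noteq> 0) \<and> (\<forall>i<n. (\<Sum>j<n. h i j * v j) = c * v i)"

lemma conjugate_of_real: "conjugate (of_real r :: 'f::rc_scalar) = of_real r"
  unfolding of_real_def by (rule conjugate_scaleR_one)

lemma nonneg_imp_of_real: "0 \<le> (x :: 'f::rc_scalar) \<Longrightarrow> \<exists>r\<ge>0. x = of_real r"
  unfolding of_real_def by (rule nonneg_imp_scaleR_one)

subsection \<open>Adjoints\<close>

lemma dim_mat_adjoint [simp]:
  "dim_row (mat_adjoint A) = dim_col A" "dim_col (mat_adjoint A) = dim_row A"
  by (auto simp: mat_adjoint_def)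

lemma index_mat_adjoint [simp]:
  "i < dim_col A \<Longrightarrow> j < dim_row A \<Longrightarrow> mat_adjoint A $$ (i, j) = conjugate (A $$ (j, i))"
  by (auto simp: mat_adjoint_def mat_of_rows_def)

lemma mat_adjoint_carrier [simp]: "A \<in> carrier_mat m n \<Longrightarrow> mat_adjoint A \<in> carrier_mat n m"
  by auto

lemma mat_adjoint_adjoint [simp]: "mat_adjoint (mat_adjoint A) = A"
  by (rule eq_matI) auto

lemma conjugate_one [simp]: "conjugate (1 :: 'f::conjugatable_field) = 1"
proof -
  have "conjugate (1::'f) * conjugate 1 = conjugate 1 * 1"
    by (simp flip: conjugate_dist_mul)
  then show ?thesis
    by (metis conjugate_zero_iff mult_cancel_left zero_neq_one)
qed

lemma mat_adjoint_one [simp]: "mat_adjoint (1\<^sub>m n) = (1\<^sub>m n :: 'f::conjugatable_field mat)"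
  by (rule eq_matI) auto

lemma mat_adjoint_zero [simp]: "mat_adjoint (0\<^sub>m m n) = (0\<^sub>m n m :: 'f::conjugatable_field mat)"
  by (rule eq_matI) auto

lemma index_mult_mat_sum:
  assumes "A \<in> carrier_mat m p" "B \<in> carrier_mat p n" "i < m" "j < n"
  shows "(A * B) $$ (i, j) = (\<Sum>k<p. A $$ (i, k) * B $$ (k, j))"
  using assms by (auto simp: scalar_prod_def lessThan_atLeast0 intro!: sum.cong)

lemma mat_adjoint_mult:
  assumes "A \<in> carrier_mat m p" "B \<in> carrier_mat p n"
  shows "mat_adjoint (A * B) = mat_adjoint B * mat_adjoint A"
proof (rule eq_matI)
  fix i j assume "i < dim_row (mat_adjoint B * mat_adjoint A)" "j < dim_col (mat_adjoint B * mat_adjoint A)"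
  then have ij: "i < n" "j < m" using assms by auto
  have "mat_adjoint (A * B) $$ (i, j) = conjugate (\<Sum>k<p. A $$ (j, k) * B $$ (k, i))"
    using ij assms index_mult_mat_sum[OF assms ij(2,1)] by auto
  also have "\<dots> = (\<Sum>k<p. mat_adjoint B $$ (i, k) * mat_adjoint A $$ (k, j))"
    using ij assms by (auto simp: sum_conjugate conjugate_dist_mul mult.commute intro!: sum.cong)
  also have "\<dots> = (mat_adjoint B * mat_adjoint A) $$ (i, j)"
    using ij assms by (subst index_mult_mat_sum[of _ n p _ m]) auto
  finally show "mat_adjoint (A * B) $$ (i, j) = (mat_adjoint B * mat_adjoint A) $$ (i, j)" .
qed (use assms in auto)

text \<open>
  Stated with dimensions instead of carriers, the laws of matrix algebra can be used by the
  simplifier without guessing intermediate sizes.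
\<close>

named_theorems mat_algebra

lemma mult_mat_assoc [mat_algebra]:
  "dim_col A = dim_row B \<Longrightarrow> dim_col B = dim_row C \<Longrightarrow> (A * B) * C = A * (B * C :: 'f::semiring_0 mat)"
  by (rule assoc_mult_mat) auto

lemma mat_adjoint_mult' [mat_algebra]:
  "dim_col A = dim_row B \<Longrightarrow> mat_adjoint (A * B) = mat_adjoint B * mat_adjoint A"
  by (rule mat_adjoint_mult) auto

lemma add_zero_mat [mat_algebra]:
  "dim_row A = m \<Longrightarrow> dim_col A = n \<Longrightarrow> 0\<^sub>m m n + A = (A :: 'f::semiring_1 mat)"
  "dim_row A = m \<Longrightarrow> dim_col A = n \<Longrightarrow> A + 0\<^sub>m m n = (A :: 'f::semiring_1 mat)"
  by auto

lemma mult_mat_assoc_eq: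
  assumes "A * B = C" "dim_col A = dim_row B" "dim_col B = dim_row D"
  shows "A * (B * D) = C * (D :: 'f::semiring_0 mat)"
  using assms mult_mat_assoc[of A B D] by simp

lemma conjugation_hermitian:
  assumes "Z \<in> carrier_mat m m" "mat_adjoint Z = Z" "W \<in> carrier_mat m n"
  shows "mat_adjoint (mat_adjoint W * Z * W) = mat_adjoint W * Z * W"
proof -
  note d = carrier_matD[OF assms(1)] carrier_matD[OF assms(3)]
  show ?thesis by (simp add: mat_algebra d assms(2))
qed


subsection \<open>Block rows and block columns\<close>

definition vstack :: "'f mat \<Rightarrow> 'f mat \<Rightarrow> 'f mat" where
  "vstack A B = mat (dim_row A + dim_row B) (dim_col A)
     (\<lambda>(i, j). if i < dim_row A then A $$ (i, j) else B $$ (i - dim_row A, j))"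

definition hstack :: "'f mat \<Rightarrow> 'f mat \<Rightarrow> 'f mat" where
  "hstack A B = mat (dim_row A) (dim_col A + dim_col B)
     (\<lambda>(i, j). if j < dim_col A then A $$ (i, j) else B $$ (i, j - dim_col A))"

lemma vstack_carrier [simp]:
  "A \<in> carrier_mat p n \<Longrightarrow> B \<in> carrier_mat q n \<Longrightarrow> vstack A B \<in> carrier_mat (p + q) n"
  by (auto simp: vstack_def)

lemma hstack_carrier [simp]:
  "A \<in> carrier_mat n p \<Longrightarrow> B \<in> carrier_mat n q \<Longrightarrow> hstack A B \<in> carrier_mat n (p + q)"
  by (auto simp: hstack_def)

lemma vstack_eq_iff:
  assumes "A \<in> carrier_mat p n" "B \<in> carrier_mat q n" "C \<in> carrier_mat p n" "D \<in> carrier_mat q n"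
  shows "vstack A B = vstack C D \<longleftrightarrow> A = C \<and> B = D"
proof
  assume eq: "vstack A B = vstack C D"
  have "A $$ (i, j) = C $$ (i, j)" if "i < p" "j < n" for i j
    using arg_cong[OF eq, of "\<lambda>M. M $$ (i, j)"] that assms by (auto simp: vstack_def)
  moreover have "B $$ (i, j) = D $$ (i, j)" if "i < q" "j < n" for i j
    using arg_cong[OF eq, of "\<lambda>M. M $$ (p + i, j)"] that assms by (auto simp: vstack_def)
  ultimately show "A = C \<and> B = D"
    using assms by (auto intro!: eq_matI)
qed simp

lemma mat_adjoint_hstack:
  assumes "A \<in> carrier_mat n p" "B \<in> carrier_mat n q"
  shows "mat_adjoint (hstack A B) = vstack (mat_adjoint A) (mat_adjoint B)"
  using assms by (intro eq_matI) (auto simp: vstack_def hstack_def)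

lemma mat_adjoint_vstack:
  assumes "A \<in> carrier_mat p n" "B \<in> carrier_mat q n"
  shows "mat_adjoint (vstack A B) = hstack (mat_adjoint A) (mat_adjoint B)"
  using assms by (intro eq_matI) (auto simp: vstack_def hstack_def)

lemma mult_hstack:
  assumes "M \<in> carrier_mat m n" "A \<in> carrier_mat n p" "B \<in> carrier_mat n q"
  shows "M * hstack A B = hstack (M * A) (M * B)"
  using assms by (intro eq_matI) (auto simp: hstack_def scalar_prod_def intro!: sum.cong)

lemma vstack_mult:
  assumes "M \<in> carrier_mat n m" "A \<in> carrier_mat p n" "B \<in> carrier_mat q n"
  shows "vstack A B * M = vstack (A * M) (B * M)"
  using assms by (intro eq_matI) (auto simp: vstack_def scalar_prod_def intro!: sum.cong)

lemma sum_lessThan_add: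
  "(\<Sum>k<p + q. f k) = (\<Sum>k<p. f k) + (\<Sum>k<q. f (p + k :: nat) :: 'a::comm_monoid_add)"
  by (induction q) (auto simp: add.assoc)

lemma hstack_mult_vstack:
  assumes "A \<in> carrier_mat m p" "B \<in> carrier_mat m q" "C \<in> carrier_mat p n" "D \<in> carrier_mat q n"
  shows "hstack A B * vstack C D = A * C + B * D"
proof (rule eq_matI)
  fix i j assume "i < dim_row (A * C + B * D)" "j < dim_col (A * C + B * D)"
  then have ij: "i < m" "j < n" using assms by auto
  have "(hstack A B * vstack C D) $$ (i, j) =
     (\<Sum>k<p + q. hstack A B $$ (i, k) * vstack C D $$ (k, j))"
    using assms ij by (intro index_mult_mat_sum) auto
  also have "\<dots> = (\<Sum>k<p. A $$ (i, k) * C $$ (k, j)) + (\<Sum>k<q. B $$ (i, k) * D $$ (k, j))"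
    unfolding sum_lessThan_add using assms ij by (auto simp: hstack_def vstack_def)
  also have "\<dots> = (A * C + B * D) $$ (i, j)"
    using assms ij by (simp add: index_mult_mat_sum[of _ m p _ n] index_mult_mat_sum[of _ m q _ n]
        del: index_mult_mat(1))
  finally show "(hstack A B * vstack C D) $$ (i, j) = (A * C + B * D) $$ (i, j)" .
qed (use assms in \<open>auto simp: hstack_def vstack_def\<close>)

lemma vstack_mult_hstack:
  assumes "A \<in> carrier_mat p m" "B \<in> carrier_mat q m" "C \<in> carrier_mat m r" "D \<in> carrier_mat m s"
  shows "vstack A B * hstack C D = four_block_mat (A * C) (A * D) (B * C) (B * D)"
  using assms by (intro eq_matI) (auto simp: hstack_def vstack_def scalar_prod_def intro!: sum.cong)

lemma four_block_eq_vstack: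
  assumes "A \<in> carrier_mat p r" "B \<in> carrier_mat p s" "C \<in> carrier_mat q r" "D \<in> carrier_mat q s"
  shows "four_block_mat A B C D = vstack (hstack A B) (hstack C D)"
  using assms by (intro eq_matI) (auto simp: hstack_def vstack_def)

lemma four_block_mult_vstack:
  assumes "A \<in> carrier_mat p r" "B \<in> carrier_mat p s" "C \<in> carrier_mat q r" "D \<in> carrier_mat q s"
    "E \<in> carrier_mat r n" "F \<in> carrier_mat s n"
  shows "four_block_mat A B C D * vstack E F = vstack (A * E + B * F) (C * E + D * F)"
proof -
  have "four_block_mat A B C D * vstack E F =
      vstack (hstack A B * vstack E F) (hstack C D * vstack E F)"
    unfolding four_block_eq_vstack[OF assms(1-4)]
    by (rule vstack_mult[of _ "r + s" n _ p _ q]) (use assms in auto)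
  then show ?thesis
    using assms by (simp add: hstack_mult_vstack[of _ _ r _ s _ n])
qed

lemma diag_block_mult_vstack:
  fixes A D :: "'f::semiring_0 mat"
  assumes "A \<in> carrier_mat p r" "D \<in> carrier_mat q s" "E \<in> carrier_mat r n" "F \<in> carrier_mat s n"
  shows "four_block_mat A (0\<^sub>m p s) (0\<^sub>m q r) D * vstack E F = vstack (A * E) (D * F)"
  using assms by (subst four_block_mult_vstack[of _ p r _ s _ q _ _ n]) auto


subsection \<open>Isometries\<close>

definition isometry :: "nat \<Rightarrow> nat \<Rightarrow> 'f::conjugatable_field mat \<Rightarrow> bool" where
  "isometry m n W \<longleftrightarrow> W \<in> carrier_mat m n \<and> mat_adjoint W * W = 1\<^sub>m n"

lemma isometryD:
  assumes "isometry m n W"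
  shows "W \<in> carrier_mat m n" "mat_adjoint W * W = 1\<^sub>m n"
  using assms by (auto simp: isometry_def)

lemma left_inverse_imp_le:
  assumes A: "A \<in> carrier_mat m n" and B: "(B :: 'f::field mat) \<in> carrier_mat n m" and BA: "B * A = 1\<^sub>m n"
  shows "n \<le> m"
proof (rule ccontr)
  assume "\<not> n \<le> m"
  then obtain d where d: "n = m + d" "d > 0"
    by (metis less_imp_add_positive not_le)
  \<comment> \<open>Pad both factors with zeros to square matrices.\<close>
  let ?A = "vstack A (0\<^sub>m d n)" and ?B = "hstack B (0\<^sub>m n d)"
  have "?B * ?A = 1\<^sub>m n"
    using A B BA by (subst hstack_mult_vstack[of _ n m _ d _ n]) auto
  moreover have "?A \<in> carrier_mat n n" "?B \<in> carrier_mat n n"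
    using A B d by auto
  ultimately have "?A * ?B = 1\<^sub>m n"
    by (metis mat_mult_left_right_inverse)
  moreover have "(?A * ?B) $$ (m, m) = 0"
    using A B d by (subst vstack_mult_hstack[of _ m n _ d _ m _ d]) auto
  ultimately show False
    using d by simp
qed

lemma isometry_dim_le: "isometry m n W \<Longrightarrow> n \<le> m"
  by (rule left_inverse_imp_le[of W m n "mat_adjoint W"]) (auto simp: isometry_def)

lemma isometry_square_imp_unitary:
  assumes "isometry n n U"
  shows "unitary n U"
  using assms mat_mult_left_right_inverse[of "mat_adjoint U" n U]
  by (auto simp: isometry_def unitary_def)

lemma isometry_mult:
  assumes "isometry m p V" "isometry p n W"
  shows "isometry m n (V * W)"
proof -
  note V = isometryD[OF assms(1)] and W = isometryD[OF assms(2)]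
  note d = carrier_matD[OF V(1)] carrier_matD[OF W(1)]
  have "mat_adjoint (V * W) * (V * W) = mat_adjoint W * (mat_adjoint V * (V * W))"
    by (simp add: mat_algebra d)
  also have "\<dots> = 1\<^sub>m n"
    by (simp add: mult_mat_assoc_eq[OF V(2)] W(2) d)
  finally show ?thesis
    using V W by (auto simp: isometry_def)
qed

lemma isometry_hstack:
  assumes V: "isometry m p V" and W: "isometry m q W" and VW: "mat_adjoint V * W = 0\<^sub>m p q"
  shows "isometry m (p + q) (hstack V W)"
proof -
  note c = isometryD[OF V] isometryD[OF W]
  have "mat_adjoint W * V = 0\<^sub>m q p"
    using arg_cong[OF VW, of mat_adjoint] c by (simp add: mat_adjoint_mult[of _ p m _ q])
  then have "mat_adjoint (hstack V W) * hstack V W =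
      four_block_mat (1\<^sub>m p) (0\<^sub>m p q) (0\<^sub>m q p) (1\<^sub>m q)"
    using c VW by (simp add: mat_adjoint_hstack[of _ m p _ q] vstack_mult_hstack[of _ p m _ q _ p _ q])
  then show ?thesis
    using c by (auto simp: isometry_def)
qed

lemma scalar_square_root:
  assumes "0 \<le> (x :: 'f::rc_scalar)" "x \<noteq> 0"
  shows "\<exists>c. c \<noteq> 0 \<and> conjugate c = c \<and> c * c * x = 1"
proof -
  obtain r where r: "r \<ge> 0" "x = of_real r"
    using nonneg_imp_of_real[OF assms(1)] by blast
  then have "r > 0" using assms(2) by (cases "r = 0") auto
  then have "(1 / sqrt r) * (1 / sqrt r) * r = 1"
    by (simp add: field_simps)
  then have "(of_real (1 / sqrt r) :: 'f) * of_real (1 / sqrt r) * x = 1"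
    unfolding r by (metis of_real_1 of_real_mult)
  then show ?thesis
    using \<open>r > 0\<close> by (intro exI[of _ "of_real (1 / sqrt r)"]) (auto simp: conjugate_of_real simp del: of_real_divide)
qed

lemma exists_unit_multiple:
  fixes v :: "'f::rc_scalar mat"
  assumes v: "v \<in> carrier_mat m 1" "v \<noteq> 0\<^sub>m m 1"
  shows "\<exists>c. isometry m 1 (c \<cdot>\<^sub>m v)"
proof -
  define s where "s = (\<Sum>k<m. conjugate (v $$ (k, 0)) * v $$ (k, 0))"
  obtain k0 where k0: "k0 < m" "v $$ (k0, 0) \<noteq> 0"
  proof (rule ccontr)
    assume "\<not> thesis"
    then have "v = 0\<^sub>m m 1" using v(1) that by (intro eq_matI) auto
    then show False using v(2) by simp
  qed
  have nonneg: "0 \<le> conjugate (v $$ (k, 0)) * v $$ (k, 0)" for k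
    using conjugate_square_positive[of "v $$ (k, 0)"] by (simp add: mult.commute)
  have "0 \<le> s"
    unfolding s_def by (intro sum_nonneg nonneg)
  moreover have "s \<noteq> 0"
  proof
    assume "s = 0"
    then have "conjugate (v $$ (k0, 0)) * v $$ (k0, 0) = 0"
      using k0 nonneg unfolding s_def by (subst (asm) sum_nonneg_eq_0_iff) auto
    then show False using k0 by simp
  qed
  ultimately obtain c where c: "conjugate c = c" "c * c * s = 1"
    using scalar_square_root by blast
  have "mat_adjoint (c \<cdot>\<^sub>m v) * (c \<cdot>\<^sub>m v) = 1\<^sub>m 1"
  proof (rule eq_matI)
    fix i j assume "i < dim_row (1\<^sub>m 1 :: 'f mat)" "j < dim_col (1\<^sub>m 1 :: 'f mat)"
    then have ij: "i = 0" "j = 0" by auto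
    have "(mat_adjoint (c \<cdot>\<^sub>m v) * (c \<cdot>\<^sub>m v)) $$ (0, 0) =
        (\<Sum>k<m. mat_adjoint (c \<cdot>\<^sub>m v) $$ (0, k) * (c \<cdot>\<^sub>m v) $$ (k, 0))"
      using v(1) by (intro index_mult_mat_sum) auto
    also have "\<dots> = c * c * s"
      unfolding s_def sum_distrib_left using v(1) c(1)
      by (intro sum.cong) (auto simp: conjugate_dist_mul mult_ac)
    finally show "(mat_adjoint (c \<cdot>\<^sub>m v) * (c \<cdot>\<^sub>m v)) $$ (i, j) = 1\<^sub>m 1 $$ (i, j)"
      using c ij by simp
  qed (use v in auto)
  then show ?thesis
    using v(1) by (auto simp: isometry_def)
qed

lemma exists_nonzero_column:
  fixes R :: "'f::semiring_1 mat"
  assumes R: "R \<in> carrier_mat m q" "R \<noteq> 0\<^sub>m m q"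
  shows "\<exists>x \<in> carrier_mat q 1. R * x \<noteq> 0\<^sub>m m 1"
proof -
  obtain i j where ij: "i < m" "j < q" "R $$ (i, j) \<noteq> 0"
  proof (rule ccontr)
    assume "\<not> thesis"
    then have "R = 0\<^sub>m m q" using R(1) that by (intro eq_matI) auto
    then show False using R(2) by simp
  qed
  define x :: "'f mat" where "x = mat q 1 (\<lambda>(k, _). if k = j then 1 else 0)"
  have x: "x \<in> carrier_mat q 1" by (simp add: x_def)
  have "(R * x) $$ (i, 0) = (\<Sum>k<q. R $$ (i, k) * x $$ (k, 0))"
    using R(1) x ij by (intro index_mult_mat_sum) auto
  also have "\<dots> = (\<Sum>k<q. if k = j then R $$ (i, k) else 0)"
    by (intro sum.cong) (auto simp: x_def)
  also have "\<dots> = R $$ (i, j)"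
    using ij by (simp add: sum.delta)
  finally have "R * x \<noteq> 0\<^sub>m m 1"
    using ij by auto
  then show ?thesis using x by blast
qed

lemma mult_smult_mat [mat_algebra]:
  "dim_col A = dim_row B \<Longrightarrow> A * (c \<cdot>\<^sub>m B) = c \<cdot>\<^sub>m (A * (B :: 'f::comm_semiring_0 mat))"
  "dim_col A = dim_row B \<Longrightarrow> (c \<cdot>\<^sub>m A) * B = c \<cdot>\<^sub>m (A * (B :: 'f::comm_semiring_0 mat))"
  using mult_smult_distrib[of A _ _ B _ c] mult_smult_assoc_mat[of A _ _ B _ c] by auto

lemma smult_smult_mat: "a \<cdot>\<^sub>m (b \<cdot>\<^sub>m A) = (a * b) \<cdot>\<^sub>m (A :: 'f::semigroup_mult mat)"
  by (rule eq_matI) (auto simp: mult.assoc)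

lemma mult_minus_mat [mat_algebra]:
  "dim_col A = dim_row B \<Longrightarrow> dim_row B = dim_row C \<Longrightarrow> dim_col B = dim_col C \<Longrightarrow>
     A * (B - C) = A * B - A * (C :: 'f::ring mat)"
  by (rule mult_minus_distrib_mat) auto

text \<open>
  The unit vector is obtained as a combination of the columns of \<open>R\<close>, so that it inherits their linear
  properties, such as being eigenvectors.
\<close>

lemma exists_orthogonal_unit_column:
  fixes R :: "'f::rc_scalar mat"
  assumes W: "isometry m n W" and R: "R \<in> carrier_mat m q" "R \<noteq> 0\<^sub>m m q"
    and orth: "mat_adjoint W * R = 0\<^sub>m n q"
  shows "\<exists>x \<in> carrier_mat q 1. isometry m 1 (R * x) \<and> mat_adjoint W * (R * x) = 0\<^sub>m n 1"
proof -
  obtain x where x: "x \<in> carrier_mat q 1" "R * x \<noteq> 0\<^sub>m m 1"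
    using exists_nonzero_column[OF R] by blast
  have "R * x \<in> carrier_mat m 1" using R x by auto
  from exists_unit_multiple[OF this x(2)] obtain c where c: "isometry m 1 (c \<cdot>\<^sub>m (R * x))"
    by blast
  note d = carrier_matD[OF isometryD(1)[OF W]] carrier_matD[OF R(1)] carrier_matD[OF x(1)]
  have "R * (c \<cdot>\<^sub>m x) = c \<cdot>\<^sub>m (R * x)"
    by (simp add: mat_algebra d)
  moreover have "mat_adjoint W * (R * (c \<cdot>\<^sub>m x)) = 0\<^sub>m n 1"
    by (subst mult_mat_assoc_eq[OF orth]) (simp_all add: d)
  ultimately show ?thesis
    using c x by (intro bexI[of _ "c \<cdot>\<^sub>m x"]) auto
qed

lemma isometry_residual:
  assumes W: "isometry m n W" and R: "R \<in> carrier_mat m q"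
  shows "mat_adjoint W * (R - W * (mat_adjoint W * R)) = 0\<^sub>m n q"
proof -
  note W' = isometryD[OF W]
  note d = carrier_matD[OF W'(1)] carrier_matD[OF R]
  have "mat_adjoint W * (W * (mat_adjoint W * R)) = mat_adjoint W * R"
    by (subst mult_mat_assoc_eq[OF W'(2)]) (simp_all add: d)
  then show ?thesis
    by (subst mult_minus_mat) (auto simp: d)
qed

lemma minus_mat_eq_zero_iff:
  assumes "A \<in> carrier_mat m n" "B \<in> carrier_mat m n"
  shows "A - B = 0\<^sub>m m n \<longleftrightarrow> A = (B :: 'f::group_add mat)"
proof
  assume eq: "A - B = 0\<^sub>m m n"
  have "A $$ (i, j) = B $$ (i, j)" if "i < m" "j < n" for i j
    using arg_cong[OF eq, of "\<lambda>M. M $$ (i, j)"] that assms by auto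
  then show "A = B"
    using assms by (intro eq_matI) auto
qed (use assms in auto)

text \<open>
  Unit vectors are added one by one: as long as the isometry is not square, its range has a nonzero
  residual in the identity matrix.
\<close>

lemma isometry_complement:
  fixes W :: "'f::rc_scalar mat"
  assumes "isometry m n W"
  shows "\<exists>W'. isometry m (m - n) W' \<and> mat_adjoint W * W' = 0\<^sub>m n (m - n)"
  using assms
proof (induction "m - n" arbitrary: n W)
  case 0
  then have "m = n" using isometry_dim_le by fastforce
  then show ?case
    using 0 by (intro exI[of _ "0\<^sub>m m 0"]) (auto simp: isometry_def intro!: eq_matI)
next
  case (Suc d)
  note W = isometryD[OF Suc.prems]
  note dW = carrier_matD[OF W(1)]
  let ?R = "1\<^sub>m m - W * (mat_adjoint W * 1\<^sub>m m)"
  have R: "?R \<in> carrier_mat m m" using W by auto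
  have "?R \<noteq> 0\<^sub>m m m"
  proof
    assume "?R = 0\<^sub>m m m"
    then have "W * mat_adjoint W = 1\<^sub>m m"
      using W by (subst (asm) minus_mat_eq_zero_iff) (auto simp: dW)
    then have "m \<le> n"
      using W by (intro left_inverse_imp_le[of "mat_adjoint W" n m W]) auto
    then show False using Suc.hyps by simp
  qed
  from exists_orthogonal_unit_column[OF Suc.prems R this isometry_residual[OF Suc.prems]]
  obtain u where u: "isometry m 1 u" "mat_adjoint W * u = 0\<^sub>m n 1" by auto
  note du = isometryD[OF u(1)]
  have V: "isometry m (n + 1) (hstack W u)"
    using isometry_hstack[OF Suc.prems u] .
  have "d = m - (n + 1)" using Suc.hyps by simp
  from Suc.hyps(1)[OF this V] obtain V' where
    V': "isometry m d V'" "mat_adjoint (hstack W u) * V' = 0\<^sub>m (n + 1) d"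
    using \<open>d = m - (n + 1)\<close> by auto
  note dV' = isometryD[OF V'(1)]
  have "vstack (mat_adjoint W * V') (mat_adjoint u * V') = vstack (0\<^sub>m n d) (0\<^sub>m 1 d)"
  proof -
    have "vstack (mat_adjoint W * V') (mat_adjoint u * V') = mat_adjoint (hstack W u) * V'"
      using W du dV' by (simp add: mat_adjoint_hstack[of _ m n _ 1] vstack_mult[of _ m d _ n _ 1])
    also have "\<dots> = vstack (0\<^sub>m n d) (0\<^sub>m 1 d)"
      unfolding V'(2) by (rule eq_matI) (auto simp: vstack_def)
    finally show ?thesis .
  qed
  then have orth: "mat_adjoint W * V' = 0\<^sub>m n d" "mat_adjoint u * V' = 0\<^sub>m 1 d"
    using W(1) du(1) dV'(1)
      vstack_eq_iff[of "mat_adjoint W * V'" n d "mat_adjoint u * V'" 1 "0\<^sub>m n d" "0\<^sub>m 1 d"]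
    by (metis mat_adjoint_carrier mult_carrier_mat zero_carrier_mat)+
  have "isometry m (1 + d) (hstack u V')"
    using isometry_hstack[OF u(1) V'(1) orth(2)] .
  moreover have "mat_adjoint W * hstack u V' = 0\<^sub>m n (1 + d)"
    using W du dV' u(2) orth(1)
    by (simp add: mult_hstack[of _ n m _ 1 _ d]) (auto simp: hstack_def intro!: eq_matI)
  moreover have "m - n = 1 + d" using Suc.hyps by simp
  ultimately show ?case by metis
qed

lemma isometry_complement_resolution:
  fixes W :: "'f::rc_scalar mat"
  assumes W: "isometry m n W" and W': "isometry m (m - n) W'"
    and orth: "mat_adjoint W * W' = 0\<^sub>m n (m - n)"
  shows "unitary m (hstack W W')" "W * mat_adjoint W + W' * mat_adjoint W' = 1\<^sub>m m"
proof -
  have "isometry m (n + (m - n)) (hstack W W')"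
    by (rule isometry_hstack[OF W W' orth])
  then show U: "unitary m (hstack W W')"
    using isometry_dim_le[OF W] by (intro isometry_square_imp_unitary) simp
  then have "hstack W W' * mat_adjoint (hstack W W') = 1\<^sub>m m"
    by (simp add: unitary_def)
  then show "W * mat_adjoint W + W' * mat_adjoint W' = 1\<^sub>m m"
    using isometryD(1)[OF W] isometryD(1)[OF W']
    by (simp add: mat_adjoint_hstack[of _ m n _ "m - n"]
        hstack_mult_vstack[of _ m n _ "m - n" _ m])
qed

text \<open>
  The columns of \<open>W\<close> are a maximal orthonormal family of eigenvectors. A vector of the eigenspace
  outside their span would leave a residual that extends the family.
\<close>

lemma eigenspace_isometry:
  fixes P :: "'f::rc_scalar mat"
  assumes P: "P \<in> carrier_mat n n" "mat_adjoint P = P" and n: "0 < n"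
  shows "\<exists>c p W. 1 \<le> p \<and> isometry n p W \<and> P * W = c \<cdot>\<^sub>m W \<and>
     (\<forall>q. \<forall>R \<in> carrier_mat n q. P * R = c \<cdot>\<^sub>m R \<longrightarrow> W * (mat_adjoint W * R) = R)"
proof -
  define h where "h i j = (if i < n \<and> j < n then P $$ (i, j) else 0)" for i j
  have "h j i = conjugate (h i j)" for i j
    using P(1) arg_cong[OF P(2), of "\<lambda>M. M $$ (j, i)"] by (auto simp: h_def)
  from hermitian_eigenvector[of h, OF this n] obtain c v i0 where
    v: "i0 < n" "v i0 \<noteq> 0" "\<And>i. i < n \<Longrightarrow> (\<Sum>j<n. h i j * v j) = c * v i" by blast
  define w where "w = mat n 1 (\<lambda>(i, _). v i)"
  have w: "w \<in> carrier_mat n 1" by (simp add: w_def)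
  have Pw: "P * w = c \<cdot>\<^sub>m w"
  proof (rule eq_matI)
    fix i j assume "i < dim_row (c \<cdot>\<^sub>m w)" "j < dim_col (c \<cdot>\<^sub>m w)"
    then have ij: "i < n" "j = 0" by (auto simp: w_def)
    have "(P * w) $$ (i, 0) = (\<Sum>k<n. P $$ (i, k) * w $$ (k, 0))"
      using P(1) w ij by (intro index_mult_mat_sum) auto
    also have "\<dots> = (\<Sum>k<n. h i k * v k)"
      using ij by (intro sum.cong) (auto simp: h_def w_def)
    finally show "(P * w) $$ (i, j) = (c \<cdot>\<^sub>m w) $$ (i, j)"
      using v(3)[of i] ij by (simp add: w_def)
  qed (use P(1) w in auto)
  have "w \<noteq> 0\<^sub>m n 1"
  proof
    assume "w = 0\<^sub>m n 1"
    then have "w $$ (i0, 0) = 0" using v(1) by simp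
    then show False using v(1,2) by (simp add: w_def)
  qed
  from exists_unit_multiple[OF w this] obtain k where k: "isometry n 1 (k \<cdot>\<^sub>m w)" by blast
  define S where "S = {p. \<exists>W. isometry n p W \<and> P * W = c \<cdot>\<^sub>m W}"
  have "P * (k \<cdot>\<^sub>m w) = c \<cdot>\<^sub>m (k \<cdot>\<^sub>m w)"
    using P(1) w Pw by (subst mult_smult_mat) (auto simp: smult_smult_mat mult.commute)
  then have S1: "1 \<in> S" using k by (auto simp: S_def)
  have "S \<subseteq> {..n}" using isometry_dim_le by (auto simp: S_def)
  then have fin: "finite S" using finite_subset by blast
  define p where "p = Max S"
  have "p \<in> S" "1 \<le> p"
    using S1 fin by (auto simp: p_def intro: Max_in)
  then obtain W where W: "isometry n p W" "P * W = c \<cdot>\<^sub>m W" by (auto simp: S_def)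
  note cW = isometryD[OF W(1)]
  have "W * (mat_adjoint W * R) = R" if R: "R \<in> carrier_mat n q" "P * R = c \<cdot>\<^sub>m R" for q R
  proof (rule ccontr)
    let ?r = "R - W * (mat_adjoint W * R)"
    assume neq: "W * (mat_adjoint W * R) \<noteq> R"
    note d = carrier_matD[OF cW(1)] carrier_matD[OF R(1)] carrier_matD[OF P(1)]
    have r: "?r \<in> carrier_mat n q" using cW R by auto
    have r0: "?r \<noteq> 0\<^sub>m n q"
      using neq R cW by (subst minus_mat_eq_zero_iff) auto
    from exists_orthogonal_unit_column[OF W(1) r r0 isometry_residual[OF W(1) R(1)]]
    obtain x where x: "x \<in> carrier_mat q 1" "isometry n 1 (?r * x)"
      "mat_adjoint W * (?r * x) = 0\<^sub>m p 1" by blast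
    have "P * (W * (mat_adjoint W * R)) = c \<cdot>\<^sub>m (W * (mat_adjoint W * R))"
      by (subst mult_mat_assoc_eq[OF W(2)]) (simp_all add: d mat_algebra)
    then have "P * ?r = c \<cdot>\<^sub>m R - c \<cdot>\<^sub>m (W * (mat_adjoint W * R))"
      by (subst mult_minus_mat) (simp_all add: d R(2))
    also have "\<dots> = c \<cdot>\<^sub>m ?r"
      by (intro eq_matI) (auto simp: d algebra_simps)
    finally have "P * (?r * x) = c \<cdot>\<^sub>m (?r * x)"
      using x(1) by (subst mult_mat_assoc_eq) (auto simp: d mat_algebra)
    then have "P * hstack W (?r * x) = hstack (c \<cdot>\<^sub>m W) (c \<cdot>\<^sub>m (?r * x))"
      using W(2) P(1) cW(1) isometryD(1)[OF x(2)] by (simp only: mult_hstack)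
    also have "\<dots> = c \<cdot>\<^sub>m hstack W (?r * x)"
      using x(1) by (intro eq_matI) (auto simp: hstack_def d)
    finally have "p + 1 \<in> S"
      using isometry_hstack[OF W(1) x(2,3)] unfolding S_def by blast
    then have "p + 1 \<le> p" unfolding p_def using Max_ge[OF fin] by blast
    then show False by simp
  qed
  then show ?thesis
    using \<open>1 \<le> p\<close> W by blast
qed

section \<open>Matrix convex sets and their extreme points\<close>

definition compression :: "'f::conjugatable_field mat \<Rightarrow> ('g \<Rightarrow> 'f mat) \<Rightarrow> 'g \<Rightarrow> 'f mat" where
  "compression W Z = (\<lambda>a. mat_adjoint W * Z a * W)"

lemma SM_D:
  assumes "X \<in> SM n"
  shows "X a \<in> carrier_mat n n" "mat_adjoint (X a) = X a" "dim_row (X a) = n" "dim_col (X a) = n"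
  using assms by (auto simp: SM_def mat_tuples_def)

lemma SM_I:
  assumes "\<And>a. X a \<in> carrier_mat n n" "\<And>a. mat_adjoint (X a) = X a"
  shows "X \<in> SM n"
  using assms by (auto simp: SM_def mat_tuples_def)

lemma levelD: "X \<in> level K n \<Longrightarrow> X \<in> SM n" "X \<in> level K n \<Longrightarrow> X \<in> K"
  by (auto simp: level_def)

lemma compression_SM:
  assumes "Z \<in> SM m" "W \<in> carrier_mat m n"
  shows "compression W Z \<in> SM n"
  using assms SM_D[OF assms(1)] conjugation_hermitian[OF SM_D(1,2)[OF assms(1)] assms(2)]
  by (intro SM_I) (auto simp: compression_def)

lemma compression_hstack:
  assumes Z: "Z \<in> SM m" and W: "W \<in> carrier_mat m n" and W': "W' \<in> carrier_mat m l"
  shows "compression (hstack W W') Z =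
    block_tuple (compression W Z) (\<lambda>a. mat_adjoint W * Z a * W') (compression W' Z)"
proof
  fix a
  note Za = SM_D[OF Z, of a]
  note d = Za(3,4) carrier_matD[OF W] carrier_matD[OF W']
  have "compression (hstack W W') Z a =
      vstack (mat_adjoint W) (mat_adjoint W') * (Z a * hstack W W')"
    using W W' unfolding compression_def mat_adjoint_hstack[OF W W']
    by (intro mult_mat_assoc) (auto simp: d vstack_def hstack_def)
  also have "\<dots> = vstack (mat_adjoint W) (mat_adjoint W') * hstack (Z a * W) (Z a * W')"
    by (simp only: mult_hstack[OF Za(1) W W'])
  also have "\<dots> = four_block_mat (mat_adjoint W * (Z a * W)) (mat_adjoint W * (Z a * W'))
      (mat_adjoint W' * (Z a * W)) (mat_adjoint W' * (Z a * W'))"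
    using W W' Za(1) by (intro vstack_mult_hstack) auto
  also have "\<dots> = block_tuple (compression W Z) (\<lambda>a. mat_adjoint W * Z a * W') (compression W' Z) a"
    by (simp add: block_tuple_def compression_def mat_algebra d Za(2))
  finally show "compression (hstack W W') Z a =
    block_tuple (compression W Z) (\<lambda>a. mat_adjoint W * Z a * W') (compression W' Z) a" .
qed

lemma compression_direct_sum:
  assumes Z: "Z \<in> SM m" and Y: "Y \<in> SM q" and A: "A \<in> carrier_mat m n" and B: "B \<in> carrier_mat q n"
  shows "compression (vstack A B) (direct_sum Z Y) a = compression A Z a + compression B Y a"
    and "direct_sum Z Y a * vstack A B = vstack (Z a * A) (Y a * B)"
proof -
  note Za = SM_D[OF Z, of a] and Ya = SM_D[OF Y, of a]
  note d = Za(3,4) Ya(3,4) carrier_matD[OF A] carrier_matD[OF B]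
  show *: "direct_sum Z Y a * vstack A B = vstack (Z a * A) (Y a * B)"
    unfolding direct_sum_def d by (rule diag_block_mult_vstack) (use Za Ya A B in auto)
  have "compression (vstack A B) (direct_sum Z Y) a =
      hstack (mat_adjoint A) (mat_adjoint B) * (direct_sum Z Y a * vstack A B)"
    unfolding compression_def mat_adjoint_vstack[OF A B]
    by (intro mult_mat_assoc) (auto simp: d vstack_def hstack_def direct_sum_def)
  also have "\<dots> = mat_adjoint A * (Z a * A) + mat_adjoint B * (Y a * B)"
    unfolding * using A B Za Ya by (intro hstack_mult_vstack) auto
  finally show "compression (vstack A B) (direct_sum Z Y) a = compression A Z a + compression B Y a"
    by (simp add: compression_def mat_algebra d)
qed

lemma compression_mult:
  assumes "Z \<in> SM m" "V \<in> carrier_mat m p" "W \<in> carrier_mat p n"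
  shows "compression (V * W) Z = compression W (compression V Z)"
  using SM_D[OF assms(1)] carrier_matD[OF assms(2)] carrier_matD[OF assms(3)]
  by (simp add: compression_def mat_algebra)

lemma compression_one: "Z \<in> SM m \<Longrightarrow> compression (1\<^sub>m m) Z = Z"
  using SM_D[of Z m] by (auto simp: compression_def)

lemma isometry_inclusion: "isometry (n + l) n (vstack (1\<^sub>m n) (0\<^sub>m l n) :: 'f::conjugatable_field mat)"
proof -
  have "mat_adjoint (vstack (1\<^sub>m n) (0\<^sub>m l n)) * vstack (1\<^sub>m n) (0\<^sub>m l n :: 'f mat) = 1\<^sub>m n"
    by (subst mat_adjoint_vstack[of _ n n _ l]; simp?) (subst hstack_mult_vstack[of _ n n _ l _ n]; simp)
  then show ?thesis
    by (auto simp: isometry_def)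
qed

lemma block_tuple_inclusion:
  assumes X: "X \<in> SM n" and \<beta>: "\<beta> \<in> mat_tuples n l" and \<gamma>: "\<gamma> \<in> SM l"
  shows "block_tuple X \<beta> \<gamma> a * vstack (1\<^sub>m n) (0\<^sub>m l n) = vstack (X a) (mat_adjoint (\<beta> a))"
    and "compression (vstack (1\<^sub>m n) (0\<^sub>m l n)) (block_tuple X \<beta> \<gamma>) = X"
proof -
  have \<beta>a: "\<beta> a \<in> carrier_mat n l" for a using \<beta> by (auto simp: mat_tuples_def)
  note Xa = SM_D[OF X] and \<gamma>a = SM_D[OF \<gamma>]
  note d = Xa(3,4) \<gamma>a(3,4) carrier_matD[OF \<beta>a]
  show *: "block_tuple X \<beta> \<gamma> a * vstack (1\<^sub>m n) (0\<^sub>m l n) = vstack (X a) (mat_adjoint (\<beta> a))" for a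
    unfolding block_tuple_def
    by (subst four_block_mult_vstack[of _ n n _ l _ l _ _ n]) (use Xa \<beta>a \<gamma>a in \<open>auto simp: d\<close>)
  show "compression (vstack (1\<^sub>m n) (0\<^sub>m l n)) (block_tuple X \<beta> \<gamma>) = X"
  proof
    fix a
    have "compression (vstack (1\<^sub>m n) (0\<^sub>m l n)) (block_tuple X \<beta> \<gamma>) a =
        mat_adjoint (vstack (1\<^sub>m n) (0\<^sub>m l n)) * (block_tuple X \<beta> \<gamma> a * vstack (1\<^sub>m n) (0\<^sub>m l n))"
      unfolding compression_def by (intro mult_mat_assoc) (auto simp: block_tuple_def vstack_def d)
    also have "\<dots> = hstack (1\<^sub>m n) (0\<^sub>m n l) * vstack (X a) (mat_adjoint (\<beta> a))"
      unfolding * by (subst mat_adjoint_vstack[of _ n n _ l]) auto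
    also have "\<dots> = X a"
      by (subst hstack_mult_vstack[of _ n n _ l _ n]) (use Xa \<beta>a in \<open>auto simp: d\<close>)
    finally show "compression (vstack (1\<^sub>m n) (0\<^sub>m l n)) (block_tuple X \<beta> \<gamma>) a = X a" .
  qed
qed

lemma mult_add_mat:
  "dim_col A = dim_row B \<Longrightarrow> dim_row B = dim_row C \<Longrightarrow> dim_col B = dim_col C \<Longrightarrow>
     A * (B + C) = A * B + A * (C :: 'f::semiring_0 mat)"
  "dim_row A = dim_row B \<Longrightarrow> dim_col A = dim_col B \<Longrightarrow> dim_col B = dim_row C \<Longrightarrow>
     (A + B) * C = A * C + B * (C :: 'f::semiring_0 mat)"
  by (rule mult_add_distrib_mat, auto)[1] (rule add_mult_distrib_mat, auto)[1]

lemma vstack_eqD: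
  assumes "vstack A B = vstack C D"
    and "dim_row A = dim_row C" "dim_row B = dim_row D"
    and "dim_col A = dim_col B" "dim_col C = dim_col D" "dim_col A = dim_col C"
  shows "A = C" "B = D"
proof -
  have "A = C \<and> B = D"
    by (rule iffD1[OF vstack_eq_iff[of A "dim_row A" "dim_col A" B "dim_row B" C D] assms(1)])
      (use assms(2-) in \<open>auto intro!: carrier_matI\<close>)
  then show "A = C" "B = D" by auto
qed

text \<open>
  A subspace that a self-adjoint tuple maps into itself splits the tuple: its complement is mapped
  into itself as well.
\<close>

lemma reducing_subspace_splits:
  fixes X :: "'g \<Rightarrow> 'f::rc_scalar mat"
  assumes X: "X \<in> SM n" and V: "isometry n p V" and V': "isometry n (n - p) V'"
    and orth: "mat_adjoint V * V' = 0\<^sub>m p (n - p)"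
    and reducing: "X a * V = V * compression V X a"
  shows "X a * V' = V' * compression V' X a"
    and "X a = V * compression V X a * mat_adjoint V + V' * compression V' X a * mat_adjoint V'"
proof -
  note Xa = SM_D[OF X, of a]
  note cV = isometryD[OF V] and cV' = isometryD[OF V']
  note d = Xa(3,4) carrier_matD[OF cV(1)] carrier_matD[OF cV'(1)]
  note res = isometry_complement_resolution(2)[OF V V' orth]
  have orth': "mat_adjoint V' * V = 0\<^sub>m (n - p) p"
    using arg_cong[OF orth, of mat_adjoint] by (simp add: mat_algebra d)
  have C: "compression V X a \<in> carrier_mat p p" "compression V' X a \<in> carrier_mat (n - p) (n - p)"
    using compression_SM[OF X cV(1)] compression_SM[OF X cV'(1)] by (auto simp: SM_D)
  have "mat_adjoint V' * (X a * V) = 0\<^sub>m (n - p) p"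
    unfolding reducing using C by (subst mult_mat_assoc_eq[OF orth']) (auto simp: d)
  from arg_cong[OF this, of mat_adjoint]
  have VXV': "mat_adjoint V * (X a * V') = 0\<^sub>m p (n - p)"
    by (simp add: mat_algebra d Xa(2))
  have XV': "X a * V' \<in> carrier_mat n (n - p)" using Xa cV' by auto
  have "X a * V' = (V * mat_adjoint V + V' * mat_adjoint V') * (X a * V')"
    unfolding res by (simp add: d)
  also have "\<dots> = V * (mat_adjoint V * (X a * V')) + V' * (mat_adjoint V' * (X a * V'))"
    using cV cV' XV' by (subst add_mult_distrib_mat[of _ n n _ _ "n - p"]) (auto simp: mat_algebra d)
  also have "\<dots> = V' * (mat_adjoint V' * (X a * V'))"
    unfolding VXV' using cV by (auto simp: mat_algebra d)
  finally show *: "X a * V' = V' * compression V' X a"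
    by (simp add: compression_def mat_algebra d)
  have "X a = X a * (V * mat_adjoint V + V' * mat_adjoint V')"
    unfolding res by (simp add: d)
  also have "\<dots> = (X a * V) * mat_adjoint V + (X a * V') * mat_adjoint V'"
    using cV cV' Xa by (subst mult_add_distrib_mat[of _ n n _ n]) (auto simp: mat_algebra d)
  finally show "X a = V * compression V X a * mat_adjoint V + V' * compression V' X a * mat_adjoint V'"
    unfolding * reducing .
qed

lemma mat_sum_carrier [simp]: "mat_sum m n M I \<in> carrier_mat m n"
  by (simp add: mat_sum_def)

lemma mat_sum_lessThan_add:
  "mat_sum m n M {..<p + (q::nat)} = mat_sum m n M {..<p} + mat_sum m n (\<lambda>i. M (p + i)) {..<q}"
  by (rule eq_matI) (auto simp: mat_sum_def sum_lessThan_add)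

lemma mat_sum_Suc:
  assumes "M (k::nat) \<in> carrier_mat m n"
  shows "mat_sum m n M {..<Suc k} = mat_sum m n M {..<k} + M k"
  using assms by (intro eq_matI) (auto simp: mat_sum_def)

lemma mat_sum_cong:
  "(\<And>i. i \<in> I \<Longrightarrow> M i = N i) \<Longrightarrow> mat_sum m n M I = mat_sum m n N I"
  by (auto simp: mat_sum_def intro!: arg_cong[of _ _ "mat m n"] ext sum.cong)

lemma mat_sum_empty: "mat_sum m n M {} = 0\<^sub>m m n"
  by (rule eq_matI) (auto simp: mat_sum_def)

lemma mat_sum_conjugation:
  fixes M :: "nat \<Rightarrow> 'f::conjugatable_field mat"
  assumes "T \<in> carrier_mat n m" "\<And>i. i < k \<Longrightarrow> M i \<in> carrier_mat n n"
  shows "mat_adjoint T * mat_sum n n M {..<k} * T = mat_sum m m (\<lambda>i. mat_adjoint T * M i * T) {..<k}"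
  using assms(2)
proof (induction k)
  case 0
  then show ?case using assms(1) by (simp add: mat_sum_empty)
next
  case (Suc k)
  let ?S = "mat_sum n n M {..<k}"
  have S: "?S \<in> carrier_mat n n" "M k \<in> carrier_mat n n" using Suc.prems by auto
  have "mat_adjoint T * (?S + M k) * T = mat_adjoint T * ?S * T + mat_adjoint T * M k * T"
    using carrier_matD[OF assms(1)] carrier_matD[OF S(2)]
    by (simp add: mult_add_mat carrier_matD[OF mat_sum_carrier])
  moreover have "mat_adjoint T * M k * T \<in> carrier_mat m m"
    using assms(1) S by auto
  ultimately show ?case
    using S Suc by (simp add: mat_sum_Suc)
qed

text \<open>
  Closure under compressions by isometries and under direct sums amounts to closure under matrix convex
  combinations: stacking the \<open>V\<^sub>i\<close> turns a combination into one compression of a direct sum.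
\<close>

locale matrix_convex_set =
  fixes K :: "('g \<Rightarrow> 'f::rc_scalar mat) set"
  assumes graded: "X \<in> K \<Longrightarrow> \<exists>n\<ge>1. X \<in> SM n"
    and compression_closed:
      "Z \<in> level K m \<Longrightarrow> isometry m n W \<Longrightarrow> 1 \<le> n \<Longrightarrow> compression W Z \<in> level K n"
    and direct_sum_closed:
      "X \<in> level K m \<Longrightarrow> Y \<in> level K n \<Longrightarrow> direct_sum X Y \<in> level K (m + n)"
begin

lemma level_pos: "X \<in> level K n \<Longrightarrow> 1 \<le> n"
  using graded[of X] SM_D(3)[of X] by (metis levelD)

lemma level_graded: "X \<in> K \<Longrightarrow> \<exists>n\<ge>1. X \<in> level K n"
  using graded[of X] by (auto simp: level_def)

text \<open>
  The Arveson extreme property in a form without blocks: the first columns of a unitary are replaced by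
  an arbitrary isometry. This form is visibly invariant under unitaries.
\<close>

definition rigid :: "nat \<Rightarrow> ('g \<Rightarrow> 'f mat) \<Rightarrow> bool" where
  "rigid n X \<longleftrightarrow> X \<in> level K n \<and>
     (\<forall>m Z W. Z \<in> level K m \<longrightarrow> isometry m n W \<longrightarrow> compression W Z = X \<longrightarrow>
        (\<forall>a. Z a * W = W * X a))"

lemma rigidD:
  "rigid n X \<Longrightarrow> Z \<in> level K m \<Longrightarrow> isometry m n W \<Longrightarrow> compression W Z = X \<Longrightarrow> Z a * W = W * X a"
  by (auto simp: rigid_def)

lemma rigid_level: "rigid n X \<Longrightarrow> X \<in> level K n"
  by (auto simp: rigid_def)

text \<open>
  A unitary completion of \<open>W\<close> turns \<open>Z\<close> into a dilation of \<open>X\<close>. Its off-diagonal block vanishes, that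
  is, \<open>Z\<close> maps the range of \<open>W\<close> into itself.
\<close>

lemma arveson_extreme_imp_rigid:
  assumes X: "arveson_extreme_point K n X"
  shows "rigid n X"
  unfolding rigid_def
proof (intro conjI allI impI)
  show Xl: "X \<in> level K n" using X by (simp add: arveson_extreme_point_def)
  fix m Z W a
  assume Z: "Z \<in> level K m" and W: "isometry m n W" and WZ: "compression W Z = X"
  note ZS = levelD(1)[OF Z]
  note cW = isometryD[OF W] and nm = isometry_dim_le[OF W]
  obtain W' where W': "isometry m (m - n) W'" "mat_adjoint W * W' = 0\<^sub>m n (m - n)"
    using isometry_complement[OF W] by blast
  note cW' = isometryD[OF W'(1)]
  note d = SM_D(3,4)[OF ZS] carrier_matD[OF cW(1)] carrier_matD[OF cW'(1)]
  define \<beta> where "\<beta> = (\<lambda>a. mat_adjoint W * Z a * W')"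
  have \<beta>: "\<beta> \<in> mat_tuples n (m - n)"
    by (auto simp: mat_tuples_def \<beta>_def d intro!: carrier_matI)
  have "\<beta> = (\<lambda>_. 0\<^sub>m n (m - n))"
  proof (cases "m - n \<ge> 1")
    case True
    have "isometry m m (hstack W W')"
      using isometry_hstack[OF W W'] nm by simp
    then have "compression (hstack W W') Z \<in> level K (n + (m - n))"
      using compression_closed[OF Z] level_pos[OF Z] nm by simp
    then have "block_tuple X \<beta> (compression W' Z) \<in> level K (n + (m - n))"
      unfolding compression_hstack[OF ZS cW(1) cW'(1)] WZ \<beta>_def .
    moreover have "compression W' Z \<in> SM (m - n)"
      by (rule compression_SM[OF ZS cW'(1)])
    ultimately show ?thesis
      using X \<beta> True unfolding arveson_extreme_point_def by blast
  next
    case False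
    then have "m - n = 0" by simp
    then have "dim_row (\<beta> a) = n" "dim_col (\<beta> a) = 0" for a
      using \<beta> by (auto simp: mat_tuples_def)
    then show ?thesis using \<open>m - n = 0\<close> by (auto intro!: ext eq_matI)
  qed
  then have "mat_adjoint (\<beta> a) = 0\<^sub>m (m - n) n" by simp
  then have \<beta>0: "mat_adjoint W' * (Z a * W) = 0\<^sub>m (m - n) n"
    by (simp add: \<beta>_def mat_algebra d SM_D(2)[OF ZS])
  have ZW: "Z a * W \<in> carrier_mat m n" using cW SM_D[OF ZS] by auto
  have "Z a * W = (W * mat_adjoint W + W' * mat_adjoint W') * (Z a * W)"
    unfolding isometry_complement_resolution(2)[OF W W'] by (simp add: d)
  also have "\<dots> = W * (mat_adjoint W * (Z a * W)) + W' * (mat_adjoint W' * (Z a * W))"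
    using cW cW' ZW by (subst add_mult_distrib_mat[of _ m m _ _ n]) (auto simp: mat_algebra d)
  also have "\<dots> = W * X a"
    unfolding \<beta>0 WZ[symmetric] compression_def by (simp add: mat_algebra d)
  finally show "Z a * W = W * X a" .
qed

lemma rigid_imp_arveson_extreme:
  assumes X: "rigid n X"
  shows "arveson_extreme_point K n X"
  unfolding arveson_extreme_point_def
proof (intro conjI allI impI ballI)
  show Xl: "X \<in> level K n" by (rule rigid_level[OF X])
  note XS = levelD(1)[OF Xl]
  fix l \<beta> \<gamma>
  assume \<beta>: "\<beta> \<in> mat_tuples n l" and \<gamma>: "\<gamma> \<in> SM l" and Z: "block_tuple X \<beta> \<gamma> \<in> level K (n + l)"
  note incl = block_tuple_inclusion[OF XS \<beta> \<gamma>]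
  have \<beta>a: "\<beta> a \<in> carrier_mat n l" for a using \<beta> by (auto simp: mat_tuples_def)
  have "\<beta> a = 0\<^sub>m n l" for a
  proof -
    have "vstack (X a) (mat_adjoint (\<beta> a)) = vstack (1\<^sub>m n) (0\<^sub>m l n) * X a"
      using rigidD[OF X Z isometry_inclusion incl(2)] unfolding incl(1) .
    also have "\<dots> = vstack (X a) (0\<^sub>m l n)"
      using SM_D[OF XS] by (subst vstack_mult[of _ n n _ n _ l]) auto
    finally have "mat_adjoint (\<beta> a) = 0\<^sub>m l n"
      using SM_D[OF XS] \<beta>a
      by (metis vstack_eq_iff mat_adjoint_carrier zero_carrier_mat)
    from arg_cong[OF this, of mat_adjoint] show ?thesis by simp
  qed
  then show "\<beta> = (\<lambda>_. 0\<^sub>m n l)" by blast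
qed

lemma rigid_unitary_conjugate:
  assumes X: "rigid n X" and U: "unitary n U"
  shows "rigid n (compression U X)"
  unfolding rigid_def
proof (intro conjI allI impI)
  have cU: "U \<in> carrier_mat n n" "mat_adjoint U * U = 1\<^sub>m n" "U * mat_adjoint U = 1\<^sub>m n"
    using U by (auto simp: unitary_def)
  then have isoU: "isometry n n U" "isometry n n (mat_adjoint U)" by (auto simp: isometry_def)
  note XS = levelD(1)[OF rigid_level[OF X]]
  show "compression U X \<in> level K n"
    using compression_closed[OF rigid_level[OF X] isoU(1)] level_pos[OF rigid_level[OF X]] .
  fix m Z V a
  assume Z: "Z \<in> level K m" and V: "isometry m n V" and VZ: "compression V Z = compression U X"
  note cV = isometryD[OF V]
  note d = SM_D(3,4)[OF XS] SM_D(3,4)[OF levelD(1)[OF Z]] carrier_matD[OF cU(1)] carrier_matD[OF cV(1)]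
  have "compression (V * mat_adjoint U) Z = compression (U * mat_adjoint U) X"
    using cU(1) by (simp add: compression_mult[OF levelD(1)[OF Z] cV(1), of _ n] VZ
        compression_mult[OF XS cU(1), of _ n])
  then have "compression (V * mat_adjoint U) Z = X"
    using XS by (simp add: cU compression_one)
  from rigidD[OF X Z isometry_mult[OF V isoU(2)] this, of a]
  have "Z a * (V * mat_adjoint U) * U = V * mat_adjoint U * X a * U" by simp
  then show "Z a * V = V * compression U X a"
    by (simp add: mat_algebra d compression_def cU)
qed

lemma rigid_compression_dilates:
  assumes Z: "rigid m Z" and W: "isometry m n W"
  shows "\<exists>Y. dilation K n (m - n) (compression W Z) Y \<and> arveson_extreme_point K (n + (m - n)) Y"
proof -
  note ZS = levelD(1)[OF rigid_level[OF Z]]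
  obtain W' where W': "isometry m (m - n) W'" "mat_adjoint W * W' = 0\<^sub>m n (m - n)"
    using isometry_complement[OF W] by blast
  note cW = isometryD[OF W] and cW' = isometryD[OF W'(1)]
  let ?Y = "compression (hstack W W') Z"
  have mn: "n + (m - n) = m" using isometry_dim_le[OF W] by simp
  have Y: "rigid m ?Y"
    using rigid_unitary_conjugate[OF Z isometry_complement_resolution(1)[OF W W']] .
  have "(\<lambda>a. mat_adjoint W * Z a * W') \<in> mat_tuples n (m - n)"
    by (auto simp: mat_tuples_def carrier_matD[OF cW(1)] carrier_matD[OF cW'(1)] intro!: carrier_matI)
  then have "dilation K n (m - n) (compression W Z) ?Y"
    using rigid_level[OF Y] compression_hstack[OF ZS cW(1) cW'(1)] compression_SM[OF ZS cW'(1)]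
    unfolding dilation_def mn by blast
  then show ?thesis
    using rigid_imp_arveson_extreme[OF Y] unfolding mn by blast
qed

text \<open>
  A tuple \<open>Z\<close> that compresses to the summand gives, together with the complementary summand, a tuple that
  compresses to all of \<open>X\<close>, to which the rigidity of \<open>X\<close> applies.
\<close>

lemma rigid_summand:
  assumes X: "rigid n X" and V: "isometry n p V" and p: "1 \<le> p" "p < n"
    and reducing: "\<And>a. X a * V = V * compression V X a"
  shows "rigid p (compression V X)"
  unfolding rigid_def
proof (intro conjI allI impI)
  note Xl = rigid_level[OF X]
  note XS = levelD(1)[OF Xl]
  show X1: "compression V X \<in> level K p"
    using compression_closed[OF Xl V p(1)] .
  obtain V' where V': "isometry n (n - p) V'" "mat_adjoint V * V' = 0\<^sub>m p (n - p)"
    using isometry_complement[OF V] by blast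
  have X2: "compression V' X \<in> level K (n - p)"
    using compression_closed[OF Xl V'(1)] p by simp
  note cV = isometryD[OF V] and cV' = isometryD[OF V'(1)]
  fix m Z W a
  assume Z: "Z \<in> level K m" and W: "isometry m p W" and WZ: "compression W Z = compression V X"
  note cW = isometryD[OF W]
  note d = SM_D(3,4)[OF XS] SM_D(3,4)[OF levelD(1)[OF Z]] SM_D(3,4)[OF levelD(1)[OF X1]]
    SM_D(3,4)[OF levelD(1)[OF X2]]
    carrier_matD[OF cV(1)] carrier_matD[OF cV'(1)] carrier_matD[OF cW(1)]
  let ?A = "W * mat_adjoint V" and ?B = "mat_adjoint V'"
  have A: "?A \<in> carrier_mat m n" and B: "?B \<in> carrier_mat (n - p) n" using cW cV cV' by auto
  let ?T = "vstack ?A ?B"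
  have "mat_adjoint ?A * ?A = V * (mat_adjoint W * (W * mat_adjoint V))"
    by (simp add: mat_algebra d)
  then have AA: "mat_adjoint ?A * ?A = V * mat_adjoint V"
    by (simp add: mult_mat_assoc_eq[OF cW(2)] d)
  have "mat_adjoint ?T * ?T = mat_adjoint ?A * ?A + mat_adjoint ?B * ?B"
    unfolding mat_adjoint_vstack[OF A B]
    by (rule hstack_mult_vstack[of _ n m _ "n - p" _ n]) (use A B cV' in auto)
  also have "\<dots> = 1\<^sub>m n"
    unfolding AA using isometry_complement_resolution(2)[OF V V'] by simp
  finally have T: "isometry (m + (n - p)) n ?T"
    using A B by (auto simp: isometry_def)
  have "compression ?T (direct_sum Z (compression V' X)) = X"
  proof
    fix a
    have "compression ?A Z a = compression (mat_adjoint V) (compression W Z) a"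
      by (rule fun_cong[OF compression_mult[OF levelD(1)[OF Z] cW(1) mat_adjoint_carrier[OF cV(1)]]])
    then have "compression ?A Z a = V * compression V X a * mat_adjoint V"
      unfolding WZ by (simp add: compression_def)
    moreover have "compression ?B (compression V' X) a = V' * compression V' X a * mat_adjoint V'"
      by (simp add: compression_def)
    ultimately show "compression ?T (direct_sum Z (compression V' X)) a = X a"
      unfolding compression_direct_sum(1)[OF levelD(1)[OF Z] levelD(1)[OF X2] A B]
      by (simp only: reducing_subspace_splits(2)[OF XS V V' reducing, of a, symmetric])
  qed
  from rigidD[OF X direct_sum_closed[OF Z X2] T this, of a]
  have "vstack (Z a * ?A) (compression V' X a * ?B) = vstack (?A * X a) (?B * X a)"
    unfolding compression_direct_sum(2)[OF levelD(1)[OF Z] levelD(1)[OF X2] A B]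
    by (simp add: vstack_mult[OF SM_D(1)[OF XS] A B])
  then have "Z a * ?A = ?A * X a"
    by (rule vstack_eqD) (simp_all add: d)
  from arg_cong[OF this, of "\<lambda>M. M * V"]
  show "Z a * W = W * compression V X a"
    by (simp add: mat_algebra d cV compression_def)
qed

text \<open>The summands of a matrix convex combination, stacked into a single compression.\<close>

lemma stack_summands:
  assumes "\<And>i. i < Suc k \<Longrightarrow> V i \<in> carrier_mat (ns i) n \<and> Z i \<in> level K (ns i)"
  shows "\<exists>p P T. P \<in> carrier_mat p n \<and> T \<in> level K p \<and>
     mat_adjoint P * P = mat_sum n n (\<lambda>i. mat_adjoint (V i) * V i) {..<Suc k} \<and>
     compression P T = (\<lambda>a. mat_sum n n (\<lambda>i. mat_adjoint (V i) * Z i a * V i) {..<Suc k}) \<and>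
     (\<forall>Y \<in> carrier_mat n n. \<forall>a. T a * P = P * Y \<longrightarrow> (\<forall>i<Suc k. Z i a * V i = V i * Y))"
  using assms
proof (induction k)
  case 0
  then have V: "V 0 \<in> carrier_mat (ns 0) n" and Z: "Z 0 \<in> level K (ns 0)" by auto
  have "mat_adjoint (V 0) * V 0 = mat_sum n n (\<lambda>i. mat_adjoint (V i) * V i) {..<Suc 0}"
    using V by (subst mat_sum_Suc) (auto simp: mat_sum_empty)
  moreover have "compression (V 0) (Z 0) =
      (\<lambda>a. mat_sum n n (\<lambda>i. mat_adjoint (V i) * Z i a * V i) {..<Suc 0})"
    using V SM_D(1)[OF levelD(1)[OF Z]]
    by (subst mat_sum_Suc) (auto simp: mat_sum_empty compression_def fun_eq_iff)
  ultimately show ?case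
    using V Z by (intro exI[of _ "ns 0"] exI[of _ "V 0"] exI[of _ "Z 0"]) auto
next
  case (Suc k)
  have "V i \<in> carrier_mat (ns i) n \<and> Z i \<in> level K (ns i)" if "i < Suc k" for i
    using Suc.prems[of i] that by simp
  from Suc.IH[OF this] obtain p P T where P: "P \<in> carrier_mat p n" and T: "T \<in> level K p"
    and PP: "mat_adjoint P * P = mat_sum n n (\<lambda>i. mat_adjoint (V i) * V i) {..<Suc k}"
    and PT: "compression P T = (\<lambda>a. mat_sum n n (\<lambda>i. mat_adjoint (V i) * Z i a * V i) {..<Suc k})"
    and intertwine: "\<And>Y a i. Y \<in> carrier_mat n n \<Longrightarrow> T a * P = P * Y \<Longrightarrow> i < Suc k \<Longrightarrow>
      Z i a * V i = V i * Y"
    by blast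
  let ?k = "Suc k"
  have V: "V ?k \<in> carrier_mat (ns ?k) n" and Z: "Z ?k \<in> level K (ns ?k)" using Suc.prems by auto
  let ?P = "vstack P (V ?k)" and ?T = "direct_sum T (Z ?k)"
  note cs = compression_direct_sum[OF levelD(1)[OF T] levelD(1)[OF Z] P V]
  have "mat_adjoint ?P * ?P = mat_adjoint P * P + mat_adjoint (V ?k) * V ?k"
    unfolding mat_adjoint_vstack[OF P V]
    by (rule hstack_mult_vstack[of _ n p _ "ns ?k" _ n]) (use P V in auto)
  then have "mat_adjoint ?P * ?P = mat_sum n n (\<lambda>i. mat_adjoint (V i) * V i) {..<Suc ?k}"
    unfolding PP
    by (subst mat_sum_Suc[of "\<lambda>i. mat_adjoint (V i) * V i" ?k n n]) (use V in auto)
  moreover have "compression ?P ?T = (\<lambda>a. mat_sum n n (\<lambda>i. mat_adjoint (V i) * Z i a * V i) {..<Suc ?k})"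
  proof
    fix a
    show "compression ?P ?T a = mat_sum n n (\<lambda>i. mat_adjoint (V i) * Z i a * V i) {..<Suc ?k}"
      unfolding cs(1) PT
      by (subst mat_sum_Suc[of "\<lambda>i. mat_adjoint (V i) * Z i a * V i" ?k n n])
        (use carrier_matD[OF V] in \<open>auto simp: compression_def intro!: carrier_matI\<close>)
  qed
  moreover have "\<forall>i<Suc ?k. Z i a * V i = V i * Y"
    if Y: "Y \<in> carrier_mat n n" and eq: "?T a * ?P = ?P * Y" for Y a
  proof -
    note d = SM_D(3,4)[OF levelD(1)[OF Z]] SM_D(3,4)[OF levelD(1)[OF T]]
      carrier_matD[OF Y] carrier_matD[OF P] carrier_matD[OF V]
    have "vstack (T a * P) (Z ?k a * V ?k) = vstack (P * Y) (V ?k * Y)"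
      using eq unfolding cs(2) vstack_mult[OF Y P V] .
    then have "T a * P = P * Y" "Z ?k a * V ?k = V ?k * Y"
      by (rule vstack_eqD, simp_all add: d)+
    then show ?thesis
      using intertwine[OF Y] by (auto simp: less_Suc_eq)
  qed
  ultimately show ?case
    using vstack_carrier[OF P V] direct_sum_closed[OF T Z]
    by (intro exI[of _ "p + ns ?k"] exI[of _ ?P] exI[of _ ?T]) blast
qed

lemma combination_as_compression:
  assumes n: "1 \<le> n" and Z: "\<And>i. i < k \<Longrightarrow> Z i \<in> level K (ns i)"
    and comb: "matrix_convex_combination n k ns V Z X"
  shows "\<exists>p P T. isometry p n P \<and> T \<in> level K p \<and> compression P T = X \<and>
     (\<forall>Y \<in> carrier_mat n n. \<forall>a. T a * P = P * Y \<longrightarrow> (\<forall>i<k. Z i a * V i = V i * Y))"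
proof (cases k)
  case 0
  with comb have "(0\<^sub>m n n :: 'f mat) = 1\<^sub>m n"
    by (simp add: matrix_convex_combination_def mat_sum_empty)
  then have "(0\<^sub>m n n :: 'f mat) $$ (0, 0) = 1\<^sub>m n $$ (0, 0)" by simp
  then show ?thesis using n by simp
next
  case (Suc k')
  have "V i \<in> carrier_mat (ns i) n \<and> Z i \<in> level K (ns i)" if "i < Suc k'" for i
    using that Z comb Suc by (auto simp: matrix_convex_combination_def)
  from stack_summands[of k' V ns n Z, OF this] obtain p P T where
    P: "P \<in> carrier_mat p n" "T \<in> level K p"
      "mat_adjoint P * P = mat_sum n n (\<lambda>i. mat_adjoint (V i) * V i) {..<Suc k'}"
      "compression P T = (\<lambda>a. mat_sum n n (\<lambda>i. mat_adjoint (V i) * Z i a * V i) {..<Suc k'})"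
      "\<forall>Y \<in> carrier_mat n n. \<forall>a. T a * P = P * Y \<longrightarrow> (\<forall>i<Suc k'. Z i a * V i = V i * Y)"
    by blast
  moreover have "isometry p n P" "compression P T = X"
    using P(1,3,4) comb unfolding Suc matrix_convex_combination_def isometry_def by simp_all
  ultimately show ?thesis unfolding Suc by blast
qed

lemma combination_closed:
  assumes "1 \<le> n" "\<And>i. i < k \<Longrightarrow> Z i \<in> level K (ns i)" "matrix_convex_combination n k ns V Z X"
  shows "X \<in> level K n"
  using combination_as_compression[OF assms] compression_closed assms(1) by blast

lemma rigid_intertwines:
  assumes X: "rigid n X" and Z: "\<And>i. i < k \<Longrightarrow> Z i \<in> level K (ns i)"
    and comb: "matrix_convex_combination n k ns V Z X" and i: "i < k"
  shows "Z i a * V i = V i * X a"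
proof -
  note Xl = rigid_level[OF X]
  from combination_as_compression[OF level_pos[OF Xl] Z comb]
  obtain p P T where P: "isometry p n P" "T \<in> level K p" "compression P T = X"
    "\<forall>Y \<in> carrier_mat n n. \<forall>a. T a * P = P * Y \<longrightarrow> (\<forall>i<k. Z i a * V i = V i * Y)"
    by blast
  then show ?thesis
    using rigidD[OF X P(2,1,3)] SM_D(1)[OF levelD(1)[OF Xl]] i by blast
qed

text \<open>
  The matrices \<open>V\<^sub>i\<^sup>* V\<^sub>i\<close> commute with \<open>X\<close> and are therefore scalar. After rescaling, \<open>V\<^sub>i\<close> is an
  isometry whose range reduces \<open>X\<^sup>i\<close>, and the complement of the range carries the second summand.
\<close>

lemma rigid_irreducible_imp_free_extreme:
  assumes X: "rigid n X"
    and irreducible: "\<And>P. P \<in> carrier_mat n n \<Longrightarrow> mat_adjoint P = P \<Longrightarrow>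
      (\<And>a. P * X a = X a * P) \<Longrightarrow> \<exists>c. P = c \<cdot>\<^sub>m 1\<^sub>m n"
  shows "free_extreme_point K n X"
  unfolding free_extreme_point_def
proof (intro conjI allI impI)
  note Xl = rigid_level[OF X]
  note XS = levelD(1)[OF Xl]
  show "X \<in> level K n" by (rule Xl)
  have n: "1 \<le> n" using level_pos[OF Xl] .
  fix k ns V Z i
  assume comb: "(\<forall>i<k. Z i \<in> level K (ns i)) \<and> matrix_convex_combination n k ns V Z X \<and>
      (\<forall>i<k. V i \<noteq> 0\<^sub>m (ns i) n)" and i: "i < k"
  let ?m = "ns i"
  have Zi: "Z i \<in> level K ?m" and V: "V i \<in> carrier_mat ?m n" and V0: "V i \<noteq> 0\<^sub>m ?m n"
    using comb i by (auto simp: matrix_convex_combination_def)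
  note ZS = levelD(1)[OF Zi]
  have ZV: "Z i a * V i = V i * X a" for a
    using rigid_intertwines[OF X _ _ i] comb by blast
  note d = SM_D(3,4)[OF XS] SM_D(3,4)[OF ZS] carrier_matD[OF V]
  let ?P = "mat_adjoint (V i) * V i"
  have P: "?P \<in> carrier_mat n n" using V by auto
  have PX: "?P * X a = X a * ?P" for a
  proof -
    have e: "mat_adjoint (V i) * Z i a = X a * mat_adjoint (V i)"
      using arg_cong[OF ZV[of a], of mat_adjoint] by (simp add: mat_algebra d SM_D(2)[OF XS] SM_D(2)[OF ZS])
    have "mat_adjoint (V i) * (Z i a * V i) = X a * mat_adjoint (V i) * V i"
      unfolding e[symmetric] by (simp add: mat_algebra d)
    then show ?thesis
      unfolding ZV by (simp add: mat_algebra d)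
  qed
  have "mat_adjoint ?P = ?P" by (simp add: mat_algebra d)
  from irreducible[OF P this PX] obtain c where c: "?P = c \<cdot>\<^sub>m 1\<^sub>m n" by blast
  \<comment> \<open>A nonzero column of \<open>V i\<close> shows that the scalar does not vanish.\<close>
  have "c \<noteq> 0"
  proof
    assume "c = 0"
    then have P0: "?P = 0\<^sub>m n n" using c by auto
    obtain x where x: "x \<in> carrier_mat n 1" "V i * x \<noteq> 0\<^sub>m ?m 1"
      using exists_nonzero_column[OF V V0] by blast
    have "V i * x \<in> carrier_mat ?m 1" using V x by auto
    from exists_unit_multiple[OF this x(2)] obtain s where "isometry ?m 1 (s \<cdot>\<^sub>m (V i * x))" by blast
    moreover have "s \<cdot>\<^sub>m (V i * x) = V i * (s \<cdot>\<^sub>m x)"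
      using carrier_matD[OF x(1)] by (simp add: mat_algebra d)
    ultimately have iso: "mat_adjoint (V i * (s \<cdot>\<^sub>m x)) * (V i * (s \<cdot>\<^sub>m x)) = 1\<^sub>m 1"
      by (simp add: isometry_def)
    have "mat_adjoint (V i * (s \<cdot>\<^sub>m x)) * (V i * (s \<cdot>\<^sub>m x)) =
        mat_adjoint (s \<cdot>\<^sub>m x) * (mat_adjoint (V i) * (V i * (s \<cdot>\<^sub>m x)))"
      using carrier_matD[OF x(1)] by (simp add: mult_mat_assoc mat_adjoint_mult' d)
    also have "\<dots> = 0\<^sub>m 1 1"
      using carrier_matD[OF x(1)] by (simp add: mult_mat_assoc_eq[OF P0] d)
    finally have "(0\<^sub>m 1 1 :: 'f mat) $$ (0, 0) = 1\<^sub>m 1 $$ (0, 0)" unfolding iso by simp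
    then show False by simp
  qed
  moreover have "0 \<le> c"
  proof -
    have "c = ?P $$ (0, 0)" using n unfolding c by simp
    also have "\<dots> = (\<Sum>k<?m. mat_adjoint (V i) $$ (0, k) * V i $$ (k, 0))"
      using V n by (intro index_mult_mat_sum) auto
    also have "\<dots> \<ge> 0"
      using n by (intro sum_nonneg) (use conjugate_square_positive in \<open>auto simp: d mult.commute\<close>)
    finally show ?thesis .
  qed
  ultimately obtain r where r: "conjugate r = r" "r * r * c = 1"
    using scalar_square_root by blast
  define W where "W = r \<cdot>\<^sub>m V i"
  have cW: "W \<in> carrier_mat ?m n" using V by (simp add: W_def)
  have adjW: "mat_adjoint W = r \<cdot>\<^sub>m mat_adjoint (V i)"
    by (rule eq_matI) (auto simp: W_def d r conjugate_dist_mul)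
  have "mat_adjoint W * W = (r * (r * c)) \<cdot>\<^sub>m 1\<^sub>m n"
    unfolding adjW unfolding W_def by (simp add: mat_algebra d c smult_smult_mat)
  then have W: "isometry ?m n W"
    using cW r by (auto simp: isometry_def mult.assoc)
  have ZW: "Z i a * W = W * X a" for a
    unfolding W_def by (simp add: mat_algebra d ZV)
  have WX: "compression W (Z i) = X"
  proof
    fix a
    have "compression W (Z i) a = mat_adjoint W * (W * X a)"
      unfolding ZW[symmetric] by (simp add: compression_def mat_algebra d carrier_matD[OF cW])
    then show "compression W (Z i) a = X a"
      by (simp add: mult_mat_assoc_eq[OF isometryD(2)[OF W]] d carrier_matD[OF cW])
  qed
  have equiv: "unitarily_equivalent T (Z i)"
    if U: "unitary ?m U" and T: "compression U (Z i) = T" for U T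
  proof -
    have cU: "U \<in> carrier_mat ?m ?m" "U * mat_adjoint U = 1\<^sub>m ?m" "mat_adjoint U * U = 1\<^sub>m ?m"
      using U by (auto simp: unitary_def)
    have TS: "T \<in> SM ?m" using compression_SM[OF ZS cU(1)] T by simp
    have "compression (mat_adjoint U) T = compression (U * mat_adjoint U) (Z i)"
      using compression_mult[OF ZS cU(1) mat_adjoint_carrier[OF cU(1)]] T by simp
    then have "compression (mat_adjoint U) T = Z i"
      using ZS by (simp add: cU compression_one)
    then show ?thesis
      using TS ZS cU unfolding unitarily_equivalent_def compression_def fun_eq_iff
      by (intro exI[of _ ?m] exI[of _ "mat_adjoint U"]) (auto simp: SM_def unitary_def)
  qed
  show "(ns i = n \<and> unitarily_equivalent X (Z i)) \<or>
      (ns i > n \<and> (\<exists>W \<in> K. unitarily_equivalent (direct_sum X W) (Z i)))"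
  proof (cases "ns i = n")
    case True
    then show ?thesis
      using equiv[OF _ WX] isometry_square_imp_unitary[of n W] W by simp
  next
    case False
    then have gt: "n < ?m" using isometry_dim_le[OF W] by simp
    obtain W' where W': "isometry ?m (?m - n) W'" "mat_adjoint W * W' = 0\<^sub>m n (?m - n)"
      using isometry_complement[OF W] by blast
    note cW' = isometryD[OF W'(1)]
    note dW = carrier_matD[OF cW] carrier_matD[OF cW'(1)]
    have orth': "mat_adjoint W' * W = 0\<^sub>m (?m - n) n"
      using arg_cong[OF W'(2), of mat_adjoint] by (simp add: mat_algebra dW)
    have off: "mat_adjoint W * Z i a * W' = 0\<^sub>m n (?m - n)" for a
    proof -
      have "mat_adjoint W' * (Z i a * W) = 0\<^sub>m (?m - n) n"
        unfolding ZW by (simp add: mult_mat_assoc_eq[OF orth'] d dW)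
      from arg_cong[OF this, of mat_adjoint] show ?thesis
        by (simp add: mat_algebra d dW SM_D(2)[OF ZS])
    qed
    let ?\<gamma> = "compression W' (Z i)"
    have \<gamma>: "?\<gamma> \<in> level K (?m - n)"
      using compression_closed[OF Zi W'(1)] gt by simp
    have "compression (hstack W W') (Z i) = direct_sum X ?\<gamma>"
      unfolding compression_hstack[OF ZS cW cW'(1)] WX off
      by (auto simp: block_tuple_def direct_sum_def d SM_D(3,4)[OF levelD(1)[OF \<gamma>]])
    from equiv[OF isometry_complement_resolution(1)[OF W W'] this]
    show ?thesis using gt levelD(2)[OF \<gamma>] by blast
  qed
qed

end

section \<open>Decomposition into free extreme points\<close>

text \<open>
  A matrix convex combination without the normalisation of the weights: \<open>Q\<close> is \<open>\<Sum> V\<^sub>i\<^sup>* V\<^sub>i\<close>. Unlike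
  normalised ones, such combinations can be added.
\<close>

definition free_extreme_sum ::
  "('g \<Rightarrow> 'f::conjugatable_field mat) set \<Rightarrow> nat \<Rightarrow> nat \<Rightarrow> 'f mat \<Rightarrow> ('g \<Rightarrow> 'f mat) \<Rightarrow> bool" where
  "free_extreme_sum K n N Q X \<longleftrightarrow>
     (\<exists>(k::nat) ns V F. (\<forall>i<k. V i \<in> carrier_mat (ns i) n \<and> free_extreme_point K (ns i) (F i)) \<and>
        Q = mat_sum n n (\<lambda>i. mat_adjoint (V i) * V i) {..<k} \<and>
        X = (\<lambda>a. mat_sum n n (\<lambda>i. mat_adjoint (V i) * F i a * V i) {..<k}) \<and>
        (\<Sum>i<k. ns i) \<le> N)"

lemma free_extreme_point_SM: "free_extreme_point K m F \<Longrightarrow> F \<in> SM m"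
  by (auto simp: free_extreme_point_def level_def)

lemma free_extreme_sum_iff_combination:
  "free_extreme_sum K n N (1\<^sub>m n) X \<longleftrightarrow>
     (\<exists>k ns V F. matrix_convex_combination n k ns V F X \<and>
        (\<forall>i<k. free_extreme_point K (ns i) (F i)) \<and> (\<Sum>i<k. ns i) \<le> N)"
proof
  assume "free_extreme_sum K n N (1\<^sub>m n) X"
  then obtain k :: nat and ns V F where *: "\<forall>i<k. V i \<in> carrier_mat (ns i) n \<and> free_extreme_point K (ns i) (F i)"
    "1\<^sub>m n = mat_sum n n (\<lambda>i. mat_adjoint (V i) * V i) {..<k}"
    "X = (\<lambda>a. mat_sum n n (\<lambda>i. mat_adjoint (V i) * F i a * V i) {..<k})" "(\<Sum>i<k. ns i) \<le> N"
    unfolding free_extreme_sum_def by blast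
  have "\<forall>i<k. V i \<in> carrier_mat (ns i) n \<and> F i \<in> SM (ns i)"
    using *(1) free_extreme_point_SM by blast
  then have "matrix_convex_combination n k ns V F X"
    using *(2)[symmetric] *(3) unfolding matrix_convex_combination_def by blast
  then show "\<exists>k ns V F. matrix_convex_combination n k ns V F X \<and>
      (\<forall>i<k. free_extreme_point K (ns i) (F i)) \<and> (\<Sum>i<k. ns i) \<le> N"
    using *(1,4) by blast
next
  assume "\<exists>k ns V F. matrix_convex_combination n k ns V F X \<and>
      (\<forall>i<k. free_extreme_point K (ns i) (F i)) \<and> (\<Sum>i<k. ns i) \<le> N"
  then obtain k ns V F where *: "matrix_convex_combination n k ns V F X"
    "\<forall>i<k. free_extreme_point K (ns i) (F i)" "(\<Sum>i<k. ns i) \<le> N" by blast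
  show "free_extreme_sum K n N (1\<^sub>m n) X"
    unfolding free_extreme_sum_def
    using * unfolding matrix_convex_combination_def
    by (intro exI[of _ k] exI[of _ ns] exI[of _ V] exI[of _ F]) simp
qed

lemma free_extreme_sum_conjugate:
  assumes "free_extreme_sum K n N Q X" and T: "T \<in> carrier_mat n m"
  shows "free_extreme_sum K m N (mat_adjoint T * Q * T) (\<lambda>a. mat_adjoint T * X a * T)"
proof -
  obtain k :: nat and ns V F where V: "\<And>i. i < k \<Longrightarrow> V i \<in> carrier_mat (ns i) n"
    and F: "\<And>i. i < k \<Longrightarrow> free_extreme_point K (ns i) (F i)"
    and Q: "Q = mat_sum n n (\<lambda>i. mat_adjoint (V i) * V i) {..<k}"
    and X: "X = (\<lambda>a. mat_sum n n (\<lambda>i. mat_adjoint (V i) * F i a * V i) {..<k})"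
    and N: "(\<Sum>i<k. ns i) \<le> N"
    using assms(1) unfolding free_extreme_sum_def by blast
  note dT = carrier_matD[OF T] and dV = carrier_matD[OF V]
  note dF = SM_D(3,4)[OF free_extreme_point_SM[OF F]]
  have "mat_adjoint T * Q * T =
      mat_sum m m (\<lambda>i. mat_adjoint T * (mat_adjoint (V i) * V i) * T) {..<k}"
    unfolding Q using dV by (intro mat_sum_conjugation[OF T]) (auto intro!: carrier_matI)
  also have "\<dots> = mat_sum m m (\<lambda>i. mat_adjoint (V i * T) * (V i * T)) {..<k}"
    by (rule mat_sum_cong) (simp add: mat_algebra dT dV)
  finally have Q': "mat_adjoint T * Q * T = mat_sum m m (\<lambda>i. mat_adjoint (V i * T) * (V i * T)) {..<k}" .
  have "mat_adjoint T * X a * T = mat_sum m m (\<lambda>i. mat_adjoint (V i * T) * F i a * (V i * T)) {..<k}" for a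
  proof -
    have "mat_adjoint T * X a * T =
        mat_sum m m (\<lambda>i. mat_adjoint T * (mat_adjoint (V i) * F i a * V i) * T) {..<k}"
      unfolding X using dV by (intro mat_sum_conjugation[OF T]) (auto intro!: carrier_matI)
    also have "\<dots> = mat_sum m m (\<lambda>i. mat_adjoint (V i * T) * F i a * (V i * T)) {..<k}"
      by (rule mat_sum_cong) (simp add: mat_algebra dT dV dF)
    finally show ?thesis .
  qed
  then have X': "(\<lambda>a. mat_adjoint T * X a * T) =
      (\<lambda>a. mat_sum m m (\<lambda>i. mat_adjoint (V i * T) * F i a * (V i * T)) {..<k})" by blast
  have "\<forall>i<k. V i * T \<in> carrier_mat (ns i) m \<and> free_extreme_point K (ns i) (F i)"
    using F mult_carrier_mat[OF V T] by blast
  then show ?thesis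
    unfolding free_extreme_sum_def using Q' X' N
    by (intro exI[of _ k] exI[of _ ns] exI[of _ "\<lambda>i. V i * T"] exI[of _ F]) blast
qed

lemma free_extreme_sum_add:
  assumes "free_extreme_sum K n N Q X" and "free_extreme_sum K n N' Q' X'"
  shows "free_extreme_sum K n (N + N') (Q + Q') (\<lambda>a. X a + X' a)"
proof -
  obtain k :: nat and ns V F where V: "\<And>i. i < k \<Longrightarrow> V i \<in> carrier_mat (ns i) n"
    and F: "\<And>i. i < k \<Longrightarrow> free_extreme_point K (ns i) (F i)"
    and Q: "Q = mat_sum n n (\<lambda>i. mat_adjoint (V i) * V i) {..<k}"
    and X: "X = (\<lambda>a. mat_sum n n (\<lambda>i. mat_adjoint (V i) * F i a * V i) {..<k})"
    and N: "(\<Sum>i<k. ns i) \<le> N"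
    using assms(1) unfolding free_extreme_sum_def by blast
  obtain k' :: nat and ns' V' F' where V': "\<And>i. i < k' \<Longrightarrow> V' i \<in> carrier_mat (ns' i) n"
    and F': "\<And>i. i < k' \<Longrightarrow> free_extreme_point K (ns' i) (F' i)"
    and Q': "Q' = mat_sum n n (\<lambda>i. mat_adjoint (V' i) * V' i) {..<k'}"
    and X': "X' = (\<lambda>a. mat_sum n n (\<lambda>i. mat_adjoint (V' i) * F' i a * V' i) {..<k'})"
    and N': "(\<Sum>i<k'. ns' i) \<le> N'"
    using assms(2) unfolding free_extreme_sum_def by blast
  let ?ns = "\<lambda>i. if i < k then ns i else ns' (i - k)"
  let ?V = "\<lambda>i. if i < k then V i else V' (i - k)"
  let ?F = "\<lambda>i. if i < k then F i else F' (i - k)"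
  have "\<forall>i<k + k'. ?V i \<in> carrier_mat (?ns i) n \<and> free_extreme_point K (?ns i) (?F i)"
    using V F V' F' by auto
  moreover have "Q + Q' = mat_sum n n (\<lambda>i. mat_adjoint (?V i) * ?V i) {..<k + k'}"
    unfolding Q Q' mat_sum_lessThan_add
    by (intro arg_cong2[of _ _ _ _ "(+)"] mat_sum_cong) auto
  moreover have "(\<lambda>a. X a + X' a) =
      (\<lambda>a. mat_sum n n (\<lambda>i. mat_adjoint (?V i) * ?F i a * ?V i) {..<k + k'})"
    unfolding X X' mat_sum_lessThan_add
    by (intro ext arg_cong2[of _ _ _ _ "(+)"] mat_sum_cong) auto
  moreover have "(\<Sum>i<k + k'. ?ns i) \<le> N + N'"
    using N N' unfolding sum_lessThan_add by simp
  ultimately show ?thesis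
    unfolding free_extreme_sum_def
    by (intro exI[of _ "k + k'"] exI[of _ ?ns] exI[of _ ?V] exI[of _ ?F]) blast
qed

context matrix_convex_set
begin

text \<open>
  A tuple that is not free extreme commutes with some nonscalar self-adjoint matrix; an eigenspace of
  this matrix and its complement reduce the tuple, and the sizes of the parts add up.
\<close>

lemma rigid_decomposition:
  "rigid n X \<Longrightarrow> free_extreme_sum K n n (1\<^sub>m n) X"
proof (induction n arbitrary: X rule: less_induct)
  case (less n)
  note X = less.prems
  note Xl = rigid_level[OF X]
  note XS = levelD(1)[OF Xl]
  have n: "1 \<le> n" using level_pos[OF Xl] .
  show ?case
  proof (cases "free_extreme_point K n X")
    case True
    have "1\<^sub>m n = mat_sum n n (\<lambda>i::nat. mat_adjoint (1\<^sub>m n) * (1\<^sub>m n :: 'f mat)) {..<1}"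
      by (rule eq_matI) (auto simp: mat_sum_def)
    moreover have "X = (\<lambda>a. mat_sum n n (\<lambda>i::nat. mat_adjoint (1\<^sub>m n) * X a * 1\<^sub>m n) {..<1})"
    proof
      fix a show "X a = mat_sum n n (\<lambda>i::nat. mat_adjoint (1\<^sub>m n) * X a * 1\<^sub>m n) {..<1}"
        using SM_D(3,4)[OF XS] by (intro eq_matI) (auto simp: mat_sum_def)
    qed
    ultimately show ?thesis
      unfolding free_extreme_sum_def using True
      by (intro exI[of _ 1] exI[of _ "\<lambda>_. n"] exI[of _ "\<lambda>_. 1\<^sub>m n"] exI[of _ "\<lambda>_. X"]) auto
  next
    case False
    then obtain P where P: "P \<in> carrier_mat n n" "mat_adjoint P = P"
      and PX: "\<And>a. P * X a = X a * P" and nonscalar: "\<And>c. P \<noteq> c \<cdot>\<^sub>m 1\<^sub>m n"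
      using rigid_irreducible_imp_free_extreme[OF X] by blast
    have "0 < n" using n by simp
    from eigenspace_isometry[OF P this] obtain c p V
      where p: "1 \<le> p" and V: "isometry n p V" and PV: "P * V = c \<cdot>\<^sub>m V"
        and range: "\<forall>q. \<forall>R \<in> carrier_mat n q. P * R = c \<cdot>\<^sub>m R \<longrightarrow> V * (mat_adjoint V * R) = R"
      by blast
    note cV = isometryD[OF V]
    note d = SM_D(3,4)[OF XS] carrier_matD[OF P(1)] carrier_matD[OF cV(1)]
    have "p \<noteq> n"
    proof
      assume "p = n"
      then have VV: "V * mat_adjoint V = 1\<^sub>m n"
        using V isometry_square_imp_unitary[of n V] by (simp add: unitary_def)
      have "P = P * 1\<^sub>m n" by (simp add: d)
      also have "\<dots> = P * (V * mat_adjoint V)" unfolding VV ..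
      also have "\<dots> = c \<cdot>\<^sub>m 1\<^sub>m n"
        unfolding VV[symmetric] by (simp add: mult_mat_assoc_eq[OF PV] d mult_smult_mat)
      finally show False using nonscalar by blast
    qed
    then have pn: "p < n" using isometry_dim_le[OF V] by simp
    have reducing: "X a * V = V * compression V X a" for a
    proof -
      have "P * (X a * V) = X a * (P * V)"
        by (simp add: mult_mat_assoc_eq[OF PX] mult_mat_assoc d)
      then have "P * (X a * V) = c \<cdot>\<^sub>m (X a * V)"
        unfolding PV by (simp add: mult_smult_mat d)
      moreover have "X a * V \<in> carrier_mat n p"
        by (intro carrier_matI) (simp_all add: d)
      ultimately have "V * (mat_adjoint V * (X a * V)) = X a * V" using range by blast
      then show ?thesis by (simp add: compression_def mat_algebra d)
    qed
    obtain V' where V': "isometry n (n - p) V'" "mat_adjoint V * V' = 0\<^sub>m p (n - p)"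
      using isometry_complement[OF V] by blast
    note cV' = isometryD[OF V'(1)]
    note split = reducing_subspace_splits[OF XS V V' reducing]
    have "rigid p (compression V X)"
      using rigid_summand[OF X V p pn reducing] .
    from less.IH[OF pn this]
    have 1: "free_extreme_sum K p p (1\<^sub>m p) (compression V X)" .
    have "rigid (n - p) (compression V' X)"
      using rigid_summand[OF X V'(1) _ _ split(1)] p pn by simp
    from less.IH[OF _ this] p pn
    have 2: "free_extreme_sum K (n - p) (n - p) (1\<^sub>m (n - p)) (compression V' X)" by simp
    have "free_extreme_sum K n (p + (n - p))
        (mat_adjoint (mat_adjoint V) * 1\<^sub>m p * mat_adjoint V +
          mat_adjoint (mat_adjoint V') * 1\<^sub>m (n - p) * mat_adjoint V')
        (\<lambda>a. mat_adjoint (mat_adjoint V) * compression V X a * mat_adjoint V +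
          mat_adjoint (mat_adjoint V') * compression V' X a * mat_adjoint V')"
      by (intro free_extreme_sum_add free_extreme_sum_conjugate[OF 1]
          free_extreme_sum_conjugate[OF 2] mat_adjoint_carrier cV(1) cV'(1))
    moreover have "mat_adjoint (mat_adjoint V) * 1\<^sub>m p * mat_adjoint V +
          mat_adjoint (mat_adjoint V') * 1\<^sub>m (n - p) * mat_adjoint V' = 1\<^sub>m n"
      using isometry_complement_resolution(2)[OF V V'] by (simp add: d carrier_matD[OF cV'(1)])
    moreover have "(\<lambda>a. mat_adjoint (mat_adjoint V) * compression V X a * mat_adjoint V +
          mat_adjoint (mat_adjoint V') * compression V' X a * mat_adjoint V') = X"
    proof
      fix a
      show "mat_adjoint (mat_adjoint V) * compression V X a * mat_adjoint V +
          mat_adjoint (mat_adjoint V') * compression V' X a * mat_adjoint V' = X a"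
        unfolding mat_adjoint_adjoint by (rule split(2)[symmetric])
    qed
    ultimately show ?thesis using pn by simp
  qed
qed

lemma dilation_to_arveson_extreme_decomposition:
  assumes XY: "dilation K n l X Y" and Y: "arveson_extreme_point K (n + l) Y" and X: "X \<in> SM n"
  shows "\<exists>k ns V F. matrix_convex_combination n k ns V F X \<and>
     (\<forall>i<k. free_extreme_point K (ns i) (F i)) \<and> (\<Sum>i<k. ns i) \<le> n + l"
proof -
  let ?I = "vstack (1\<^sub>m n) (0\<^sub>m l n) :: 'f mat"
  obtain \<beta> \<gamma> where "\<beta> \<in> mat_tuples n l" "\<gamma> \<in> SM l" "Y = block_tuple X \<beta> \<gamma>"
    using XY unfolding dilation_def by blast
  then have "compression ?I Y = X"
    using block_tuple_inclusion(2)[OF X] by blast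
  then have IX: "(\<lambda>a. mat_adjoint ?I * Y a * ?I) = X" by (simp add: compression_def)
  have II: "mat_adjoint ?I * 1\<^sub>m (n + l) * ?I = 1\<^sub>m n"
    using isometryD[OF isometry_inclusion[of n l, where 'f = 'f]]
    by (simp add: vstack_def)
  have "free_extreme_sum K n (n + l) (mat_adjoint ?I * 1\<^sub>m (n + l) * ?I) (\<lambda>a. mat_adjoint ?I * Y a * ?I)"
    using rigid_decomposition[OF arveson_extreme_imp_rigid[OF Y]]
    by (rule free_extreme_sum_conjugate) (rule isometryD(1)[OF isometry_inclusion])
  then show ?thesis
    unfolding II IX free_extreme_sum_iff_combination .
qed

lemma eq_matrix_convex_hull_free_extreme:
  assumes "\<And>n X. X \<in> level K n \<Longrightarrow> \<exists>k ns V F. matrix_convex_combination n k ns V F X \<and>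
     (\<forall>i<k. free_extreme_point K (ns i) (F i))"
  shows "K = matrix_convex_hull {F. \<exists>m. free_extreme_point K m F}"
proof
  show "K \<subseteq> matrix_convex_hull {F. \<exists>m. free_extreme_point K m F}"
  proof
    fix X assume "X \<in> K"
    then obtain n where n: "1 \<le> n" "X \<in> level K n" using level_graded by blast
    from assms[OF n(2)] obtain k ns V F where *: "matrix_convex_combination n k ns V F X"
      "\<forall>i<k. free_extreme_point K (ns i) (F i)" by blast
    have "\<forall>i<k. F i \<in> level {F. \<exists>m. free_extreme_point K m F} (ns i)"
      using *(2) free_extreme_point_SM by (auto simp: level_def)
    then show "X \<in> matrix_convex_hull {F. \<exists>m. free_extreme_point K m F}"
      unfolding matrix_convex_hull_def using n(1) *(1) by blast
  qed
  show "matrix_convex_hull {F. \<exists>m. free_extreme_point K m F} \<subseteq> K"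
  proof
    fix X assume "X \<in> matrix_convex_hull {F. \<exists>m. free_extreme_point K m F}"
    then obtain n k ns V Z where n: "1 \<le> n"
      and Z: "\<forall>i<k. Z i \<in> level {F. \<exists>m. free_extreme_point K m F} (ns i)"
      and comb: "matrix_convex_combination n k ns V Z X"
      unfolding matrix_convex_hull_def by blast
    have "Z i \<in> level K (ns i)" if "i < k" for i
      using Z that by (auto simp: level_def free_extreme_point_def)
    from combination_closed[OF n this comb] show "X \<in> K" by (rule levelD(2))
  qed
qed

end

section \<open>The two scalar fields\<close>

lemma complex_matrix_eigenvector:
  fixes h :: "nat \<Rightarrow> nat \<Rightarrow> complex"
  assumes "0 < n"
  shows "\<exists>c v. (\<exists>i<n. v i \<noteq> 0) \<and> (\<forall>i<n. (\<Sum>j<n. h i j * v j) = c * v i)"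
proof -
  let ?A = "mat n n (\<lambda>(i, j). h i j)"
  have A: "?A \<in> carrier_mat n n" by simp
  obtain c where "c \<in> spectrum ?A"
    using spectrum_non_empty[OF A] assms by auto
  then obtain v where v: "v \<in> carrier_vec n" "v \<noteq> 0\<^sub>v n" "?A *\<^sub>v v = c \<cdot>\<^sub>v v"
    unfolding spectrum_def eigenvalue_def eigenvector_def by auto
  have "\<exists>i<n. v $ i \<noteq> 0"
  proof (rule ccontr)
    assume "\<not> (\<exists>i<n. v $ i \<noteq> 0)"
    then have "v = 0\<^sub>v n" using v(1) by (intro eq_vecI) auto
    then show False using v(2) by simp
  qed
  moreover have "(\<Sum>j<n. h i j * v $ j) = c * v $ i" if "i < n" for i
    using arg_cong[OF v(3), of "\<lambda>w. w $ i"] that v(1)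
    by (auto simp: scalar_prod_def lessThan_atLeast0 intro!: sum.cong)
  ultimately show ?thesis
    by (intro exI[of _ c] exI[of _ "\<lambda>i. v $ i"]) auto
qed

instance complex :: rc_scalar
proof
  fix r :: real
  show "conjugate (r *\<^sub>R 1) = (r *\<^sub>R 1 :: complex)" by simp
next
  fix x :: complex
  assume "0 \<le> x"
  then have "0 \<le> Re x" "x = Re x *\<^sub>R 1"
    by (auto simp: less_eq_complex_def complex_eq_iff)
  then show "\<exists>r\<ge>0. x = r *\<^sub>R 1" by blast
next
  fix h :: "nat \<Rightarrow> nat \<Rightarrow> complex" and n :: nat
  assume "0 < n"
  then show "\<exists>c v. (\<exists>i<n. v i \<noteq> 0) \<and> (\<forall>i<n. (\<Sum>j<n. h i j * v j) = c * v i)"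
    by (rule complex_matrix_eigenvector)
qed

text \<open>
  A complex eigenvector has a real eigenvalue, so its real and imaginary parts are eigenvectors as well,
  and one of them is nonzero.
\<close>

lemma real_symmetric_eigenvector:
  fixes h :: "nat \<Rightarrow> nat \<Rightarrow> real"
  assumes sym: "\<And>i j. h j i = h i j" and n: "0 < n"
  shows "\<exists>c v. (\<exists>i<n. v i \<noteq> 0) \<and> (\<forall>i<n. (\<Sum>j<n. h i j * v j) = c * v i)"
proof -
  obtain c v where v0: "\<exists>i<n. v i \<noteq> 0"
    and v: "\<And>i. i < n \<Longrightarrow> (\<Sum>j<n. complex_of_real (h i j) * v j) = c * v i"
    using complex_matrix_eigenvector[OF n, of "\<lambda>i j. complex_of_real (h i j)"] by blast
  define s where "s = (\<Sum>i<n. cnj (v i) * (\<Sum>j<n. complex_of_real (h i j) * v j))"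
  have "cnj s = (\<Sum>i<n. \<Sum>j<n. complex_of_real (h i j) * cnj (v j) * v i)"
    unfolding s_def by (simp add: sum_distrib_left mult_ac)
  also have "\<dots> = (\<Sum>j<n. \<Sum>i<n. complex_of_real (h i j) * cnj (v j) * v i)"
    by (rule sum.swap)
  also have "\<dots> = s"
    unfolding s_def sum_distrib_left
    by (intro sum.cong refl) (simp add: sym[of _ _] mult_ac)
  finally have "Im s = 0"
    by (metis complex_cnj_cancel_iff complex_cnj_complex_of_real Reals_cnj_iff complex_is_Real_iff)
  moreover have "s = c * complex_of_real (\<Sum>i<n. (cmod (v i))\<^sup>2)"
  proof -
    have "s = (\<Sum>i<n. cnj (v i) * (c * v i))"
      unfolding s_def by (intro sum.cong refl) (simp add: v)
    also have "\<dots> = c * (\<Sum>i<n. v i * cnj (v i))"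
      by (simp add: sum_distrib_left mult_ac)
    also have "\<dots> = c * complex_of_real (\<Sum>i<n. (cmod (v i))\<^sup>2)"
      unfolding of_real_sum complex_norm_square ..
    finally show ?thesis .
  qed
  moreover have "(\<Sum>i<n. (cmod (v i))\<^sup>2) > 0"
  proof -
    obtain i where "i < n" "v i \<noteq> 0" using v0 by blast
    then show ?thesis by (intro sum_pos2[of _ i]) auto
  qed
  ultimately have c: "Im c = 0" by simp
  have eq: "(\<Sum>j<n. h i j * Re (v j)) = Re c * Re (v i)" "(\<Sum>j<n. h i j * Im (v j)) = Re c * Im (v i)"
    if "i < n" for i
    using arg_cong[OF v[OF that], of Re] arg_cong[OF v[OF that], of Im] c by simp_all
  show ?thesis
  proof (cases "\<exists>i<n. Re (v i) \<noteq> 0")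
    case True
    then show ?thesis using eq(1) by (intro exI[of _ "Re c"] exI[of _ "\<lambda>i. Re (v i)"]) simp
  next
    case False
    then have "\<exists>i<n. Im (v i) \<noteq> 0" using v0 by (auto simp: complex_eq_iff)
    then show ?thesis using eq(2) by (intro exI[of _ "Re c"] exI[of _ "\<lambda>i. Im (v i)"]) simp
  qed
qed

instance real :: rc_scalar
proof
  fix r :: real
  show "conjugate (r *\<^sub>R 1) = (r *\<^sub>R 1 :: real)" by simp
next
  fix x :: real
  assume "0 \<le> x"
  then show "\<exists>r\<ge>0. x = r *\<^sub>R 1" by simp
next
  fix h :: "nat \<Rightarrow> nat \<Rightarrow> real" and n :: nat
  assume "\<And>i j. h j i = conjugate (h i j)" "0 < n"
  then show "\<exists>c v. (\<exists>i<n. v i \<noteq> 0) \<and> (\<forall>i<n. (\<Sum>j<n. h i j * v j) = c * v i)"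
    by (intro real_symmetric_eigenvector) simp_all
qed


section \<open>Free spectrahedra are matrix convex\<close>

context hilbert_space_over
begin

lemma ip_add_right: "ip x (y + z) = ip x y + ip x z"
  by (metis ip_conjugate ip_add_left conjugate_dist_add)

lemma ip_smul_right: "ip x (smul c y) = conjugate c * ip x y"
  by (metis ip_conjugate ip_smul_left conjugate_dist_mul)

lemma ip_zero [simp]: "ip 0 y = 0" "ip x 0 = 0"
  using ip_smul_left[of 0 0 y] ip_smul_right[of x 0 0] by simp_all

lemma ip_sum_left: "ip (\<Sum>i\<in>I. f i) y = (\<Sum>i\<in>I. ip (f i) y)"
  by (induction I rule: infinite_finite_induct) (auto simp: ip_add_left)

lemma ip_sum_right: "ip x (\<Sum>i\<in>I. f i) = (\<Sum>i\<in>I. ip x (f i))"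
  by (induction I rule: infinite_finite_induct) (auto simp: ip_add_right)

lemma ip_diff_left: "ip (x - y) z = ip x z - ip y z"
  using ip_add_left[of "x - y" y z] by simp

text \<open>The quadratic form of \<open>T \<otimes> M\<close>.\<close>

definition tensor_form :: "nat \<Rightarrow> ('h \<Rightarrow> 'h) \<Rightarrow> 'f mat \<Rightarrow> (nat \<Rightarrow> 'h) \<Rightarrow> 'f" where
  "tensor_form n T M v = (\<Sum>j<n. \<Sum>k<n. M $$ (j, k) * ip (T (v k)) (v j))"

lemma pencil_form:
  "(\<Sum>j<n. ip (pencil smul A n X v j) (v j)) =
     tensor_form n id (1\<^sub>m n) v - (\<Sum>a\<in>UNIV. tensor_form n (A a) (X a) v)"
  unfolding pencil_def tensor_op_def tensor_form_def
  by (simp add: ip_diff_left ip_sum_left ip_smul_left sum_subtractf)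
    (subst sum.swap, simp)

text \<open>
  Compressing the coefficient matrix by \<open>W\<close> amounts to substituting \<open>W v\<close> for \<open>v\<close>.
\<close>

lemma tensor_form_compression:
  assumes T: "Vector_Spaces.linear smul smul T" and Z: "Z \<in> carrier_mat m m" and W: "W \<in> carrier_mat m n"
  shows "tensor_form n T (mat_adjoint W * Z * W) v =
    tensor_form m T Z (\<lambda>p. \<Sum>k<n. smul (W $$ (p, k)) (v k))"
proof -
  interpret T: Vector_Spaces.linear smul smul T by (rule T)
  have entry: "(mat_adjoint W * Z * W) $$ (j, k) =
      (\<Sum>q<m. \<Sum>p<m. conjugate (W $$ (p, j)) * Z $$ (p, q) * W $$ (q, k))" if "j < n" "k < n" for j k
  proof -
    have "(mat_adjoint W * Z * W) $$ (j, k) = (\<Sum>q<m. (mat_adjoint W * Z) $$ (j, q) * W $$ (q, k))"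
      using Z W that by (intro index_mult_mat_sum) (auto intro!: carrier_matI)
    also have "\<dots> = (\<Sum>q<m. (\<Sum>p<m. mat_adjoint W $$ (j, p) * Z $$ (p, q)) * W $$ (q, k))"
      using Z W that by (intro sum.cong refl arg_cong2[of _ _ _ _ "(*)"] index_mult_mat_sum) auto
    also have "\<dots> = (\<Sum>q<m. \<Sum>p<m. conjugate (W $$ (p, j)) * Z $$ (p, q) * W $$ (q, k))"
      using carrier_matD[OF W] that by (simp add: sum_distrib_right)
    finally show ?thesis .
  qed
  have "tensor_form m T Z (\<lambda>p. \<Sum>k<n. smul (W $$ (p, k)) (v k)) =
      (\<Sum>p<m. \<Sum>q<m. \<Sum>k<n. \<Sum>j<n.
        conjugate (W $$ (p, j)) * Z $$ (p, q) * W $$ (q, k) * ip (T (v k)) (v j))"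
    unfolding tensor_form_def
    by (simp add: T.sum T.scale ip_sum_left ip_sum_right ip_smul_left ip_smul_right
        sum_distrib_left mult_ac) (intro sum.cong refl sum.swap)
  also have "\<dots> = (\<Sum>j<n. \<Sum>k<n. \<Sum>q<m. \<Sum>p<m.
        conjugate (W $$ (p, j)) * Z $$ (p, q) * W $$ (q, k) * ip (T (v k)) (v j))"
    (is "(\<Sum>p<m. \<Sum>q<m. \<Sum>k<n. \<Sum>j<n. ?f p q k j) = _")
  proof -
    have "(\<Sum>p<m. \<Sum>q<m. \<Sum>k<n. \<Sum>j<n. ?f p q k j) = (\<Sum>q<m. \<Sum>p<m. \<Sum>j<n. \<Sum>k<n. ?f p q k j)"
      by (subst sum.swap) (intro sum.cong refl sum.swap)
    also have "\<dots> = (\<Sum>q<m. \<Sum>j<n. \<Sum>p<m. \<Sum>k<n. ?f p q k j)"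
      by (intro sum.cong refl sum.swap)
    also have "\<dots> = (\<Sum>j<n. \<Sum>q<m. \<Sum>k<n. \<Sum>p<m. ?f p q k j)"
      by (subst sum.swap) (intro sum.cong refl sum.swap)
    also have "\<dots> = (\<Sum>j<n. \<Sum>k<n. \<Sum>q<m. \<Sum>p<m. ?f p q k j)"
      by (intro sum.cong refl sum.swap)
    finally show ?thesis .
  qed
  also have "\<dots> = tensor_form n T (mat_adjoint W * Z * W) v"
    unfolding tensor_form_def by (intro sum.cong refl) (simp add: entry sum_distrib_right del: index_mult_mat)
  finally show ?thesis by simp
qed

lemma tensor_form_direct_sum:
  assumes "X \<in> carrier_mat m m" "Y \<in> carrier_mat n n"
  shows "tensor_form (m + n) T (four_block_mat X (0\<^sub>m m n) (0\<^sub>m n m) Y) v =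
    tensor_form m T X v + tensor_form n T Y (\<lambda>j. v (m + j))"
  unfolding tensor_form_def sum_lessThan_add using assms by (simp add: sum.distrib)

lemma direct_sum_SM:
  fixes X Y :: "'g \<Rightarrow> 'f mat"
  assumes "X \<in> SM m" "Y \<in> SM n"
  shows "direct_sum X Y \<in> SM (m + n)"
proof (rule SM_I)
  fix a
  note d = SM_D[OF assms(1), of a] SM_D[OF assms(2), of a]
  show "direct_sum X Y a \<in> carrier_mat (m + n) (m + n)"
    using d by (auto simp: direct_sum_def)
  have X: "conjugate (X a $$ (j, i)) = X a $$ (i, j)" if "i < m" "j < m" for i j
    using arg_cong[OF d(2), of "\<lambda>M. M $$ (i, j)"] that d(3,4) by simp
  have Y: "conjugate (Y a $$ (j, i)) = Y a $$ (i, j)" if "i < n" "j < n" for i j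
    using arg_cong[OF d(6), of "\<lambda>M. M $$ (i, j)"] that d(7,8) by simp
  show "mat_adjoint (direct_sum X Y a) = direct_sum X Y a"
    using d(3,4,7,8) by (intro eq_matI) (auto simp: direct_sum_def X Y)
qed

lemma gen_free_spectrahedron_level_iff:
  "X \<in> level (gen_free_spectrahedron smul ip A) n \<longleftrightarrow>
     1 \<le> n \<and> X \<in> SM n \<and>
     (\<forall>v. 0 \<le> tensor_form n id (1\<^sub>m n) v - (\<Sum>a\<in>UNIV. tensor_form n (A a) (X a) v))"
proof -
  have "m = n" if "X \<in> SM m" "X \<in> SM n" for m
    using SM_D(3)[OF that(1)] SM_D(3)[OF that(2)] by simp
  then show ?thesis
    unfolding level_def gen_free_spectrahedron_def psd_op_def pencil_form by auto
qed

end

lemma matrix_convex_gen_free_spectrahedron: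
  fixes smul :: "'f::rc_scalar \<Rightarrow> 'h::banach \<Rightarrow> 'h" and A :: "'g::finite \<Rightarrow> 'h \<Rightarrow> 'h"
  assumes H: "hilbert_space_over smul ip" and A: "\<And>a. Vector_Spaces.linear smul smul (A a)"
  shows "matrix_convex_set (gen_free_spectrahedron smul ip A)"
proof -
  interpret hilbert_space_over smul ip by (rule H)
  have linear_id: "Vector_Spaces.linear smul smul id"
    by unfold_locales auto
  let ?D = "gen_free_spectrahedron smul ip A"
  show ?thesis
  proof
    fix X assume "X \<in> ?D"
    then show "\<exists>n\<ge>1. X \<in> SM n"
      by (auto simp: gen_free_spectrahedron_def)
  next
    fix Z m n and W :: "'f mat"
    assume Z: "Z \<in> level ?D m" and W: "isometry m n W" and n: "1 \<le> n"
    note cW = isometryD[OF W]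
    have ZS: "Z \<in> SM m"
      and pos: "\<And>v. 0 \<le> tensor_form m id (1\<^sub>m m) v - (\<Sum>a\<in>UNIV. tensor_form m (A a) (Z a) v)"
      using Z by (auto simp: gen_free_spectrahedron_level_iff)
    have "tensor_form n id (1\<^sub>m n) v - (\<Sum>a\<in>UNIV. tensor_form n (A a) (compression W Z a) v) \<ge> 0" for v
    proof -
      let ?w = "\<lambda>p. \<Sum>k<n. smul (W $$ (p, k)) (v k)"
      have "1\<^sub>m n = mat_adjoint W * 1\<^sub>m m * W"
        using cW carrier_matD[OF cW(1)] by simp
      then have "tensor_form n id (1\<^sub>m n) v = tensor_form m id (1\<^sub>m m) ?w"
        using tensor_form_compression[OF linear_id one_carrier_mat cW(1)] by simp
      moreover have "tensor_form n (A a) (compression W Z a) v = tensor_form m (A a) (Z a) ?w" for a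
        unfolding compression_def by (rule tensor_form_compression[OF A SM_D(1)[OF ZS] cW(1)])
      ultimately show ?thesis using pos[of ?w] by simp
    qed
    then show "compression W Z \<in> level ?D n"
      using compression_SM[OF ZS cW(1)] n by (simp add: gen_free_spectrahedron_level_iff)
  next
    fix X Y m n
    assume X: "X \<in> level ?D m" and Y: "Y \<in> level ?D n"
    have XS: "X \<in> SM m" and m: "1 \<le> m" and YS: "Y \<in> SM n"
      using X Y by (auto simp: gen_free_spectrahedron_level_iff)
    have "0 \<le> tensor_form (m + n) id (1\<^sub>m (m + n)) v -
        (\<Sum>a\<in>UNIV. tensor_form (m + n) (A a) (direct_sum X Y a) v)" for v
    proof -
      let ?w = "\<lambda>j. v (m + j)"
      have "direct_sum X Y a = four_block_mat (X a) (0\<^sub>m m n) (0\<^sub>m n m) (Y a)" for a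
        using SM_D(3,4)[OF XS] SM_D(3,4)[OF YS] by (simp add: direct_sum_def)
      then have "tensor_form (m + n) (A a) (direct_sum X Y a) v =
          tensor_form m (A a) (X a) v + tensor_form n (A a) (Y a) ?w" for a
        using tensor_form_direct_sum[OF SM_D(1)[OF XS] SM_D(1)[OF YS]] by simp
      moreover have "tensor_form (m + n) id (1\<^sub>m (m + n)) v =
          tensor_form m id (1\<^sub>m m) v + tensor_form n id (1\<^sub>m n) ?w"
        using tensor_form_direct_sum[of "1\<^sub>m m" m "1\<^sub>m n" n id v] by simp
      ultimately have "tensor_form (m + n) id (1\<^sub>m (m + n)) v -
          (\<Sum>a\<in>UNIV. tensor_form (m + n) (A a) (direct_sum X Y a) v) =
        (tensor_form m id (1\<^sub>m m) v - (\<Sum>a\<in>UNIV. tensor_form m (A a) (X a) v)) +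
        (tensor_form n id (1\<^sub>m n) ?w - (\<Sum>a\<in>UNIV. tensor_form n (A a) (Y a) ?w))"
        by (simp add: sum.distrib)
      also have "\<dots> \<ge> 0"
        using X Y by (intro add_nonneg_nonneg) (auto simp: gen_free_spectrahedron_level_iff)
      finally show ?thesis .
    qed
    then show "direct_sum X Y \<in> level ?D (m + n)"
      using direct_sum_SM[OF XS YS] m by (simp add: gen_free_spectrahedron_level_iff)
  qed
qed

section \<open>The quadratic form of a real pencil\<close>

lemma discriminant_le:
  fixes a b c :: real
  assumes pos: "\<And>t. 0 \<le> a + 2 * t * b + t\<^sup>2 * c" and c: "0 \<le> c"
  shows "b\<^sup>2 \<le> a * c"
proof (cases "c = 0")
  case True
  have "b = 0"
  proof (rule ccontr)
    assume "b \<noteq> 0"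
    then have "a + 2 * (- (a + 1) / (2 * b)) * b = -1" by (simp add: field_simps)
    then show False using pos[of "- (a + 1) / (2 * b)"] True by simp
  qed
  then show ?thesis using True by simp
next
  case False
  then have "0 < c" using c by simp
  have "0 \<le> c * (a + 2 * (- b / c) * b + (- b / c)\<^sup>2 * c)"
    using pos[of "- b / c"] c by simp
  also have "\<dots> = a * c - b\<^sup>2"
    using \<open>0 < c\<close> by (simp add: field_simps power2_eq_square)
  finally show ?thesis by simp
qed

lemma finite_convergent_subsequence:
  fixes x :: "nat \<Rightarrow> 'i \<Rightarrow> 'm::metric_space"
  assumes "finite I" "\<And>i. i \<in> I \<Longrightarrow> compact (S i)" "\<And>k i. i \<in> I \<Longrightarrow> x k i \<in> S i"
  shows "\<exists>r l. strict_mono (r :: nat \<Rightarrow> nat) \<and> (\<forall>i\<in>I. (\<lambda>k. x (r k) i) \<longlonglongrightarrow> l i)"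
  using assms
proof (induction I)
  case empty
  then show ?case by (intro exI[of _ id]) (auto simp: strict_mono_def)
next
  case (insert i I)
  have "\<exists>r l. strict_mono (r :: nat \<Rightarrow> nat) \<and> (\<forall>i\<in>I. (\<lambda>k. x (r k) i) \<longlonglongrightarrow> l i)"
    by (rule insert.IH) (use insert.prems in auto)
  then obtain r :: "nat \<Rightarrow> nat" and l
    where r: "strict_mono r" "\<And>i. i \<in> I \<Longrightarrow> (\<lambda>k. x (r k) i) \<longlonglongrightarrow> l i"
    by blast
  have "compact (S i)" "\<forall>k. x (r k) i \<in> S i" using insert by auto
  then obtain s c where s: "strict_mono s" "((\<lambda>k. x (r k) i) \<circ> s) \<longlonglongrightarrow> c"
    unfolding compact_def by meson
  have "(\<lambda>k. x ((r \<circ> s) k) j) \<longlonglongrightarrow> (l(i := c)) j" if "j \<in> insert i I" for j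
  proof (cases "j = i")
    case True
    then show ?thesis using s(2) by (simp add: comp_def)
  next
    case False
    then have "((\<lambda>k. x (r k) j) \<circ> s) \<longlonglongrightarrow> l j"
      using that r(2) s(1) by (intro LIMSEQ_subseq_LIMSEQ) auto
    then show ?thesis using False by (simp add: comp_def)
  qed
  then show ?case using strict_mono_o[OF r(1) s(1)] by blast
qed

definition tuple_norm :: "nat \<Rightarrow> (nat \<Rightarrow> 'h::real_normed_vector) \<Rightarrow> real" where
  "tuple_norm n v = L2_set (\<lambda>j. norm (v j)) {..<n}"

lemma tuple_norm_nonneg: "0 \<le> tuple_norm n v"
  by (simp add: tuple_norm_def L2_set_nonneg)

lemma tuple_norm_square: "(tuple_norm n v)\<^sup>2 = (\<Sum>j<n. (norm (v j))\<^sup>2)"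
  by (simp add: tuple_norm_def L2_set_def sum_nonneg)

lemma norm_le_tuple_norm: "j < n \<Longrightarrow> norm (v j) \<le> tuple_norm n v"
  unfolding tuple_norm_def by (rule member_le_L2_set) auto

lemma tuple_norm_scaleR: "tuple_norm n (\<lambda>j. c *\<^sub>R v j) = \<bar>c\<bar> * tuple_norm n v"
  by (simp add: tuple_norm_def L2_set_right_distrib)

lemma tuple_norm_eq_0_iff: "tuple_norm n v = 0 \<longleftrightarrow> (\<forall>j<n. v j = 0)"
  by (auto simp: tuple_norm_def L2_set_eq_0_iff)

locale real_spectrahedron =
  fixes ip :: "'h::banach \<Rightarrow> 'h \<Rightarrow> real" and A :: "'g::finite \<Rightarrow> 'h \<Rightarrow> 'h"
  assumes hilbert: "hilbert_space_over (*\<^sub>R) ip"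
    and compact_sa: "\<And>a. compact_selfadjoint (*\<^sub>R) ip (A a)"
begin

sublocale hilbert_space_over "(*\<^sub>R)" ip
  by (rule hilbert)

lemma ip_commute: "ip x y = ip y x"
  using ip_conjugate[of x y] by simp

lemma ip_self: "ip x x = (norm x)\<^sup>2"
  using ip_norm[of x] by simp

lemma ip_scaleR: "ip (c *\<^sub>R x) y = c * ip x y" "ip x (c *\<^sub>R y) = c * ip x y"
  using ip_smul_left[of c x y] ip_smul_right[of x c y] by simp_all

lemma ip_diff_right: "ip x (y - z) = ip x y - ip x z"
  using ip_diff_left[of y z x] by (simp add: ip_commute)

lemma ip_cauchy_schwarz: "\<bar>ip x y\<bar> \<le> norm x * norm y"
proof -
  have "0 \<le> (norm x)\<^sup>2 + 2 * t * ip x y + t\<^sup>2 * (norm y)\<^sup>2" for t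
  proof -
    have "(norm (x + t *\<^sub>R y))\<^sup>2 = (norm x)\<^sup>2 + 2 * t * ip x y + t\<^sup>2 * (norm y)\<^sup>2"
      unfolding ip_self[symmetric]
      by (simp add: ip_add_left ip_add_right ip_scaleR ip_commute[of y x] algebra_simps power2_eq_square)
    then show ?thesis by (metis zero_le_power2)
  qed
  from discriminant_le[OF this] have "(ip x y)\<^sup>2 \<le> (norm x * norm y)\<^sup>2"
    by (simp add: power_mult_distrib)
  then show ?thesis by (simp add: abs_le_square_iff[symmetric])
qed

lemma A_selfadjoint: "ip (A a x) y = ip x (A a y)"
  using compact_sa[of a] by (auto simp: compact_selfadjoint_def)

lemma A_linear: "A a (x + y) = A a x + A a y" "A a (c *\<^sub>R x) = c *\<^sub>R A a x"
  "A a (x - y) = A a x - A a y" "A a 0 = 0"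
proof -
  interpret T: Vector_Spaces.linear "(*\<^sub>R)" "(*\<^sub>R)" "A a"
    using compact_sa[of a] by (simp add: compact_selfadjoint_def)
  show "A a (x + y) = A a x + A a y" "A a (c *\<^sub>R x) = c *\<^sub>R A a x"
    "A a (x - y) = A a x - A a y" "A a 0 = 0"
    by (simp_all add: T.add T.scale T.diff)
qed

lemma A_compact: "compact (closure (A a ` cball 0 1))"
  using compact_sa[of a] by (simp add: compact_selfadjoint_def)

lemma A_bounded: "\<exists>B\<ge>0. \<forall>a x. norm (A a x) \<le> B * norm x"
proof -
  have "\<exists>b\<ge>0. \<forall>x. norm (A a x) \<le> b * norm x" for a
  proof -
    have "bounded (A a ` cball 0 1)"
      by (rule bounded_subset[OF compact_imp_bounded[OF A_compact] closure_subset])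
    then obtain b where b: "\<And>x. norm x \<le> 1 \<Longrightarrow> norm (A a x) \<le> b"
      unfolding bounded_iff by (metis imageI mem_cball_0)
    have "norm (A a x) \<le> b * norm x" for x
    proof (cases "x = 0")
      case True
      then show ?thesis by (simp add: A_linear)
    next
      case False
      have "norm (A a x) = norm x * norm (A a ((1 / norm x) *\<^sub>R x))"
        using False unfolding A_linear by simp
      also have "\<dots> \<le> norm x * b"
        using False by (intro mult_left_mono b) auto
      finally show ?thesis by (simp add: mult.commute)
    qed
    moreover have "0 \<le> b" using b[of 0] by (simp add: A_linear)
    ultimately show ?thesis by blast
  qed
  then obtain b where b: "\<And>a. 0 \<le> b a" "\<And>a x. norm (A a x) \<le> b a * norm x" by metis
  have "norm (A a x) \<le> sum b UNIV * norm x" for a x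
    using b(2)[of a x] member_le_sum[of a UNIV b] b(1)
    by (meson finite UNIV_I mult_right_mono norm_ge_zero order_trans)
  then show ?thesis using b(1) by (meson sum_nonneg)
qed

text \<open>
  This is \<open>\<Lambda>\<^sub>A(\<beta>\<^sup>*)\<close>, the block row with entries \<open>\<Sum>\<^sub>a \<beta>(a, k) A\<^sub>a\<close>. The pencil \<open>L\<close> is the identity minus
  the block rows of the coefficients \<open>x\<close>; only indices below \<open>n\<close> matter.
\<close>

definition row_op :: "nat \<Rightarrow> ('g \<times> nat \<Rightarrow> real) \<Rightarrow> (nat \<Rightarrow> 'h) \<Rightarrow> 'h" where
  "row_op n \<beta> v = (\<Sum>a\<in>UNIV. \<Sum>k<n. \<beta> (a, k) *\<^sub>R A a (v k))"

definition L :: "nat \<Rightarrow> ('g \<Rightarrow> nat \<Rightarrow> nat \<Rightarrow> real) \<Rightarrow> (nat \<Rightarrow> 'h) \<Rightarrow> nat \<Rightarrow> 'h" where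
  "L n x v j = v j - row_op n (\<lambda>(a, k). x a j k) v"

definition Q :: "nat \<Rightarrow> ('g \<Rightarrow> nat \<Rightarrow> nat \<Rightarrow> real) \<Rightarrow> (nat \<Rightarrow> 'h) \<Rightarrow> real" where
  "Q n x v = (\<Sum>j<n. ip (L n x v j) (v j))"

definition nonneg_pencil :: "nat \<Rightarrow> ('g \<Rightarrow> nat \<Rightarrow> nat \<Rightarrow> real) \<Rightarrow> bool" where
  "nonneg_pencil n x \<longleftrightarrow> (\<forall>a. \<forall>i<n. \<forall>j<n. x a i j = x a j i) \<and> (\<forall>v. 0 \<le> Q n x v)"

definition in_kernel :: "nat \<Rightarrow> ('g \<Rightarrow> nat \<Rightarrow> nat \<Rightarrow> real) \<Rightarrow> (nat \<Rightarrow> 'h) \<Rightarrow> bool" where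
  "in_kernel n x z \<longleftrightarrow> (\<forall>j<n. L n x z j = 0)"

lemma row_linear:
  "row_op n \<beta> (\<lambda>j. u j + v j) = row_op n \<beta> u + row_op n \<beta> v"
  "row_op n \<beta> (\<lambda>j. c *\<^sub>R v j) = c *\<^sub>R row_op n \<beta> v"
  "row_op n \<beta> (\<lambda>j. u j - v j) = row_op n \<beta> u - row_op n \<beta> v"
  by (simp_all add: row_op_def A_linear scaleR_add_right scaleR_diff_right sum.distrib sum_subtractf
      scaleR_sum_right mult.commute)

lemma row_linear_coeff:
  "row_op n (\<lambda>i. \<beta> i + \<eta> i) v = row_op n \<beta> v + row_op n \<eta> v"
  "row_op n (\<lambda>i. c * \<beta> i) v = c *\<^sub>R row_op n \<beta> v"
  "row_op n (\<lambda>_. 0) v = 0"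
  by (simp_all add: row_op_def scaleR_add_left sum.distrib scaleR_sum_right)

lemma row_cong:
  "(\<And>a k. k < n \<Longrightarrow> \<beta> (a, k) = \<eta> (a, k)) \<Longrightarrow> (\<And>k. k < n \<Longrightarrow> v k = w k) \<Longrightarrow> row_op n \<beta> v = row_op n \<eta> w"
  by (simp add: row_op_def)

lemma row_bounded: "\<exists>B\<ge>0. \<forall>v. norm (row_op n \<beta> v) \<le> B * tuple_norm n v"
proof -
  obtain b where b: "0 \<le> b" "\<And>a x. norm (A a x) \<le> b * norm x" using A_bounded by blast
  let ?B = "\<Sum>a\<in>UNIV. \<Sum>k<n. \<bar>\<beta> (a, k)\<bar> * b"
  have "norm (row_op n \<beta> v) \<le> ?B * tuple_norm n v" for v
  proof -
    have "norm (row_op n \<beta> v) \<le> (\<Sum>a\<in>UNIV. \<Sum>k<n. norm (\<beta> (a, k) *\<^sub>R A a (v k)))"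
      unfolding row_op_def by (intro order_trans[OF norm_sum] sum_mono norm_sum)
    also have "\<dots> \<le> (\<Sum>a\<in>UNIV. \<Sum>k<n. (\<bar>\<beta> (a, k)\<bar> * b) * tuple_norm n v)"
    proof (intro sum_mono)
      fix a k assume "k \<in> {..<n}"
      then have "norm (A a (v k)) \<le> b * tuple_norm n v"
        using b norm_le_tuple_norm[of k n v] by (meson lessThan_iff mult_left_mono order_trans)
      then show "norm (\<beta> (a, k) *\<^sub>R A a (v k)) \<le> (\<bar>\<beta> (a, k)\<bar> * b) * tuple_norm n v"
        by (simp add: mult.assoc mult_left_mono)
    qed
    also have "\<dots> = ?B * tuple_norm n v" by (simp add: sum_distrib_right)
    finally show ?thesis .
  qed
  moreover have "0 \<le> ?B" using b(1) by (intro sum_nonneg) auto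
  ultimately show ?thesis by blast
qed

lemma L_linear:
  "L n x (\<lambda>j. u j + v j) j = L n x u j + L n x v j"
  "L n x (\<lambda>j. c *\<^sub>R v j) j = c *\<^sub>R L n x v j"
  "L n x (\<lambda>j. u j - v j) j = L n x u j - L n x v j"
  by (simp_all add: L_def row_linear scaleR_diff_right)

lemma L_bounded: "\<exists>B\<ge>0. \<forall>v. tuple_norm n (L n x v) \<le> B * tuple_norm n v"
proof -
  have "\<forall>j. \<exists>b\<ge>0. \<forall>v. norm (row_op n (\<lambda>(a, k). x a j k) v) \<le> b * tuple_norm n v"
    using row_bounded by blast
  from choice[OF this] obtain b where b: "\<And>j. 0 \<le> b j"
    "\<And>j v. norm (row_op n (\<lambda>(a, k). x a j k) v) \<le> b j * tuple_norm n v"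
    by blast
  have "tuple_norm n (L n x v) \<le> (\<Sum>j<n. 1 + b j) * tuple_norm n v" for v
  proof -
    have "tuple_norm n (L n x v) \<le> (\<Sum>j<n. norm (L n x v j))"
      unfolding tuple_norm_def by (rule L2_set_le_sum) auto
    also have "\<dots> \<le> (\<Sum>j<n. (1 + b j) * tuple_norm n v)"
    proof (intro sum_mono)
      fix j assume "j \<in> {..<n}"
      then have "norm (v j) \<le> tuple_norm n v" by (simp add: norm_le_tuple_norm)
      then have "norm (v j) + norm (row_op n (\<lambda>(a, k). x a j k) v) \<le> (1 + b j) * tuple_norm n v"
        using b(2)[of j v] by (simp add: distrib_right)
      then show "norm (L n x v j) \<le> (1 + b j) * tuple_norm n v"
        unfolding L_def by (rule order_trans[OF norm_triangle_ineq4])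
    qed
    also have "\<dots> = (\<Sum>j<n. 1 + b j) * tuple_norm n v" by (rule sum_distrib_right[symmetric])
    finally show ?thesis .
  qed
  moreover have "0 \<le> (\<Sum>j<n. 1 + b j)" using b(1) by (intro sum_nonneg) (simp add: add_nonneg_nonneg)
  ultimately show ?thesis by blast
qed

lemma L_symmetric:
  assumes "\<And>a i j. i < n \<Longrightarrow> j < n \<Longrightarrow> x a i j = x a j i"
  shows "(\<Sum>j<n. ip (L n x u j) (v j)) = (\<Sum>j<n. ip (u j) (L n x v j))"
proof -
  have "(\<Sum>j<n. ip (row_op n (\<lambda>(a, k). x a j k) u) (v j)) = (\<Sum>j<n. \<Sum>a\<in>UNIV. \<Sum>k<n. x a j k * ip (u k) (A a (v j)))"
    by (simp add: row_op_def ip_sum_left ip_scaleR A_selfadjoint)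
  also have "\<dots> = (\<Sum>a\<in>UNIV. \<Sum>j<n. \<Sum>k<n. x a j k * ip (u k) (A a (v j)))"
    by (rule sum.swap)
  also have "\<dots> = (\<Sum>a\<in>UNIV. \<Sum>k<n. \<Sum>j<n. x a j k * ip (u k) (A a (v j)))"
    by (intro sum.cong refl sum.swap)
  also have "\<dots> = (\<Sum>k<n. \<Sum>a\<in>UNIV. \<Sum>j<n. x a j k * ip (u k) (A a (v j)))"
    by (rule sum.swap)
  also have "\<dots> = (\<Sum>k<n. \<Sum>a\<in>UNIV. \<Sum>j<n. x a k j * ip (u k) (A a (v j)))"
    using assms by (intro sum.cong refl) auto
  also have "\<dots> = (\<Sum>k<n. ip (u k) (row_op n (\<lambda>(a, j). x a k j) v))"
    by (simp add: row_op_def ip_sum_right ip_scaleR)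
  finally show ?thesis
    by (simp add: L_def ip_diff_left ip_diff_right sum_subtractf)
qed

lemma Q_bounded: "\<exists>B\<ge>0. \<forall>v. Q n x v \<le> B * (tuple_norm n v)\<^sup>2"
proof -
  obtain b where b: "0 \<le> b" "\<And>v. tuple_norm n (L n x v) \<le> b * tuple_norm n v"
    using L_bounded by blast
  have "Q n x v \<le> b * (tuple_norm n v)\<^sup>2" for v
  proof -
    have "Q n x v \<le> (\<Sum>j<n. \<bar>norm (L n x v j)\<bar> * \<bar>norm (v j)\<bar>)"
      unfolding Q_def by (intro sum_mono) (use ip_cauchy_schwarz abs_le_D1 in auto)
    also have "\<dots> \<le> tuple_norm n (L n x v) * tuple_norm n v"
      unfolding tuple_norm_def by (rule L2_set_mult_ineq)
    also have "\<dots> \<le> b * tuple_norm n v * tuple_norm n v"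
      by (intro mult_right_mono b tuple_norm_nonneg)
    finally show ?thesis by (simp add: power2_eq_square mult.assoc)
  qed
  then show ?thesis using b(1) by blast
qed

text \<open>Cauchy-Schwarz for the form \<open>Q\<close>, applied to \<open>v\<close> and \<open>L v\<close>.\<close>

lemma L_norm_le_form:
  assumes x: "nonneg_pencil n x"
  shows "\<exists>B\<ge>0. \<forall>v. (tuple_norm n (L n x v))\<^sup>2 \<le> B * Q n x v"
proof -
  obtain B where B: "0 \<le> B" "\<And>v. Q n x v \<le> B * (tuple_norm n v)\<^sup>2" using Q_bounded by blast
  have "(tuple_norm n (L n x v))\<^sup>2 \<le> B * Q n x v" for v
  proof -
    let ?u = "L n x v"
    define N where "N = (tuple_norm n ?u)\<^sup>2"
    have N: "N = (\<Sum>j<n. ip (L n x v j) (?u j))"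
      by (simp add: N_def tuple_norm_square ip_self)
    have "Q n x (\<lambda>j. v j + t *\<^sub>R ?u j) = Q n x v + 2 * t * N + t\<^sup>2 * Q n x ?u" for t
    proof -
      have "(\<Sum>j<n. ip (L n x ?u j) (v j)) = N"
        using L_symmetric[of n x v ?u] x by (simp add: N nonneg_pencil_def ip_commute)
      then show ?thesis
        unfolding Q_def L_linear N
        by (simp add: ip_add_left ip_add_right ip_scaleR sum.distrib power2_eq_square
            flip: sum_distrib_left) (simp add: algebra_simps)
    qed
    then have "0 \<le> Q n x v + 2 * t * N + t\<^sup>2 * Q n x ?u" for t
      using x unfolding nonneg_pencil_def by metis
    moreover have "0 \<le> Q n x ?u" using x by (simp add: nonneg_pencil_def)
    ultimately have "N\<^sup>2 \<le> Q n x v * Q n x ?u" by (rule discriminant_le)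
    also have "\<dots> \<le> Q n x v * (B * N)"
      using B(2)[of ?u] x by (intro mult_left_mono) (auto simp: N_def nonneg_pencil_def)
    finally have "N * N \<le> (B * Q n x v) * N" by (simp add: power2_eq_square mult_ac)
    moreover have "0 \<le> B * Q n x v" using B(1) x by (simp add: nonneg_pencil_def)
    moreover have "0 \<le> N" by (simp add: N_def)
    ultimately show ?thesis
      unfolding N_def[symmetric] by (cases "N = 0") auto
  qed
  then show ?thesis using B(1) by blast
qed

lemma form_zero_imp_kernel:
  assumes "nonneg_pencil n x" "Q n x v = 0"
  shows "in_kernel n x v"
proof -
  obtain B where B: "0 \<le> B" "\<And>v. (tuple_norm n (L n x v))\<^sup>2 \<le> B * Q n x v"
    using L_norm_le_form[OF assms(1)] by blast
  have "(tuple_norm n (L n x v))\<^sup>2 \<le> 0" using B(2)[of v] assms(2) by simp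
  then show ?thesis by (simp add: in_kernel_def tuple_norm_eq_0_iff)
qed

lemma A_tendsto: "f \<longlonglongrightarrow> l \<Longrightarrow> (\<lambda>k. A a (f k)) \<longlonglongrightarrow> A a l"
proof -
  obtain b where "\<And>a x. norm (A a x) \<le> b * norm x" using A_bounded by blast
  then have "bounded_linear (A a)"
    by (intro bounded_linear_intro[of _ b]) (auto simp: A_linear mult.commute)
  then show "f \<longlonglongrightarrow> l \<Longrightarrow> (\<lambda>k. A a (f k)) \<longlonglongrightarrow> A a l"
    by (rule bounded_linear.tendsto)
qed

end

section \<open>Operators vanishing on the kernel\<close>

lemma tuple_norm_cong: "(\<And>j. j < n \<Longrightarrow> v j = w j) \<Longrightarrow> tuple_norm n v = tuple_norm n w"
  unfolding tuple_norm_def by (intro L2_set_cong) auto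

lemma bounded_closed_attains_sup:
  fixes S :: "('i::finite \<Rightarrow> real) set" and f :: "('i \<Rightarrow> real) \<Rightarrow> real"
  assumes "S \<noteq> {}" and bounded: "\<And>s i. s \<in> S \<Longrightarrow> \<bar>s i\<bar> \<le> C"
    and closed: "\<And>s l. (\<And>k. s k \<in> S) \<Longrightarrow> (\<And>i. (\<lambda>k::nat. s k i) \<longlonglongrightarrow> l i) \<Longrightarrow> l \<in> S"
    and continuous: "\<And>s l. (\<And>i. (\<lambda>k::nat. s k i) \<longlonglongrightarrow> l i) \<Longrightarrow> (\<lambda>k. f (s k)) \<longlonglongrightarrow> f l"
  shows "\<exists>s\<in>S. \<forall>t\<in>S. f t \<le> f s"
proof -
  have "compact (f ` S)"
    unfolding compact_def
  proof (intro allI impI)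
    fix y :: "nat \<Rightarrow> real"
    assume "\<forall>k. y k \<in> f ` S"
    then have "\<forall>k. \<exists>s. s \<in> S \<and> y k = f s" by blast
    from choice[OF this] obtain s where s: "\<And>k. s k \<in> S" "\<And>k. y k = f (s k)" by blast
    have "s k i \<in> {-C..C}" for k i
      using bounded[OF s(1), of k i] by auto
    then have "\<exists>r l. strict_mono (r :: nat \<Rightarrow> nat) \<and> (\<forall>i\<in>UNIV. (\<lambda>k. s (r k) i) \<longlonglongrightarrow> l i)"
      by (intro finite_convergent_subsequence[of UNIV "\<lambda>_. {-C..C}" s]) auto
    then obtain r :: "nat \<Rightarrow> nat" and l where
      r: "strict_mono r" "\<And>i. (\<lambda>k. s (r k) i) \<longlonglongrightarrow> l i" by blast
    have "l \<in> S" using closed[of "\<lambda>k. s (r k)" l] s(1) r(2) by blast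
    moreover have "(y \<circ> r) \<longlonglongrightarrow> f l"
      using continuous[of "\<lambda>k. s (r k)" l] r(2) by (simp add: comp_def s(2))
    ultimately show "\<exists>l\<in>f ` S. \<exists>r. strict_mono r \<and> (y \<circ> r) \<longlonglongrightarrow> l"
      using r(1) by blast
  qed
  then obtain m where "m \<in> f ` S" "\<forall>t\<in>f ` S. t \<le> m"
    using compact_attains_sup[of "f ` S"] assms(1) by blast
  then show ?thesis by blast
qed

context real_spectrahedron
begin

lemma in_kernel_linear:
  "in_kernel n x (\<lambda>_. 0)"
  "in_kernel n x u \<Longrightarrow> in_kernel n x v \<Longrightarrow> in_kernel n x (\<lambda>j. u j + v j)"
  "in_kernel n x v \<Longrightarrow> in_kernel n x (\<lambda>j. c *\<^sub>R v j)"
  using L_linear(2)[of n x 0 "\<lambda>_. 0"] by (auto simp: in_kernel_def L_linear)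

text \<open>
  Riesz: the range of a compact perturbation of the identity is closed. Otherwise there are bounded
  vectors at distance at least one from the kernel whose images tend to zero; by compactness a
  subsequence converges, and its limit lies in the kernel.
\<close>

lemma kernel_distance_le:
  "\<exists>C\<ge>0. \<forall>v. \<exists>z. in_kernel n x z \<and> tuple_norm n (\<lambda>j. v j - z j) \<le> C * tuple_norm n (L n x v)"
proof (rule ccontr)
  assume neg: "\<not> ?thesis"
  have "\<exists>u. tuple_norm n u \<le> 2 \<and> tuple_norm n (L n x u) * real (Suc k) \<le> 1 \<and>
      (\<forall>z. in_kernel n x z \<longrightarrow> 1 \<le> tuple_norm n (\<lambda>j. u j - z j))" for k
  proof -
    obtain v where v: "\<And>z. in_kernel n x z \<Longrightarrow>
        real (Suc k) * tuple_norm n (L n x v) < tuple_norm n (\<lambda>j. v j - z j)"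
      using neg by (metis not_le of_nat_0_le_iff)
    define dist where "dist = (\<lambda>z. tuple_norm n (\<lambda>j. v j - z j)) ` {z. in_kernel n x z}"
    define d where "d = Inf dist"
    have ne: "dist \<noteq> {}" using in_kernel_linear(1) by (auto simp: dist_def)
    have bdd: "bdd_below dist"
      unfolding dist_def by (intro bdd_belowI2[of _ 0] tuple_norm_nonneg)
    have d_ge: "real (Suc k) * tuple_norm n (L n x v) \<le> d"
      unfolding d_def using v by (intro cInf_greatest[OF ne]) (auto simp: dist_def less_imp_le)
    have "0 < d"
    proof (rule ccontr)
      assume "\<not> 0 < d"
      then have "real (Suc k) * tuple_norm n (L n x v) \<le> 0" using d_ge by linarith
      then have "tuple_norm n (L n x v) = 0"
        using tuple_norm_nonneg[of n "L n x v"] by (simp add: mult_le_0_iff)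
      then have "in_kernel n x v" by (simp add: in_kernel_def tuple_norm_eq_0_iff)
      from v[OF this] have "0 < tuple_norm n (\<lambda>j. 0 :: 'h)"
        using \<open>tuple_norm n (L n x v) = 0\<close> by simp
      moreover have "tuple_norm n (\<lambda>j. 0 :: 'h) = 0" by (simp add: tuple_norm_eq_0_iff)
      ultimately show False by simp
    qed
    then have "Inf dist < 2 * d" by (simp add: d_def)
    then obtain z where z: "in_kernel n x z" "tuple_norm n (\<lambda>j. v j - z j) < 2 * d"
      using cInf_lessD[OF ne] by (auto simp: dist_def)
    define u where "u = (\<lambda>j. (1 / d) *\<^sub>R (v j - z j))"
    have "tuple_norm n u = tuple_norm n (\<lambda>j. v j - z j) / d"
      using \<open>0 < d\<close> by (simp add: u_def tuple_norm_scaleR del: scaleR_diff_right)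
    then have "tuple_norm n u \<le> 2"
      using z(2) \<open>0 < d\<close> by (simp add: divide_le_eq)
    moreover have "tuple_norm n (L n x u) * real (Suc k) \<le> 1"
    proof -
      have "tuple_norm n (L n x u) = tuple_norm n (\<lambda>j. (1 / d) *\<^sub>R L n x v j)"
        using z(1) by (intro tuple_norm_cong) (simp add: u_def L_linear in_kernel_def)
      then have "tuple_norm n (L n x u) * real (Suc k) = real (Suc k) * tuple_norm n (L n x v) / d"
        using \<open>0 < d\<close> by (simp add: tuple_norm_scaleR)
      also have "\<dots> \<le> 1" using d_ge \<open>0 < d\<close> by (simp add: divide_le_eq)
      finally show ?thesis .
    qed
    moreover have "1 \<le> tuple_norm n (\<lambda>j. u j - z' j)" if z': "in_kernel n x z'" for z'
    proof -
      have "in_kernel n x (\<lambda>j. z j + d *\<^sub>R z' j)"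
        using z(1) z' by (intro in_kernel_linear)
      then have "d \<le> tuple_norm n (\<lambda>j. v j - (z j + d *\<^sub>R z' j))"
        unfolding d_def by (intro cInf_lower bdd) (auto simp: dist_def)
      moreover have "(\<lambda>j. u j - z' j) = (\<lambda>j. (1 / d) *\<^sub>R (v j - (z j + d *\<^sub>R z' j)))"
        using \<open>0 < d\<close> by (simp add: u_def scaleR_diff_right scaleR_add_right diff_diff_eq)
      ultimately show ?thesis
        using \<open>0 < d\<close> by (simp add: tuple_norm_scaleR del: scaleR_diff_right)
    qed
    ultimately show ?thesis by blast
  qed
  then have "\<forall>k. \<exists>u. tuple_norm n u \<le> 2 \<and> tuple_norm n (L n x u) * real (Suc k) \<le> 1 \<and>
      (\<forall>z. in_kernel n x z \<longrightarrow> 1 \<le> tuple_norm n (\<lambda>j. u j - z j))" by blast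
  from choice[OF this] obtain u where
    u: "\<And>k. tuple_norm n (u k) \<le> 2" "\<And>k. tuple_norm n (L n x (u k)) * real (Suc k) \<le> 1"
      "\<And>k z. in_kernel n x z \<Longrightarrow> 1 \<le> tuple_norm n (\<lambda>j. u k j - z j)" by blast
  let ?S = "\<lambda>(a, j). (\<lambda>h. 2 *\<^sub>R h) ` closure (A a ` cball 0 1)"
  have S: "A a (u k j) \<in> ?S (a, j)" if "j < n" for a j k
  proof -
    have "norm ((1 / 2) *\<^sub>R u k j) \<le> 1"
      using norm_le_tuple_norm[OF that, of "u k"] u(1)[of k] by simp
    then have "A a ((1 / 2) *\<^sub>R u k j) \<in> closure (A a ` cball 0 1)"
      by (intro subsetD[OF closure_subset] imageI) simp
    moreover have "A a (u k j) = 2 *\<^sub>R A a ((1 / 2) *\<^sub>R u k j)" by (simp add: A_linear)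
    ultimately show ?thesis by blast
  qed
  have "\<exists>r l. strict_mono (r :: nat \<Rightarrow> nat) \<and>
      (\<forall>i\<in>UNIV \<times> {..<n}. (\<lambda>k. (\<lambda>k (a, j). A a (u k j)) (r k) i) \<longlonglongrightarrow> l i)"
    using S by (intro finite_convergent_subsequence[of _ ?S])
      (auto intro!: compact_scaling A_compact)
  then obtain r :: "nat \<Rightarrow> nat" and l where r: "strict_mono r"
    "\<And>a j. j < n \<Longrightarrow> (\<lambda>k. A a (u (r k) j)) \<longlonglongrightarrow> l (a, j)" by auto
  define y where "y j = (\<Sum>a\<in>UNIV. \<Sum>i<n. x a j i *\<^sub>R l (a, i))" for j
  have L0: "(\<lambda>k. L n x (u (r k)) j) \<longlonglongrightarrow> 0" if "j < n" for j
  proof -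
    have "(\<lambda>k. L n x (u k) j) \<longlonglongrightarrow> 0"
    proof (rule Lim_null_comparison)
      show "\<forall>\<^sub>F k in sequentially. norm (L n x (u k) j) \<le> 1 / real (Suc k)"
      proof (intro always_eventually allI)
        fix k
        have "tuple_norm n (L n x (u k)) \<le> 1 / real (Suc k)"
          using u(2)[of k] by (simp add: le_divide_eq)
        then show "norm (L n x (u k) j) \<le> 1 / real (Suc k)"
          using norm_le_tuple_norm[OF that, of "L n x (u k)"] by linarith
      qed
      show "(\<lambda>k. 1 / real (Suc k)) \<longlonglongrightarrow> 0" by (rule LIMSEQ_Suc[OF lim_1_over_n])
    qed
    from LIMSEQ_subseq_LIMSEQ[OF this r(1)] show ?thesis by (simp add: comp_def)
  qed
  have uy: "(\<lambda>k. u (r k) j) \<longlonglongrightarrow> y j" if "j < n" for j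
  proof -
    have "(\<lambda>k. L n x (u (r k)) j + row_op n (\<lambda>(a, k). x a j k) (u (r k))) \<longlonglongrightarrow> 0 + y j"
      unfolding row_op_def y_def by (intro tendsto_add L0[OF that]) (auto intro!: tendsto_intros r(2))
    then show ?thesis by (simp add: L_def)
  qed
  have "in_kernel n x y"
    unfolding in_kernel_def
  proof (intro allI impI)
    fix j assume j: "j < n"
    have "(\<lambda>k. L n x (u (r k)) j) \<longlonglongrightarrow> L n x y j"
      unfolding L_def row_op_def by (auto intro!: tendsto_intros A_tendsto uy j)
    then show "L n x y j = 0" using L0[OF j] LIMSEQ_unique by blast
  qed
  have "(\<lambda>k. \<Sum>j<n. norm (u (r k) j - y j)) \<longlonglongrightarrow> (\<Sum>j<n. norm (y j - y j))"
    by (intro tendsto_sum tendsto_norm tendsto_diff uy tendsto_const) auto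
  moreover have "1 \<le> (\<Sum>j<n. norm (u (r k) j - y j))" for k
    using u(3)[OF \<open>in_kernel n x y\<close>, of "r k"]
    by (rule order_trans) (auto simp: tuple_norm_def intro: L2_set_le_sum)
  ultimately have "1 \<le> (\<Sum>j<n. norm (y j - y j))"
    by (intro LIMSEQ_le_const[of _ _ 1]) auto
  then show False by simp
qed

definition corner :: "('g \<Rightarrow> real) \<Rightarrow> 'h \<Rightarrow> 'h" where
  "corner \<gamma> h = (\<Sum>a\<in>UNIV. \<gamma> a *\<^sub>R A a h)"

lemma corner_linear:
  "corner \<gamma> (c *\<^sub>R h) = c *\<^sub>R corner \<gamma> h"
  "corner \<gamma> (h - h') = corner \<gamma> h - corner \<gamma> h'"
  "corner \<gamma> 0 = 0"
  by (simp_all add: corner_def A_linear scaleR_diff_right sum_subtractf scaleR_sum_right mult.commute)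

lemma ip_corner: "ip (corner \<gamma> h) h' = (\<Sum>a\<in>UNIV. \<gamma> a * ip (A a h) h')"
  by (simp add: corner_def ip_sum_left ip_scaleR)

lemma corner_selfadjoint: "ip (corner \<gamma> h) h' = ip h (corner \<gamma> h')"
  by (simp add: corner_def ip_sum_left ip_sum_right ip_scaleR A_selfadjoint)

lemma row_Suc: "row_op (Suc n) \<beta> v = row_op n \<beta> v + corner (\<lambda>a. \<beta> (a, n)) (v n)"
  by (simp add: row_op_def corner_def sum.distrib)

lemma row_extend_by_zero:
  "n \<le> p \<Longrightarrow> row_op p \<beta> (\<lambda>j. if j < n then z j else 0) = row_op n \<beta> z"
proof -
  assume np: "n \<le> p"
  have "row_op p \<beta> (\<lambda>j. if j < n then z j else 0) =
      (\<Sum>a\<in>UNIV. \<Sum>k<p. if k < n then \<beta> (a, k) *\<^sub>R A a (z k) else 0)"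
    unfolding row_op_def by (intro sum.cong refl) (auto simp: A_linear)
  also have "\<dots> = row_op n \<beta> z"
    unfolding row_op_def using np
    by (intro sum.cong refl sum.mono_neutral_cong_right) auto
  finally show ?thesis .
qed

lemma form_controls_kernel_distance:
  assumes "nonneg_pencil n x"
  shows "\<exists>C\<ge>0. \<forall>v. \<exists>z. in_kernel n x z \<and> (tuple_norm n (\<lambda>j. v j - z j))\<^sup>2 \<le> C * Q n x v"
proof -
  obtain C where C: "0 \<le> C"
    "\<And>v. \<exists>z. in_kernel n x z \<and> tuple_norm n (\<lambda>j. v j - z j) \<le> C * tuple_norm n (L n x v)"
    using kernel_distance_le by blast
  obtain B where B: "0 \<le> B" "\<And>v. (tuple_norm n (L n x v))\<^sup>2 \<le> B * Q n x v"
    using L_norm_le_form[OF assms] by blast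
  have "\<exists>z. in_kernel n x z \<and> (tuple_norm n (\<lambda>j. v j - z j))\<^sup>2 \<le> (C\<^sup>2 * B) * Q n x v" for v
  proof -
    obtain z where z: "in_kernel n x z" "tuple_norm n (\<lambda>j. v j - z j) \<le> C * tuple_norm n (L n x v)"
      using C(2) by blast
    have "(tuple_norm n (\<lambda>j. v j - z j))\<^sup>2 \<le> C\<^sup>2 * (tuple_norm n (L n x v))\<^sup>2"
      using power_mono[OF z(2) tuple_norm_nonneg, of 2] by (simp add: power_mult_distrib)
    also have "\<dots> \<le> C\<^sup>2 * (B * Q n x v)" by (intro mult_left_mono B) simp
    finally show ?thesis using z(1) by (auto simp: mult.assoc)
  qed
  then show ?thesis using B(1) by (intro exI[of _ "C\<^sup>2 * B"]) auto
qed

text \<open>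
  An operator that vanishes on the kernel is bounded by the distance to the kernel, hence by the form.
\<close>

lemma row_le_form:
  assumes x: "nonneg_pencil n x" and \<beta>: "\<And>z. in_kernel n x z \<Longrightarrow> row_op n \<beta> z = 0"
  shows "\<exists>M>0. \<forall>v. (norm (row_op n \<beta> v))\<^sup>2 \<le> M * Q n x v"
proof -
  obtain C where C: "0 \<le> C"
    "\<And>v. \<exists>z. in_kernel n x z \<and> (tuple_norm n (\<lambda>j. v j - z j))\<^sup>2 \<le> C * Q n x v"
    using form_controls_kernel_distance[OF x] by blast
  obtain B where B: "0 \<le> B" "\<And>v. norm (row_op n \<beta> v) \<le> B * tuple_norm n v"
    using row_bounded by blast
  have "(norm (row_op n \<beta> v))\<^sup>2 \<le> (B\<^sup>2 * C + 1) * Q n x v" for v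
  proof -
    obtain z where z: "in_kernel n x z" "(tuple_norm n (\<lambda>j. v j - z j))\<^sup>2 \<le> C * Q n x v"
      using C(2) by blast
    have "norm (row_op n \<beta> v) = norm (row_op n \<beta> (\<lambda>j. v j - z j))"
      by (simp add: row_linear \<beta>[OF z(1)])
    then have "(norm (row_op n \<beta> v))\<^sup>2 \<le> (B * tuple_norm n (\<lambda>j. v j - z j))\<^sup>2"
      using B(2) by (simp add: power_mono)
    also have "\<dots> \<le> B\<^sup>2 * (C * Q n x v)"
      unfolding power_mult_distrib by (intro mult_left_mono z(2)) simp
    also have "\<dots> \<le> (B\<^sup>2 * C + 1) * Q n x v"
      using x by (simp add: nonneg_pencil_def distrib_right)
    finally show ?thesis .
  qed
  moreover have "B\<^sup>2 * C + 1 > 0" using C(1) by (simp add: add_nonneg_pos)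
  ultimately show ?thesis by blast
qed

text \<open>
  The operator \<open>corner \<sigma>\<close> is self-adjoint and annihilates component \<open>m\<close> of every kernel vector, so its
  form at \<open>v\<^sub>m\<close> does not change when a kernel vector is subtracted from \<open>v\<close>.
\<close>

lemma corner_le_form:
  assumes x: "nonneg_pencil n x" and m: "m < n"
    and \<sigma>: "\<And>z. in_kernel n x z \<Longrightarrow> corner \<sigma> (z m) = 0"
  shows "\<exists>M>0. \<forall>v. \<bar>ip (corner \<sigma> (v m)) (v m)\<bar> \<le> M * Q n x v"
proof -
  obtain C where C: "0 \<le> C"
    "\<And>v. \<exists>z. in_kernel n x z \<and> (tuple_norm n (\<lambda>j. v j - z j))\<^sup>2 \<le> C * Q n x v"
    using form_controls_kernel_distance[OF x] by blast
  obtain B0 where B0: "0 \<le> B0" "\<And>v. norm (row_op 1 (\<lambda>(a, k). \<sigma> a) v) \<le> B0 * tuple_norm 1 v"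
    using row_bounded by blast
  have B: "0 \<le> B0" "norm (corner \<sigma> h) \<le> B0 * norm h" for h
    using B0(1) B0(2)[of "\<lambda>_. h"] by (simp_all add: row_op_def corner_def tuple_norm_def L2_set_def lessThan_Suc)
  have "\<bar>ip (corner \<sigma> (v m)) (v m)\<bar> \<le> (B0 * C + 1) * Q n x v" for v
  proof -
    obtain z where z: "in_kernel n x z" "(tuple_norm n (\<lambda>j. v j - z j))\<^sup>2 \<le> C * Q n x v"
      using C(2) by blast
    let ?d = "v m - z m"
    have c: "corner \<sigma> (v m) = corner \<sigma> ?d" by (simp add: corner_linear \<sigma>[OF z(1)])
    then have "ip (corner \<sigma> (v m)) (v m) = ip ?d (corner \<sigma> ?d)"
      by (simp add: corner_selfadjoint)
    also have "\<bar>\<dots>\<bar> \<le> norm ?d * (B0 * norm ?d)"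
      using B(2)[of ?d] by (intro order_trans[OF ip_cauchy_schwarz] mult_left_mono) auto
    also have "\<dots> = B0 * (norm ?d)\<^sup>2" by (simp add: power2_eq_square)
    also have "\<dots> \<le> B0 * (tuple_norm n (\<lambda>j. v j - z j))\<^sup>2"
      using norm_le_tuple_norm[OF m, of "\<lambda>j. v j - z j"] B(1) by (intro mult_left_mono power_mono) auto
    also have "\<dots> \<le> B0 * (C * Q n x v)" by (intro mult_left_mono z(2) B(1))
    also have "\<dots> \<le> (B0 * C + 1) * Q n x v"
      using x by (simp add: nonneg_pencil_def distrib_right)
    finally show ?thesis .
  qed
  moreover have "B0 * C + 1 > 0" using C(1) B(1) by (simp add: add_nonneg_pos)
  ultimately show ?thesis by blast
qed

section \<open>Dilations by one row and column\<close>

definition ext ::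
  "nat \<Rightarrow> ('g \<Rightarrow> nat \<Rightarrow> nat \<Rightarrow> real) \<Rightarrow> ('g \<times> nat \<Rightarrow> real) \<Rightarrow> ('g \<Rightarrow> real) \<Rightarrow> 'g \<Rightarrow> nat \<Rightarrow> nat \<Rightarrow> real"
  where "ext n x \<beta> \<gamma> a i j =
    (if i < n then if j < n then x a i j else \<beta> (a, i) else if j < n then \<beta> (a, j) else \<gamma> a)"

lemma L_ext:
  "j < n \<Longrightarrow> L (Suc n) (ext n x \<beta> \<gamma>) v j = L n x v j - corner (\<lambda>a. \<beta> (a, j)) (v n)"
  "L (Suc n) (ext n x \<beta> \<gamma>) v n = v n - row_op n \<beta> v - corner \<gamma> (v n)"
  unfolding L_def row_Suc
  by (simp_all add: row_op_def ext_def diff_diff_eq)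

lemma Q_ext:
  "Q (Suc n) (ext n x \<beta> \<gamma>) v =
     Q n x v - 2 * ip (row_op n \<beta> v) (v n) + (norm (v n))\<^sup>2 - ip (corner \<gamma> (v n)) (v n)"
proof -
  have "(\<Sum>j<n. ip (corner (\<lambda>a. \<beta> (a, j)) (v n)) (v j)) =
      (\<Sum>j<n. \<Sum>a\<in>UNIV. \<beta> (a, j) * ip (A a (v j)) (v n))"
    unfolding ip_corner by (intro sum.cong refl) (metis A_selfadjoint ip_commute)
  also have "\<dots> = (\<Sum>a\<in>UNIV. \<Sum>j<n. \<beta> (a, j) * ip (A a (v j)) (v n))"
    by (rule sum.swap)
  also have "\<dots> = ip (row_op n \<beta> v) (v n)"
    by (simp add: row_op_def ip_sum_left ip_scaleR)
  finally have *: "(\<Sum>j<n. ip (corner (\<lambda>a. \<beta> (a, j)) (v n)) (v j)) = ip (row_op n \<beta> v) (v n)" .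
  have "(\<Sum>j<n. ip (L (Suc n) (ext n x \<beta> \<gamma>) v j) (v j)) = Q n x v - ip (row_op n \<beta> v) (v n)"
    unfolding *[symmetric] Q_def by (simp add: L_ext ip_diff_left sum_subtractf)
  then show ?thesis
    by (simp add: Q_def[of "Suc n"] L_ext(2) ip_diff_left ip_self)
qed

lemma nonneg_pencil_ext_iff:
  assumes "nonneg_pencil n x"
  shows "nonneg_pencil (Suc n) (ext n x \<beta> \<gamma>) \<longleftrightarrow>
    (\<forall>v. 0 \<le> Q n x v - 2 * ip (row_op n \<beta> v) (v n) + (norm (v n))\<^sup>2 - ip (corner \<gamma> (v n)) (v n))"
  using assms unfolding nonneg_pencil_def[of "Suc n"] Q_ext by (auto simp: ext_def nonneg_pencil_def)

lemma L_principal_block: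
  assumes "n \<le> p" "\<And>a i j. i < n \<Longrightarrow> j < n \<Longrightarrow> w a i j = x a i j"
  defines "v \<equiv> \<lambda>z j. if j < n then z j else 0"
  shows "j < n \<Longrightarrow> L p w (v z) j = L n x z j"
    and "n \<le> j \<Longrightarrow> L p w (v z) j = - row_op n (\<lambda>(a, k). w a j k) z"
  unfolding L_def v_def row_extend_by_zero[OF assms(1)]
  using assms(2) by (auto intro!: row_cong)

text \<open>
  A row added to a nonnegative matrix vanishes on the kernel of the old one: extended by zeros, a
  kernel vector is a null vector of the larger form.
\<close>

lemma added_row_vanishes_on_kernel:
  assumes w: "nonneg_pencil p w" and np: "n \<le> p"
    and block: "\<And>a i j. i < n \<Longrightarrow> j < n \<Longrightarrow> w a i j = x a i j"
    and z: "in_kernel n x z" and i: "n \<le> i" "i < p"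
  shows "row_op n (\<lambda>(a, k). w a i k) z = 0"
proof -
  let ?v = "\<lambda>j. if j < n then z j else 0"
  have block': "j < n \<Longrightarrow> L p w ?v j = L n x z j" "n \<le> j \<Longrightarrow> L p w ?v j = - row_op n (\<lambda>(a, k). w a j k) z" for j
    using L_principal_block[of n p w x j z] np block by blast+
  have "Q p w ?v = 0"
    unfolding Q_def using z by (intro sum.neutral) (auto simp: block'(1) in_kernel_def)
  from form_zero_imp_kernel[OF w this] have "L p w ?v i = 0"
    using i by (simp add: in_kernel_def)
  then show ?thesis using block'(2)[OF i(1)] by simp
qed

text \<open>
  By the preceding lemma all columns of dilations belong to this set; by the next one its elements are
  columns of dilations up to scaling.
\<close>

definition directions :: "nat \<Rightarrow> ('g \<Rightarrow> nat \<Rightarrow> nat \<Rightarrow> real) \<Rightarrow> ('g \<times> nat \<Rightarrow> real) set" where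
  "directions n x = {\<beta>. (\<forall>a k. n \<le> k \<longrightarrow> \<beta> (a, k) = 0) \<and> (\<forall>z. in_kernel n x z \<longrightarrow> row_op n \<beta> z = 0)}"

text \<open>
  With corner zero, the new form at \<open>(v, u)\<close> is at least \<open>(c \<parallel>row_op n \<beta> v\<parallel> - \<parallel>u\<parallel>)\<^sup>2\<close> once \<open>c\<close> is so small that
  \<open>(c \<parallel>row_op n \<beta> v\<parallel>)\<^sup>2\<close> is bounded by the old form.
\<close>

lemma direction_dilates:
  assumes x: "nonneg_pencil n x" and \<beta>: "\<beta> \<in> directions n x"
  shows "\<exists>c>0. nonneg_pencil (Suc n) (ext n x (\<lambda>i. c * \<beta> i) (\<lambda>_. 0))"
proof -
  obtain M where M: "M > 0" "\<And>v. (norm (row_op n \<beta> v))\<^sup>2 \<le> M * Q n x v"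
    using row_le_form[OF x, of \<beta>] \<beta> unfolding directions_def by blast
  \<comment> \<open>The largest multiple for which \<open>row_le_form\<close> bounds the new row by the form.\<close>
  define c where "c = 1 / sqrt M"
  have c: "c > 0" "c\<^sup>2 * M = 1" using M(1) by (auto simp: c_def power_divide)
  have "0 \<le> Q n x v - 2 * ip (row_op n (\<lambda>i. c * \<beta> i) v) (v n) + (norm (v n))\<^sup>2 - ip (corner (\<lambda>_. 0) (v n)) (v n)" for v
  proof -
    let ?r = "norm (row_op n \<beta> v)" and ?u = "norm (v n)"
    have "ip (row_op n (\<lambda>i. c * \<beta> i) v) (v n) \<le> c * (?r * ?u)"
      using ip_cauchy_schwarz[of "row_op n \<beta> v" "v n"] c(1)
      by (simp add: row_linear_coeff ip_scaleR)
    moreover have "(c * ?r)\<^sup>2 \<le> Q n x v"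
    proof -
      have "(c * ?r)\<^sup>2 \<le> c\<^sup>2 * (M * Q n x v)"
        unfolding power_mult_distrib by (intro mult_left_mono M(2)) simp
      then show ?thesis using c(2) by (simp add: mult.assoc[symmetric])
    qed
    moreover have "0 \<le> (c * ?r - ?u)\<^sup>2" by simp
    then have "0 \<le> (c * ?r)\<^sup>2 - 2 * (c * (?r * ?u)) + ?u\<^sup>2"
      by (simp add: power2_diff mult.assoc)
    ultimately show ?thesis by (simp add: ip_corner)
  qed
  then show ?thesis
    using c(1) nonneg_pencil_ext_iff[OF x] by blast
qed

text \<open>
  The dilation used in the induction: first the multiple of the direction \<open>\<beta>\<close> is maximal, then the
  norm of the corner.
\<close>

definition maximal_dilation ::
  "nat \<Rightarrow> ('g \<Rightarrow> nat \<Rightarrow> nat \<Rightarrow> real) \<Rightarrow> ('g \<times> nat \<Rightarrow> real) \<Rightarrow> real \<Rightarrow> ('g \<Rightarrow> real) \<Rightarrow> bool" where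
  "maximal_dilation n x \<beta> c \<gamma> \<longleftrightarrow> 0 < c \<and> nonneg_pencil (Suc n) (ext n x (\<lambda>i. c * \<beta> i) \<gamma>) \<and>
     (\<forall>c' \<gamma>'. nonneg_pencil (Suc n) (ext n x (\<lambda>i. c' * \<beta> i) \<gamma>') \<longrightarrow> c' \<le> c) \<and>
     (\<forall>\<gamma>'. nonneg_pencil (Suc n) (ext n x (\<lambda>i. c * \<beta> i) \<gamma>') \<longrightarrow>
        (\<Sum>a\<in>UNIV. (\<gamma>' a)\<^sup>2) \<le> (\<Sum>a\<in>UNIV. (\<gamma> a)\<^sup>2))"

text \<open>
  The admissible multiples and corners form a closed set. It is bounded because the entries of the
  dilations are, where a nonzero entry of \<open>\<beta>\<close> bounds the multiple.
\<close>

lemma exists_maximal_dilation: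
  assumes x: "nonneg_pencil n x" and \<beta>: "\<beta> \<in> directions n x" "\<beta> \<noteq> (\<lambda>_. 0)"
    and bounded: "\<And>w a i j. nonneg_pencil (Suc n) w \<Longrightarrow> i < Suc n \<Longrightarrow> j < Suc n \<Longrightarrow> \<bar>w a i j\<bar> \<le> C"
  shows "\<exists>c \<gamma>. maximal_dilation n x \<beta> c \<gamma>"
proof -
  \<comment> \<open>The index \<open>None\<close> holds the multiple of \<open>\<beta>\<close>, the indices \<open>Some a\<close> the corner.\<close>
  define S where "S = {s :: 'g option \<Rightarrow> real.
    nonneg_pencil (Suc n) (ext n x (\<lambda>i. s None * \<beta> i) (\<lambda>a. s (Some a)))}"
  obtain a0 k0 where \<beta>0: "\<beta> (a0, k0) \<noteq> 0" using \<beta>(2) by (metis surj_pair)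
  then have k0: "k0 < n" using \<beta>(1) not_le by (auto simp: directions_def)
  define C' where "C' = max C (C / \<bar>\<beta> (a0, k0)\<bar>)"
  have bdd: "\<bar>s i\<bar> \<le> C'" if s: "s \<in> S" for s i
  proof (cases i)
    case None
    have "\<bar>s None * \<beta> (a0, k0)\<bar> \<le> C"
      using bounded[of _ k0 n a0] s k0 by (fastforce simp: S_def ext_def)
    then have "\<bar>s None\<bar> \<le> C / \<bar>\<beta> (a0, k0)\<bar>"
      using \<beta>0 by (simp add: abs_mult le_divide_eq)
    then show ?thesis using None by (simp add: C'_def)
  next
    case (Some a)
    have "\<bar>s (Some a)\<bar> \<le> C"
      using bounded[of _ n n a] s by (fastforce simp: S_def ext_def)
    then show ?thesis using Some by (simp add: C'_def)
  qed
  note S_iff = nonneg_pencil_ext_iff[OF x]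
  have closed: "l \<in> S" if s: "\<And>k. s k \<in> S" and lim: "\<And>i. (\<lambda>k::nat. s k i) \<longlonglongrightarrow> l i" for s l
  proof -
    have "0 \<le> Q n x v - 2 * ip (row_op n (\<lambda>i. l None * \<beta> i) v) (v n) + (norm (v n))\<^sup>2 -
        ip (corner (\<lambda>a. l (Some a)) (v n)) (v n)" for v
    proof (rule LIMSEQ_le_const)
      show "(\<lambda>k. Q n x v - 2 * (s k None * ip (row_op n \<beta> v) (v n)) + (norm (v n))\<^sup>2 -
          (\<Sum>a\<in>UNIV. s k (Some a) * ip (A a (v n)) (v n))) \<longlonglongrightarrow>
        Q n x v - 2 * ip (row_op n (\<lambda>i. l None * \<beta> i) v) (v n) + (norm (v n))\<^sup>2 -
          ip (corner (\<lambda>a. l (Some a)) (v n)) (v n)"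
        unfolding row_linear_coeff ip_scaleR ip_corner by (intro tendsto_intros lim)
      show "\<exists>N. \<forall>k\<ge>N. 0 \<le> Q n x v - 2 * (s k None * ip (row_op n \<beta> v) (v n)) + (norm (v n))\<^sup>2 -
          (\<Sum>a\<in>UNIV. s k (Some a) * ip (A a (v n)) (v n))"
        using s unfolding S_def mem_Collect_eq S_iff row_linear_coeff ip_scaleR ip_corner by blast
    qed
    then show ?thesis unfolding S_def mem_Collect_eq S_iff by blast
  qed
  obtain c0 where c0: "c0 > 0" "nonneg_pencil (Suc n) (ext n x (\<lambda>i. c0 * \<beta> i) (\<lambda>_. 0))"
    using direction_dilates[OF x \<beta>(1)] by blast
  then have c0S: "case_option c0 (\<lambda>_. 0) \<in> S" by (simp add: S_def)
  have "\<exists>s\<in>S. \<forall>t\<in>S. t None \<le> s None"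
    using c0S bdd closed by (intro bounded_closed_attains_sup[of S C']) auto
  then obtain s where s: "s \<in> S" "\<And>t. t \<in> S \<Longrightarrow> t None \<le> s None" by blast
  define S' where "S' = {t \<in> S. t None = s None}"
  have "\<exists>t\<in>S'. \<forall>t'\<in>S'. (\<Sum>a\<in>UNIV. (t' (Some a))\<^sup>2) \<le> (\<Sum>a\<in>UNIV. (t (Some a))\<^sup>2)"
  proof (rule bounded_closed_attains_sup[of S' C'])
    show "S' \<noteq> {}" using s(1) by (auto simp: S'_def)
    show "\<bar>t i\<bar> \<le> C'" if "t \<in> S'" for t i using bdd that by (simp add: S'_def)
    show "l \<in> S'" if t: "\<And>k. t k \<in> S'" and lim: "\<And>i. (\<lambda>k::nat. t k i) \<longlonglongrightarrow> l i" for t l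
    proof -
      have "l \<in> S" using closed[of t l] t lim by (simp add: S'_def)
      moreover have "(\<lambda>k. t k None) \<longlonglongrightarrow> s None" using t by (simp add: S'_def)
      then have "l None = s None" using lim[of None] LIMSEQ_unique by blast
      ultimately show ?thesis by (simp add: S'_def)
    qed
    show "(\<lambda>k. \<Sum>a\<in>UNIV. (t k (Some a))\<^sup>2) \<longlonglongrightarrow> (\<Sum>a\<in>UNIV. (l (Some a))\<^sup>2)"
      if lim: "\<And>i. (\<lambda>k::nat. t k i) \<longlonglongrightarrow> l i" for t :: "nat \<Rightarrow> 'g option \<Rightarrow> real" and l
      by (intro tendsto_sum tendsto_power lim)
  qed
  then obtain t where t: "t \<in> S'"
    "\<And>t'. t' \<in> S' \<Longrightarrow> (\<Sum>a\<in>UNIV. (t' (Some a))\<^sup>2) \<le> (\<Sum>a\<in>UNIV. (t (Some a))\<^sup>2)" by blast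
  have tS: "t \<in> S" "t None = s None" using t(1) by (auto simp: S'_def)
  have "maximal_dilation n x \<beta> (t None) (\<lambda>a. t (Some a))"
    unfolding maximal_dilation_def
  proof (intro conjI allI impI)
    show "0 < t None" using s(2)[OF c0S] c0(1) tS(2) by simp
    show "nonneg_pencil (Suc n) (ext n x (\<lambda>i. t None * \<beta> i) (\<lambda>a. t (Some a)))"
      using tS(1) by (simp add: S_def)
    show "c' \<le> t None" if "nonneg_pencil (Suc n) (ext n x (\<lambda>i. c' * \<beta> i) \<gamma>')" for c' \<gamma>'
      using s(2)[of "case_option c' \<gamma>'"] that tS(2) by (simp add: S_def)
    show "(\<Sum>a\<in>UNIV. (\<gamma>' a)\<^sup>2) \<le> (\<Sum>a\<in>UNIV. (t (Some a))\<^sup>2)"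
      if "nonneg_pencil (Suc n) (ext n x (\<lambda>i. t None * \<beta> i) \<gamma>')" for \<gamma>'
      using t(2)[of "case_option (t None) \<gamma>'"] that tS(2) by (simp add: S'_def S_def)
  qed
  then show ?thesis by blast
qed

end

section \<open>Dimension count\<close>

interpretation fun_space: vector_space "scale_fun :: 'f::field \<Rightarrow> ('i \<Rightarrow> 'f) \<Rightarrow> 'i \<Rightarrow> 'f"
  by (rule vector_space_scale_fun)

lemma supported_subset_span:
  assumes "finite F"
  shows "{f :: 'i \<Rightarrow> 'f::field. \<forall>i. i \<notin> F \<longrightarrow> f i = 0} \<subseteq>
    fun_space.span ((\<lambda>i j. if j = i then 1 else 0) ` F)"
  using assms
proof (induction F)
  case empty
  have "f = 0" if "\<forall>i. f i = 0" for f :: "'i \<Rightarrow> 'f" using that by auto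
  then show ?case using fun_space.span_zero by auto
next
  case (insert i F)
  show ?case
  proof
    fix f :: "'i \<Rightarrow> 'f"
    assume "f \<in> {f. \<forall>j. j \<notin> insert i F \<longrightarrow> f j = 0}"
    then have "f(i := 0) \<in> {f. \<forall>j. j \<notin> F \<longrightarrow> f j = 0}" by auto
    then have "f(i := 0) \<in> fun_space.span ((\<lambda>i j. if j = i then 1 else 0) ` F)"
      using insert.IH by blast
    then have "f(i := 0) \<in> fun_space.span ((\<lambda>i j. if j = i then 1 else 0) ` insert i F)"
      by (rule subsetD[OF fun_space.span_mono, rotated]) blast
    moreover have "scale_fun (f i) (\<lambda>j. if j = i then 1 else 0) \<in>
        fun_space.span ((\<lambda>i j. if j = i then 1 else 0) ` insert i F)"
      by (intro fun_space.span_scale fun_space.span_base) simp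
    moreover have "f = f(i := 0) + scale_fun (f i) (\<lambda>j. if j = i then 1 else 0)"
      by (auto simp: scale_fun_def fun_eq_iff)
    ultimately show "f \<in> fun_space.span ((\<lambda>i j. if j = i then 1 else 0) ` insert i F)"
      by (metis fun_space.span_add)
  qed
qed

lemma supported_in_finite_span:
  fixes V :: "('g::finite \<times> nat \<Rightarrow> 'f::field) set"
  assumes "\<And>f a k. f \<in> V \<Longrightarrow> n \<le> k \<Longrightarrow> f (a, k) = 0"
  obtains T where "finite T" "card T \<le> n * CARD('g)" "V \<subseteq> fun_space.span T"
proof -
  let ?F = "UNIV \<times> {..<n} :: ('g \<times> nat) set"
  let ?T = "(\<lambda>i j. if j = i then 1 else 0 :: 'f) ` ?F"
  have "V \<subseteq> {f. \<forall>i. i \<notin> ?F \<longrightarrow> f i = 0}" using assms by auto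
  also have "\<dots> \<subseteq> fun_space.span ?T" by (rule supported_subset_span) simp
  finally have "V \<subseteq> fun_space.span ?T" .
  moreover have "card ?T \<le> n * CARD('g)"
    using card_image_le[of ?F] by (metis card_cartesian_product card_lessThan finite_SigmaI
        finite_lessThan finite mult.commute)
  ultimately show thesis using that[of ?T] by simp
qed

lemma dim_less_of_injection:
  fixes f :: "('i \<Rightarrow> 'f::field) \<Rightarrow> 'i \<Rightarrow> 'f"
  assumes T: "finite T" "W \<subseteq> fun_space.span T"
    and V: "fun_space.subspace V" and f: "Vector_Spaces.linear scale_fun scale_fun f"
    and inj: "inj_on f V" and img: "f ` V \<subseteq> W" and w: "w \<in> W" "w \<notin> f ` V"
  shows "fun_space.dim V < fun_space.dim W"
proof -
  interpret f: Vector_Spaces.linear scale_fun scale_fun f by (rule f)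
  obtain B where B: "B \<subseteq> V" "fun_space.independent B" "V \<subseteq> fun_space.span B" "card B = fun_space.dim V"
    using fun_space.basis_exists by blast
  have span: "fun_space.span B \<subseteq> V" using fun_space.span_minimal[OF B(1) V] .
  have fB: "fun_space.independent (f ` B)"
    using B(2) inj_on_subset[OF inj span] by (rule f.independent_injective_image)
  have "w \<notin> fun_space.span (f ` B)"
    unfolding f.span_image using w(2) span by blast
  then have ind: "fun_space.independent (insert w (f ` B))"
    using fB fun_space.independent_insertI by blast
  obtain C where C: "C \<subseteq> W" "fun_space.independent C" "W \<subseteq> fun_space.span C" "card C = fun_space.dim W"
    using fun_space.basis_exists by blast
  have "finite C"
    using fun_space.independent_span_bound[OF T(1) C(2)] C(1) T(2) by blast
  have sub: "insert w (f ` B) \<subseteq> fun_space.span C"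
    using w(1) img B(1) C(3) by blast
  have "finite (insert w (f ` B)) \<and> card (insert w (f ` B)) \<le> card C"
    by (rule fun_space.independent_span_bound[OF \<open>finite C\<close> ind sub])
  moreover have "card (f ` B) = card B"
    using inj_on_subset[OF inj B(1)] by (rule card_image)
  moreover have "w \<notin> f ` B" using w(2) B(1) by blast
  ultimately show ?thesis using B(4) C(4) by (auto simp: card_insert_if)
qed

definition restrict_coords :: "nat \<Rightarrow> ('g \<times> nat \<Rightarrow> 'f::zero) \<Rightarrow> 'g \<times> nat \<Rightarrow> 'f" where
  "restrict_coords n \<eta> = (\<lambda>(a, k). if k < n then \<eta> (a, k) else 0)"

lemma linear_restrict_coords:
  "Vector_Spaces.linear scale_fun scale_fun (restrict_coords n :: ('g \<times> nat \<Rightarrow> 'f::field) \<Rightarrow> _)"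
  by unfold_locales (auto simp: restrict_coords_def scale_fun_def fun_eq_iff algebra_simps)

context real_spectrahedron
begin

lemma subspace_directions: "fun_space.subspace (directions n x)"
proof (rule fun_space.subspaceI)
  show "0 \<in> directions n x"
    using row_linear_coeff(3)[of n] by (simp add: directions_def zero_fun_def)
  show "\<beta> + \<eta> \<in> directions n x" if "\<beta> \<in> directions n x" "\<eta> \<in> directions n x" for \<beta> \<eta>
    using that row_linear_coeff(1)[of n \<beta> \<eta>] by (simp add: directions_def plus_fun_def)
  show "scale_fun c \<beta> \<in> directions n x" if "\<beta> \<in> directions n x" for c \<beta>
    using that row_linear_coeff(2)[of n c \<beta>] by (simp add: directions_def scale_fun_def)
qed

text \<open>
  A kernel vector of \<open>x\<close>, extended by zero, is a kernel vector of the bordered tuple, because \<open>\<beta>\<close> is a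
  direction of \<open>x\<close>.
\<close>

lemma restrict_direction:
  assumes x: "nonneg_pencil n x" and \<beta>: "\<beta> \<in> directions n x"
    and y: "nonneg_pencil (Suc n) (ext n x \<beta> \<gamma>)" and \<eta>: "\<eta> \<in> directions (Suc n) (ext n x \<beta> \<gamma>)"
  shows "restrict_coords n \<eta> \<in> directions n x"
proof -
  have "row_op n (restrict_coords n \<eta>) z = 0" if z: "in_kernel n x z" for z
  proof -
    let ?v = "\<lambda>j. if j < n then z j else 0"
    have block: "ext n x \<beta> \<gamma> a i j = x a i j" if "i < n" "j < n" for a i j
      using that by (simp add: ext_def)
    have "row_op n (\<lambda>(a, k). ext n x \<beta> \<gamma> a n k) z = 0"
      by (rule added_row_vanishes_on_kernel[OF y _ block z]) auto
    then have "in_kernel (Suc n) (ext n x \<beta> \<gamma>) ?v"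
      using z L_principal_block[of n "Suc n" "ext n x \<beta> \<gamma>" x _ z] block
      unfolding in_kernel_def less_Suc_eq by force
    then have "row_op (Suc n) \<eta> ?v = 0" using \<eta> by (simp add: directions_def)
    then have "row_op n \<eta> z = 0" by (simp add: row_extend_by_zero)
    moreover have "row_op n (restrict_coords n \<eta>) z = row_op n \<eta> z"
      by (rule row_cong) (auto simp: restrict_coords_def)
    ultimately show ?thesis by simp
  qed
  then show ?thesis by (simp add: directions_def restrict_coords_def)
qed

text \<open>
  A direction of the maximal dilation supported in the new coordinate alone would allow the corner to
  be moved both ways, contradicting the maximality of its norm.
\<close>

lemma no_direction_in_corner:
  assumes x: "nonneg_pencil n x" and max: "maximal_dilation n x \<beta> c \<gamma>"
    and \<eta>: "\<eta> \<in> directions (Suc n) (ext n x (\<lambda>i. c * \<beta> i) \<gamma>)" and zero: "restrict_coords n \<eta> = (\<lambda>_. 0)"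
  shows "\<eta> = (\<lambda>_. 0)"
proof -
  let ?y = "ext n x (\<lambda>i. c * \<beta> i) \<gamma>"
  define \<sigma> where "\<sigma> = (\<lambda>a. \<eta> (a, n))"
  have \<eta>0: "\<eta> (a, k) = 0" if "k < n" for a k
    using fun_cong[OF zero, of "(a, k)"] that by (simp add: restrict_coords_def)
  have y: "nonneg_pencil (Suc n) ?y" using max by (simp add: maximal_dilation_def)
  have kernel: "corner \<sigma> (z n) = 0" if "in_kernel (Suc n) ?y z" for z
  proof -
    have "row_op (Suc n) \<eta> z = 0" using \<eta> that by (simp add: directions_def)
    moreover have "row_op n \<eta> z = 0" by (simp add: row_op_def \<eta>0)
    ultimately show ?thesis by (simp add: row_Suc \<sigma>_def)
  qed
  obtain M where M: "M > 0" "\<And>v. \<bar>ip (corner \<sigma> (v n)) (v n)\<bar> \<le> M * Q (Suc n) ?y v"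
    using corner_le_form[of "Suc n" ?y n \<sigma>] y kernel by blast
  have moved: "(\<Sum>a\<in>UNIV. (\<gamma> a + e * \<sigma> a)\<^sup>2) \<le> (\<Sum>a\<in>UNIV. (\<gamma> a)\<^sup>2)" if e: "\<bar>e\<bar> = 1 / M" for e
  proof -
    have "0 \<le> Q n x v - 2 * ip (row_op n (\<lambda>i. c * \<beta> i) v) (v n) + (norm (v n))\<^sup>2 -
        ip (corner (\<lambda>a. \<gamma> a + e * \<sigma> a) (v n)) (v n)" for v
    proof -
      have "e * ip (corner \<sigma> (v n)) (v n) \<le> \<bar>e\<bar> * \<bar>ip (corner \<sigma> (v n)) (v n)\<bar>"
        by (metis abs_ge_self abs_mult)
      also have "\<dots> \<le> (1 / M) * (M * Q (Suc n) ?y v)"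
        unfolding e using M by (intro mult_left_mono) auto
      also have "\<dots> = Q (Suc n) ?y v" using M(1) by simp
      finally have "e * ip (corner \<sigma> (v n)) (v n) \<le> Q (Suc n) ?y v" .
      moreover have "ip (corner (\<lambda>a. \<gamma> a + e * \<sigma> a) (v n)) (v n) =
          ip (corner \<gamma> (v n)) (v n) + e * ip (corner \<sigma> (v n)) (v n)"
        by (simp add: ip_corner distrib_right sum.distrib sum_distrib_left mult.assoc)
      ultimately show ?thesis by (simp add: Q_ext)
    qed
    then have "nonneg_pencil (Suc n) (ext n x (\<lambda>i. c * \<beta> i) (\<lambda>a. \<gamma> a + e * \<sigma> a))"
      using nonneg_pencil_ext_iff[OF x] by blast
    then show ?thesis using max unfolding maximal_dilation_def by blast
  qed
  have "(\<Sum>a\<in>UNIV. (\<gamma> a + (1 / M) * \<sigma> a)\<^sup>2) + (\<Sum>a\<in>UNIV. (\<gamma> a + (- (1 / M)) * \<sigma> a)\<^sup>2) =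
      2 * (\<Sum>a\<in>UNIV. (\<gamma> a)\<^sup>2) + 2 * (\<Sum>a\<in>UNIV. ((1 / M) * \<sigma> a)\<^sup>2)"
    unfolding sum_distrib_left sum.distrib[symmetric]
    by (intro sum.cong refl) (simp add: power2_eq_square algebra_simps)
  then have "(\<Sum>a\<in>UNIV. ((1 / M) * \<sigma> a)\<^sup>2) \<le> 0"
    using moved[of "1 / M"] moved[of "- (1 / M)"] M(1) by simp
  then have "(\<Sum>a\<in>UNIV. ((1 / M) * \<sigma> a)\<^sup>2) = 0"
    using sum_nonneg[of UNIV "\<lambda>a. ((1 / M) * \<sigma> a)\<^sup>2"] by (intro antisym) auto
  then have \<sigma>0: "\<sigma> a = 0" for a
    using M(1) by (subst (asm) sum_nonneg_eq_0_iff) auto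
  show ?thesis
  proof
    fix i :: "'g \<times> nat"
    obtain a k where i: "i = (a, k)" by (cases i)
    consider "k < n" | "k = n" | "Suc n \<le> k" by linarith
    then have "\<eta> (a, k) = 0"
    proof cases
      case 1
      then show ?thesis by (rule \<eta>0)
    next
      case 2
      then show ?thesis using \<sigma>0[of a] by (simp add: \<sigma>_def)
    next
      case 3
      then show ?thesis using \<eta> by (simp add: directions_def)
    qed
    then show "\<eta> i = 0" unfolding i .
  qed
qed

text \<open>
  If the old direction extended to a direction of the maximal dilation, rotating the two new
  coordinates into one would produce a larger multiple of it.
\<close>

lemma maximal_direction_not_restricted:
  assumes x: "nonneg_pencil n x" and max: "maximal_dilation n x \<beta> c \<gamma>"
    and \<eta>: "\<eta> \<in> directions (Suc n) (ext n x (\<lambda>i. c * \<beta> i) \<gamma>)"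
  shows "restrict_coords n \<eta> \<noteq> \<beta>"
proof
  assume \<beta>: "restrict_coords n \<eta> = \<beta>"
  let ?y = "ext n x (\<lambda>i. c * \<beta> i) \<gamma>"
  have c: "0 < c" and y: "nonneg_pencil (Suc n) ?y"
    using max by (simp_all add: maximal_dilation_def)
  obtain d where d: "d > 0" "nonneg_pencil (Suc (Suc n)) (ext (Suc n) ?y (\<lambda>i. d * \<eta> i) (\<lambda>_. 0))"
    using direction_dilates[OF y \<eta>] by blast
  define t where "t = d / c"
  have t: "t > 0" "t * c = d" using c d(1) by (simp_all add: t_def)
  define s where "s = sqrt (1 + t\<^sup>2)"
  have s: "s > 1" "s\<^sup>2 = 1 + t\<^sup>2" using t(1) by (simp_all add: s_def)
  \<comment> \<open>The rotation \<open>(p, q)\<close> is parallel to \<open>(1, t)\<close>, which makes \<open>p + q t\<close> largest.\<close>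
  define p q where "p = 1 / s" and "q = t / s"
  have pq: "p\<^sup>2 + q\<^sup>2 = 1" "p + q * t = s"
  proof -
    have "p\<^sup>2 + q\<^sup>2 = (1 + t\<^sup>2) / s\<^sup>2"
      by (simp add: p_def q_def power_divide add_divide_distrib)
    moreover have "s\<^sup>2 \<noteq> 0" using s(1) by simp
    ultimately show "p\<^sup>2 + q\<^sup>2 = 1" unfolding s(2)[symmetric] by simp
    have "p + q * t = (1 + t\<^sup>2) / s" by (simp add: p_def q_def power2_eq_square add_divide_distrib)
    also have "\<dots> = s" unfolding s(2)[symmetric] by (simp add: power2_eq_square)
    finally show "p + q * t = s" .
  qed
  define \<sigma> where "\<sigma> = (\<lambda>a. d * \<eta> (a, n))"
  define \<gamma>' where "\<gamma>' a = p\<^sup>2 * \<gamma> a + 2 * (p * q) * \<sigma> a" for a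
  have "0 \<le> Q n x v - 2 * ip (row_op n (\<lambda>i. (s * c) * \<beta> i) v) (v n) + (norm (v n))\<^sup>2 - ip (corner \<gamma>' (v n)) (v n)" for v
  proof -
    let ?u = "v n"
    define w where "w j = (if j < n then v j else if j = n then p *\<^sub>R ?u else q *\<^sub>R ?u)" for j
    let ?r = "ip (row_op n \<beta> v) ?u"
    have wn: "w n = p *\<^sub>R ?u" "w (Suc n) = q *\<^sub>R ?u" by (simp_all add: w_def)
    have roww: "row_op n \<theta> w = row_op n \<theta> v" for \<theta>
      by (rule row_cong) (simp_all add: w_def)
    have Qw: "Q n x w = Q n x v"
    proof -
      have "L n x w j = L n x v j" if "j < n" for j
        using that by (simp add: L_def roww) (simp add: w_def)
      then show ?thesis by (simp add: Q_def w_def)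
    qed
    have 1: "Q (Suc n) ?y w = Q n x v - 2 * (p * c) * ?r + p\<^sup>2 * (norm ?u)\<^sup>2 - p\<^sup>2 * ip (corner \<gamma> ?u) ?u"
      unfolding Q_ext wn roww Qw row_linear_coeff corner_linear ip_scaleR
      by (simp add: power_mult_distrib power2_eq_square)
    have 2: "ip (row_op (Suc n) (\<lambda>i. d * \<eta> i) w) (w (Suc n)) = q * (d * ?r) + q * p * ip (corner \<sigma> ?u) ?u"
    proof -
      have "row_op n (\<lambda>i. d * \<eta> i) w = d *\<^sub>R row_op n \<beta> v"
        unfolding roww row_linear_coeff \<beta>[symmetric]
        by (intro arg_cong[of _ _ "scaleR d"] row_cong) (auto simp: restrict_coords_def)
      then show ?thesis
        unfolding row_Suc wn ip_scaleR by (simp add: ip_add_left ip_scaleR corner_linear \<sigma>_def distrib_left)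
    qed
    have "0 \<le> Q (Suc (Suc n)) (ext (Suc n) ?y (\<lambda>i. d * \<eta> i) (\<lambda>_. 0)) w"
      using d(2) by (simp add: nonneg_pencil_def)
    also have "\<dots> = Q n x v - 2 * (p * c) * ?r + p\<^sup>2 * (norm ?u)\<^sup>2 - p\<^sup>2 * ip (corner \<gamma> ?u) ?u
        - 2 * (q * (d * ?r) + q * p * ip (corner \<sigma> ?u) ?u) + q\<^sup>2 * (norm ?u)\<^sup>2"
      unfolding Q_ext[of "Suc n"] 1 2 unfolding wn(2) by (simp add: ip_corner power_mult_distrib)
    also have "\<dots> = Q n x v - 2 * ((p + q * t) * c * ?r) + (p\<^sup>2 + q\<^sup>2) * (norm ?u)\<^sup>2
        - (p\<^sup>2 * ip (corner \<gamma> ?u) ?u + 2 * (p * q) * ip (corner \<sigma> ?u) ?u)"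
      unfolding t(2)[symmetric] by (simp add: algebra_simps)
    also have "\<dots> = Q n x v - 2 * ip (row_op n (\<lambda>i. (s * c) * \<beta> i) v) ?u + (norm ?u)\<^sup>2 - ip (corner \<gamma>' ?u) ?u"
      unfolding pq row_linear_coeff ip_scaleR
      by (simp add: ip_corner \<gamma>'_def distrib_right sum.distrib sum_distrib_left mult.assoc)
    finally show ?thesis .
  qed
  then have "nonneg_pencil (Suc n) (ext n x (\<lambda>i. (s * c) * \<beta> i) \<gamma>')"
    using nonneg_pencil_ext_iff[OF x] by blast
  then have "s * c \<le> c" using max unfolding maximal_dilation_def by blast
  then show False using s(1) c by simp
qed

lemma directions_dim_less:
  assumes x: "nonneg_pencil n x" and \<beta>: "\<beta> \<in> directions n x" and max: "maximal_dilation n x \<beta> c \<gamma>"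
  shows "fun_space.dim (directions (Suc n) (ext n x (\<lambda>i. c * \<beta> i) \<gamma>)) < fun_space.dim (directions n x)"
proof -
  let ?y = "ext n x (\<lambda>i. c * \<beta> i) \<gamma>"
  interpret R: Vector_Spaces.linear scale_fun scale_fun "restrict_coords n :: ('g \<times> nat \<Rightarrow> real) \<Rightarrow> _"
    by (rule linear_restrict_coords)
  have y: "nonneg_pencil (Suc n) ?y" using max by (simp add: maximal_dilation_def)
  have "scale_fun c \<beta> \<in> directions n x"
    by (rule fun_space.subspace_scale[OF subspace_directions \<beta>])
  then have c\<beta>: "(\<lambda>i. c * \<beta> i) \<in> directions n x" by (simp add: scale_fun_def)
  obtain T where T: "finite T" "directions n x \<subseteq> fun_space.span T"
    by (rule supported_in_finite_span[of "directions n x" n]) (auto simp: directions_def)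
  have inj: "inj_on (restrict_coords n) (directions (Suc n) ?y)"
  proof (rule inj_onI)
    fix \<eta> \<theta>
    assume \<eta>: "\<eta> \<in> directions (Suc n) ?y" and \<theta>: "\<theta> \<in> directions (Suc n) ?y"
      and eq: "restrict_coords n \<eta> = restrict_coords n \<theta>"
    have "\<eta> - \<theta> \<in> directions (Suc n) ?y"
      by (rule fun_space.subspace_diff[OF subspace_directions \<eta> \<theta>])
    moreover have "restrict_coords n (\<eta> - \<theta>) = (\<lambda>_. 0)"
      using R.diff[of \<eta> \<theta>] eq by (simp add: zero_fun_def)
    ultimately have "\<eta> - \<theta> = (\<lambda>_. 0)" by (rule no_direction_in_corner[OF x max])
    then show "\<eta> = \<theta>" by (simp add: fun_eq_iff)
  qed
  show ?thesis
  proof (rule dim_less_of_injection[OF T subspace_directions linear_restrict_coords inj _ \<beta>])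
    show "restrict_coords n ` directions (Suc n) ?y \<subseteq> directions n x"
      using restrict_direction[OF x c\<beta> y] by blast
    show "\<beta> \<notin> restrict_coords n ` directions (Suc n) ?y"
      using maximal_direction_not_restricted[OF x max] by blast
  qed
qed

lemma dilation_without_directions:
  assumes bounded: "\<And>p w a i j. nonneg_pencil p w \<Longrightarrow> i < p \<Longrightarrow> j < p \<Longrightarrow> \<bar>w a i j\<bar> \<le> C"
  shows "nonneg_pencil n x \<Longrightarrow> \<exists>l w. l \<le> fun_space.dim (directions n x) \<and> nonneg_pencil (n + l) w \<and>
     (\<forall>a. \<forall>i<n. \<forall>j<n. w a i j = x a i j) \<and> directions (n + l) w = {\<lambda>_. 0}"
proof (induction "fun_space.dim (directions n x)" arbitrary: n x rule: less_induct)
  case less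
  note x = less.prems
  show ?case
  proof (cases "directions n x = {\<lambda>_. 0}")
    case True
    have "nonneg_pencil (n + 0) x" "directions (n + 0) x = {\<lambda>_. 0}"
      using x True by simp_all
    then show ?thesis by blast
  next
    case False
    have "(\<lambda>_. 0) \<in> directions n x"
      using fun_space.subspace_0[OF subspace_directions] by (simp add: zero_fun_def)
    then obtain \<beta> where \<beta>: "\<beta> \<in> directions n x" "\<beta> \<noteq> (\<lambda>_. 0)" using False by blast
    obtain c \<gamma> where max: "maximal_dilation n x \<beta> c \<gamma>"
      using exists_maximal_dilation[OF x \<beta>, of C] bounded by blast
    let ?y = "ext n x (\<lambda>i. c * \<beta> i) \<gamma>"
    note less_dim = directions_dim_less[OF x \<beta>(1) max]
    have y: "nonneg_pencil (Suc n) ?y" using max by (simp add: maximal_dilation_def)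
    from less.hyps[OF less_dim y] obtain l w where
      w: "l \<le> fun_space.dim (directions (Suc n) ?y)" "nonneg_pencil (Suc n + l) w"
        "\<And>a i j. i < Suc n \<Longrightarrow> j < Suc n \<Longrightarrow> w a i j = ?y a i j" "directions (Suc n + l) w = {\<lambda>_. 0}"
      by blast
    have "w a i j = x a i j" if "i < n" "j < n" for a i j
      using w(3)[of i j a] that by (simp add: ext_def)
    moreover have "nonneg_pencil (n + Suc l) w" "directions (n + Suc l) w = {\<lambda>_. 0}"
      "Suc l \<le> fun_space.dim (directions n x)"
      using w(1,2,4) less_dim by simp_all
    ultimately show ?thesis by blast
  qed
qed

end

section \<open>Arveson extreme dilations over the reals\<close>

definition entries :: "('g \<Rightarrow> 'f mat) \<Rightarrow> 'g \<Rightarrow> nat \<Rightarrow> nat \<Rightarrow> 'f" where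
  "entries X = (\<lambda>a i j. X a $$ (i, j))"

definition of_entries :: "nat \<Rightarrow> ('g \<Rightarrow> nat \<Rightarrow> nat \<Rightarrow> 'f) \<Rightarrow> 'g \<Rightarrow> 'f mat" where
  "of_entries n x = (\<lambda>a. mat n n (\<lambda>(i, j). x a i j))"

lemma SM_real_iff:
  "X \<in> SM n \<longleftrightarrow> (\<forall>a. X a \<in> carrier_mat n n) \<and>
     (\<forall>a. \<forall>i<n. \<forall>j<n. entries X a i j = (entries X a j i :: real))"
proof (intro iffI conjI allI impI)
  show "X a \<in> carrier_mat n n" if "X \<in> SM n" for a using SM_D(1)[OF that] .
  show "entries X a i j = entries X a j i" if "X \<in> SM n" "i < n" "j < n" for a i j
    using arg_cong[OF SM_D(2)[OF that(1)], of "\<lambda>M. M $$ (i, j)" a] that(2,3) SM_D(3,4)[OF that(1)]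
    by (simp add: entries_def)
  show "X \<in> SM n" if *: "(\<forall>a. X a \<in> carrier_mat n n) \<and>
     (\<forall>a. \<forall>i<n. \<forall>j<n. entries X a i j = (entries X a j i :: real))"
  proof (rule SM_I)
    fix a
    show "X a \<in> carrier_mat n n" using * by blast
    then have d: "dim_row (X a) = n" "dim_col (X a) = n" by auto
    show "mat_adjoint (X a) = X a"
      using * d by (intro eq_matI) (auto simp: entries_def)
  qed
qed

lemma unit_vec_form:
  assumes "M \<in> carrier_mat p p" "i < p"
  shows "(M *\<^sub>v unit_vec p i) \<bullet>c unit_vec p i = (M $$ (i, i) :: real)"
proof -
  have "conjugate (unit_vec p i :: real vec) = unit_vec p i" by (intro eq_vecI) auto
  moreover have "(M *\<^sub>v unit_vec p i) $ i = M $$ (i, i)"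
    using assms by simp
  ultimately show ?thesis using assms by (simp add: scalar_prod_right_unit del: index_mult_mat_vec)
qed

lemma dilation_subspace_supported:
  assumes "f \<in> dilation_subspace K n X" "n \<le> k"
  shows "f (a, k) = 0"
proof -
  let ?S = "{f :: 'a \<times> nat \<Rightarrow> 'b. f (a, k) = 0}"
  have "fun_space.subspace ?S"
    by (rule fun_space.subspaceI) (auto simp: scale_fun_def)
  moreover have "column_coords \<beta> (a, k) = 0" if "\<beta> \<in> mat_tuples n 1" for \<beta> :: "'a \<Rightarrow> 'b mat"
  proof -
    have "\<beta> a \<in> carrier_mat n 1" using that by (simp add: mat_tuples_def)
    from carrier_matD(1)[OF this] show ?thesis using assms(2) by (simp add: column_coords_def)
  qed
  ultimately have "dilation_subspace K n X \<subseteq> ?S"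
    unfolding dilation_subspace_def by (intro fun_space.span_minimal) auto
  then show ?thesis using assms(1) by blast
qed

lemma dilation_dim_le:
  fixes X :: "'g::finite \<Rightarrow> 'f::{conjugatable_ordered_field,real_normed_field} mat"
  shows "dilation_dim K n X \<le> n * CARD('g)"
proof -
  obtain T where T: "finite T" "card T \<le> n * CARD('g)" "dilation_subspace K n X \<subseteq> fun_space.span T"
    by (rule supported_in_finite_span[of "dilation_subspace K n X" n]) (simp_all add: dilation_subspace_supported)
  have "fun_space.dim (dilation_subspace K n X) \<le> card T"
    using T(3,1) by (rule fun_space.dim_le_card)
  then show ?thesis using T(2) by (simp add: dilation_dim_def)
qed

context real_spectrahedron
begin

abbreviation D :: "('g \<Rightarrow> real mat) set" where
  "D \<equiv> gen_free_spectrahedron (*\<^sub>R) ip A"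

lemma pencil_eq_L:
  assumes "X \<in> SM n" "j < n"
  shows "pencil (*\<^sub>R) A n X v j = L n (entries X) v j"
proof -
  have "tensor_op (*\<^sub>R) n id (1\<^sub>m n) v j = (\<Sum>k<n. if k = j then v k else 0)"
    unfolding tensor_op_def using assms(2) by (intro sum.cong) auto
  then have "tensor_op (*\<^sub>R) n id (1\<^sub>m n) v j = v j"
    using assms(2) by (simp add: sum.delta)
  then show ?thesis
    by (simp add: pencil_def L_def row_op_def tensor_op_def entries_def)
qed

lemma level_D_iff:
  "X \<in> level D n \<longleftrightarrow> 1 \<le> n \<and> (\<forall>a. X a \<in> carrier_mat n n) \<and> nonneg_pencil n (entries X)"
proof -
  have "psd_op ip n (pencil (*\<^sub>R) A n X) \<longleftrightarrow> (\<forall>v. 0 \<le> Q n (entries X) v)" if "X \<in> SM n"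
    using pencil_eq_L[OF that] by (simp add: psd_op_def Q_def)
  moreover have "m = n" if "X \<in> SM m" "X \<in> SM n" for m
    using SM_D(3)[OF that(1)] SM_D(3)[OF that(2)] by simp
  ultimately have "X \<in> level D n \<longleftrightarrow> 1 \<le> n \<and> X \<in> SM n \<and> (\<forall>v. 0 \<le> Q n (entries X) v)"
    unfolding level_def gen_free_spectrahedron_def by auto
  then show ?thesis
    unfolding nonneg_pencil_def SM_real_iff by blast
qed

lemma nonneg_pencil_cong:
  assumes "\<And>a i j. i < n \<Longrightarrow> j < n \<Longrightarrow> x a i j = y a i j"
  shows "nonneg_pencil n x \<longleftrightarrow> nonneg_pencil n y"
proof -
  have "L n x v j = L n y v j" if "j < n" for v j
    unfolding L_def using assms that by (auto intro!: row_cong)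
  then have "Q n x v = Q n y v" for v by (simp add: Q_def)
  then show ?thesis using assms by (simp add: nonneg_pencil_def)
qed

lemma of_entries_level: "1 \<le> n \<Longrightarrow> nonneg_pencil n w \<Longrightarrow> of_entries n w \<in> level D n"
  using nonneg_pencil_cong[of n "entries (of_entries n w)" w]
  by (simp add: level_D_iff entries_def of_entries_def)

lemma bounded_entries:
  assumes "bounded_tuples D"
  shows "\<exists>C. \<forall>p w a i j. nonneg_pencil p w \<longrightarrow> i < p \<longrightarrow> j < p \<longrightarrow> \<bar>w a i j\<bar> \<le> C"
proof -
  obtain C where C: "\<And>n X. X \<in> level D n \<Longrightarrow>
      psd n (C \<cdot>\<^sub>m 1\<^sub>m n - mat_sum n n (\<lambda>a. X a * X a) UNIV)"
    using assms by (auto simp: bounded_tuples_def)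
  have "\<bar>w a i j\<bar> \<le> sqrt C" if w: "nonneg_pencil p w" and ij: "i < p" "j < p" for p w a i j
  proof -
    define X where "X = of_entries p w"
    have X: "X \<in> level D p" unfolding X_def using w ij by (intro of_entries_level) auto
    let ?M = "C \<cdot>\<^sub>m 1\<^sub>m p - mat_sum p p (\<lambda>a. X a * X a) UNIV"
    have M: "?M \<in> carrier_mat p p" by (intro minus_carrier_mat mat_sum_carrier)
    have "0 \<le> (?M *\<^sub>v unit_vec p i) \<bullet>c unit_vec p i"
      using C[OF X] by (simp add: psd_def)
    also have "\<dots> = ?M $$ (i, i)"
      by (rule unit_vec_form[OF M ij(1)])
    also have "\<dots> = C - (\<Sum>b\<in>UNIV. \<Sum>k<p. (w b i k)\<^sup>2)"
    proof -
      have "(X b * X b) $$ (i, i) = (\<Sum>k<p. (w b i k)\<^sup>2)" for b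
      proof -
        have "(X b * X b) $$ (i, i) = (\<Sum>k<p. X b $$ (i, k) * X b $$ (k, i))"
          using ij by (intro index_mult_mat_sum) (auto simp: X_def of_entries_def)
        also have "\<dots> = (\<Sum>k<p. (w b i k)\<^sup>2)"
          using ij w by (intro sum.cong) (auto simp: X_def of_entries_def power2_eq_square nonneg_pencil_def)
        finally show ?thesis .
      qed
      then show ?thesis using ij by (simp add: mat_sum_def)
    qed
    finally have "(\<Sum>b\<in>UNIV. \<Sum>k<p. (w b i k)\<^sup>2) \<le> C" by simp
    moreover have "(w a i j)\<^sup>2 \<le> (\<Sum>k<p. (w a i k)\<^sup>2)"
      using ij by (intro member_le_sum) auto
    moreover have "(\<Sum>k<p. (w a i k)\<^sup>2) \<le> (\<Sum>b\<in>UNIV. \<Sum>k<p. (w b i k)\<^sup>2)"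
      by (intro member_le_sum[of a UNIV "\<lambda>b. \<Sum>k<p. (w b i k)\<^sup>2"]) (auto intro: sum_nonneg)
    ultimately have "(w a i j)\<^sup>2 \<le> C" by linarith
    then show ?thesis using real_sqrt_le_mono by fastforce
  qed
  then show ?thesis by blast
qed

lemma entries_block_tuple:
  assumes "\<And>a. X a \<in> carrier_mat n n" "\<And>a. \<beta> a \<in> carrier_mat n m" "\<And>a. \<gamma> a \<in> carrier_mat m m"
  shows "i < n \<Longrightarrow> j < n \<Longrightarrow> entries (block_tuple X \<beta> \<gamma>) a i j = entries X a i j"
    and "i < m \<Longrightarrow> k < n \<Longrightarrow> entries (block_tuple X \<beta> \<gamma>) a (n + i) k = conjugate (\<beta> a $$ (k, i))"
  using carrier_matD[OF assms(1)] carrier_matD[OF assms(2)] carrier_matD[OF assms(3)]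
  by (simp_all add: entries_def block_tuple_def)

text \<open>
  The coordinates of a column in a dilation form the added row, and a direction needs only to be
  rescaled.
\<close>

lemma dilation_subspace_eq_directions:
  assumes X: "X \<in> level D n"
  shows "dilation_subspace D n X = directions n (entries X)"
proof
  have Xc: "\<And>a. X a \<in> carrier_mat n n" and x: "nonneg_pencil n (entries X)"
    using X by (auto simp: level_D_iff)
  let ?G = "{\<beta> \<in> mat_tuples n 1. \<exists>c :: 'g \<Rightarrow> real. block_tuple X \<beta> (\<lambda>a. mat 1 1 (\<lambda>_. of_real (c a))) \<in> D}"
  have "column_coords \<beta> \<in> directions n (entries X)" if \<beta>G: "\<beta> \<in> ?G" for \<beta>
  proof -
    obtain c where Y: "block_tuple X \<beta> (\<lambda>a. mat 1 1 (\<lambda>_. c a)) \<in> D" (is "?Y \<in> D")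
      using \<beta>G by auto
    have \<beta>: "\<beta> a \<in> carrier_mat n 1" for a using \<beta>G by (auto simp: mat_tuples_def)
    obtain m where m: "?Y \<in> level D m"
      using Y by (auto simp: gen_free_spectrahedron_def level_def)
    have "?Y a \<in> carrier_mat (n + 1) (n + 1)" for a
      unfolding block_tuple_def by (rule four_block_carrier_mat[OF Xc]) simp
    moreover have "?Y a \<in> carrier_mat m m" for a using m by (simp add: level_D_iff)
    ultimately have "m = n + 1" by (metis carrier_matD(1))
    then have w: "nonneg_pencil (n + 1) (entries ?Y)" using m by (simp add: level_D_iff)
    have \<gamma>: "mat 1 1 (\<lambda>_. c a) \<in> carrier_mat 1 1" for a by simp
    note entries = entries_block_tuple[of X n \<beta> 1 "\<lambda>a. mat 1 1 (\<lambda>_. c a)", OF Xc \<beta> \<gamma>]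
    have "row_op n (column_coords \<beta>) z = 0" if z: "in_kernel n (entries X) z" for z
    proof -
      have "row_op n (\<lambda>(a, k). entries ?Y a n k) z = 0"
      proof (rule added_row_vanishes_on_kernel[OF w _ _ z])
        show "entries ?Y a i j = entries X a i j" if "i < n" "j < n" for a i j
          by (rule entries(1)[OF that])
      qed simp_all
      moreover have "row_op n (\<lambda>(a, k). entries ?Y a n k) z = row_op n (column_coords \<beta>) z"
      proof (rule row_cong)
        fix a k assume k: "k < n"
        have "entries ?Y a (n + 0) k = conjugate (\<beta> a $$ (k, 0))"
          by (rule entries(2)[OF _ k]) simp
        then show "(case (a, k) of (a, k) \<Rightarrow> entries ?Y a n k) = column_coords \<beta> (a, k)"
          using carrier_matD[OF \<beta>[of a]] k by (simp add: column_coords_def)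
      qed simp
      ultimately show ?thesis by simp
    qed
    then show ?thesis
      using carrier_matD[OF \<beta>] by (auto simp: directions_def column_coords_def)
  qed
  then show "dilation_subspace D n X \<subseteq> directions n (entries X)"
    unfolding dilation_subspace_def
    by (intro fun_space.span_minimal subspace_directions) blast
  show "directions n (entries X) \<subseteq> dilation_subspace D n X"
  proof
    fix f assume f: "f \<in> directions n (entries X)"
    obtain c where c: "c > 0" "nonneg_pencil (Suc n) (ext n (entries X) (\<lambda>i. c * f i) (\<lambda>_. 0))"
      using direction_dilates[OF x f] by blast
    define \<beta> where "\<beta> a = mat n 1 (\<lambda>(k, _). c * f (a, k))" for a
    have "block_tuple X \<beta> (\<lambda>a. mat 1 1 (\<lambda>_. of_real 0)) =
        of_entries (Suc n) (ext n (entries X) (\<lambda>i. c * f i) (\<lambda>_. 0))"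
      using carrier_matD[OF Xc]
      by (intro ext eq_matI) (auto simp: block_tuple_def of_entries_def entries_def ext_def \<beta>_def)
    also have "\<dots> \<in> level D (Suc n)" using c(2) by (intro of_entries_level) auto
    finally have "block_tuple X \<beta> (\<lambda>a. mat 1 1 (\<lambda>_. of_real 0)) \<in> D" by (simp add: level_def)
    moreover have "\<beta> \<in> mat_tuples n 1" by (simp add: mat_tuples_def \<beta>_def)
    ultimately have "column_coords \<beta> \<in> dilation_subspace D n X"
      unfolding dilation_subspace_def by (intro fun_space.span_base imageI) (auto intro!: exI[of _ "\<lambda>_. 0"])
    then have "scale_fun (1 / c) (column_coords \<beta>) \<in> dilation_subspace D n X"
      unfolding dilation_subspace_def by (rule fun_space.span_scale)
    moreover have "scale_fun (1 / c) (column_coords \<beta>) = f"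
      using c(1) f by (auto simp: scale_fun_def column_coords_def \<beta>_def directions_def fun_eq_iff)
    ultimately show "f \<in> dilation_subspace D n X" by simp
  qed
qed

lemma no_directions_imp_arveson_extreme:
  assumes Y: "Y \<in> level D m" and zero: "directions m (entries Y) = {\<lambda>_. 0}"
  shows "arveson_extreme_point D m Y"
  unfolding arveson_extreme_point_def
proof (intro conjI allI impI ballI)
  show "Y \<in> level D m" by (rule Y)
  fix l \<beta> \<gamma>
  assume \<beta>': "\<beta> \<in> mat_tuples m l" and \<gamma>': "\<gamma> \<in> SM l" and Z: "block_tuple Y \<beta> \<gamma> \<in> level D (m + l)"
  have Yc: "Y a \<in> carrier_mat m m" and \<beta>: "\<beta> a \<in> carrier_mat m l" and \<gamma>: "\<gamma> a \<in> carrier_mat l l" for a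
    using Y \<beta>' SM_D(1)[OF \<gamma>'] by (auto simp: level_D_iff mat_tuples_def)
  note entries = entries_block_tuple[of Y m \<beta> l \<gamma>, OF Yc \<beta> \<gamma>]
  have w: "nonneg_pencil (m + l) (entries (block_tuple Y \<beta> \<gamma>))" using Z by (simp add: level_D_iff)
  have "\<beta> a $$ (k, i) = 0" if "k < m" "i < l" for a k i
  proof -
    define f where "f = (\<lambda>(a, k). if k < m then \<beta> a $$ (k, i) else 0)"
    have "row_op m f z = 0" if z: "in_kernel m (entries Y) z" for z
    proof -
      have "row_op m (\<lambda>(a, k). entries (block_tuple Y \<beta> \<gamma>) a (m + i) k) z = 0"
        by (rule added_row_vanishes_on_kernel[OF w _ _ z]) (use \<open>i < l\<close> in \<open>auto simp: entries\<close>)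
      moreover have "row_op m (\<lambda>(a, k). entries (block_tuple Y \<beta> \<gamma>) a (m + i) k) z = row_op m f z"
        using entries(2)[OF \<open>i < l\<close>] by (intro row_cong) (auto simp: f_def)
      ultimately show ?thesis by simp
    qed
    then have "f \<in> directions m (entries Y)" by (simp add: directions_def f_def)
    then have "f (a, k) = 0" using zero by simp
    then show ?thesis using that by (simp add: f_def)
  qed
  then show "\<beta> = (\<lambda>_. 0\<^sub>m m l)"
    using carrier_matD[OF \<beta>] by (intro ext eq_matI) auto
qed

theorem real_arveson_extreme_dilation:
  assumes bounded: "bounded_tuples D" and X: "X \<in> level D n"
  shows "\<exists>l \<le> dilation_dim D n X. \<exists>Y. dilation D n l X Y \<and> arveson_extreme_point D (n + l) Y"
proof -
  have n: "1 \<le> n" and Xc: "\<And>a. X a \<in> carrier_mat n n" and x: "nonneg_pencil n (entries X)"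
    using X by (auto simp: level_D_iff)
  obtain C where C: "\<And>p w a i j. nonneg_pencil p w \<Longrightarrow> i < p \<Longrightarrow> j < p \<Longrightarrow> \<bar>w a i j\<bar> \<le> C"
    using bounded_entries[OF bounded] by blast
  obtain l w where l: "l \<le> fun_space.dim (directions n (entries X))"
    and w: "nonneg_pencil (n + l) w" "directions (n + l) w = {\<lambda>_. 0}"
    and block: "\<And>a i j. i < n \<Longrightarrow> j < n \<Longrightarrow> w a i j = entries X a i j"
    using dilation_without_directions[of C n "entries X"] C x by blast
  let ?Y = "of_entries (n + l) w"
  have Y: "?Y \<in> level D (n + l)" using w(1) n by (intro of_entries_level) auto
  have wsym: "w a i j = w a j i" if "i < n + l" "j < n + l" for a i j
    using w(1) that by (simp add: nonneg_pencil_def)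
  have "directions (n + l) (entries ?Y) = directions (n + l) w"
  proof -
    have "L (n + l) (entries ?Y) z j = L (n + l) w z j" if "j < n + l" for z j
      unfolding L_def using that by (auto simp: entries_def of_entries_def intro!: row_cong)
    then show ?thesis by (simp add: directions_def in_kernel_def)
  qed
  then have "arveson_extreme_point D (n + l) ?Y"
    using no_directions_imp_arveson_extreme[OF Y] w(2) by simp
  moreover have "dilation D n l X ?Y"
    unfolding dilation_def
  proof (intro bexI conjI)
    let ?\<beta> = "\<lambda>a. mat n l (\<lambda>(i, j). w a i (n + j))" and ?\<gamma> = "\<lambda>a. mat l l (\<lambda>(i, j). w a (n + i) (n + j))"
    show "?Y = block_tuple X ?\<beta> ?\<gamma>"
    proof (intro ext eq_matI)
      fix a i j
      assume "i < dim_row (block_tuple X ?\<beta> ?\<gamma> a)" "j < dim_col (block_tuple X ?\<beta> ?\<gamma> a)"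
      then have ij: "i < n + l" "j < n + l"
        using carrier_matD[OF Xc[of a]] by (simp_all add: block_tuple_def)
      then show "?Y a $$ (i, j) = block_tuple X ?\<beta> ?\<gamma> a $$ (i, j)"
        using carrier_matD[OF Xc[of a]] block[of i j a] wsym[of i j a]
        by (auto simp: of_entries_def block_tuple_def entries_def)
    qed (use carrier_matD[OF Xc] in \<open>auto simp: of_entries_def block_tuple_def\<close>)
    show "?Y \<in> level D (n + l)" by (rule Y)
    show "?\<beta> \<in> mat_tuples n l" by (simp add: mat_tuples_def)
    show "?\<gamma> \<in> SM l" by (auto simp: SM_real_iff entries_def wsym)
  qed
  ultimately show ?thesis
    using l unfolding dilation_dim_def dilation_subspace_eq_directions[OF X] by blast
qed

end

section \<open>From complex to real scalars\<close>

lemma hilbert_space_over_real_part: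
  fixes smul :: "complex \<Rightarrow> 'k::banach \<Rightarrow> 'k"
  assumes "hilbert_space_over smul ip"
  shows "hilbert_space_over (*\<^sub>R) (\<lambda>x y. Re (ip x y))"
proof -
  interpret C: hilbert_space_over smul ip by (rule assms)
  show ?thesis
  proof
    show "Re (ip (c *\<^sub>R x) y) = c * Re (ip x y)" for c x y
      using C.ip_smul_left[of "of_real c" x y] by (simp add: C.smul_of_real)
    show "Re (ip y x) = conjugate (Re (ip x y))" for x y
      using C.ip_conjugate[of y x] by simp
    show "Re (ip x x) = of_real ((norm x)\<^sup>2)" for x
      using C.ip_norm[of x] by simp
  qed (simp_all add: C.ip_add_left scaleR_add_right scaleR_add_left)
qed

lemma compact_selfadjoint_real_part:
  fixes smul :: "complex \<Rightarrow> 'k::banach \<Rightarrow> 'k"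
  assumes H: "hilbert_space_over smul ip" and T: "compact_selfadjoint smul ip T"
  shows "compact_selfadjoint (*\<^sub>R) (\<lambda>x y. Re (ip x y)) T"
proof -
  interpret C: hilbert_space_over smul ip by (rule H)
  interpret T: Vector_Spaces.linear smul smul T
    using T by (simp add: compact_selfadjoint_def)
  have "T (c *\<^sub>R x) = c *\<^sub>R T x" for c x
    using T.scale[of "of_real c" x] by (simp add: C.smul_of_real)
  then have "Vector_Spaces.linear (*\<^sub>R) (*\<^sub>R) T"
    by unfold_locales (simp_all add: T.add)
  then show ?thesis
    using T by (simp add: compact_selfadjoint_def)
qed

definition complexify :: "('g \<Rightarrow> real mat) \<Rightarrow> 'g \<Rightarrow> complex mat" where
  "complexify X = (\<lambda>a. map_mat complex_of_real (X a))"

lemma complexify_SM_iff: "complexify X \<in> SM n \<longleftrightarrow> X \<in> SM n"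
proof
  assume X: "X \<in> SM n"
  note d = SM_D[OF X]
  show "complexify X \<in> SM n"
  proof (rule SM_I)
    fix a
    have "X a $$ (j, i) = X a $$ (i, j)" if "i < n" "j < n" for i j
      using arg_cong[OF d(2)[of a], of "\<lambda>M. M $$ (i, j)"] that d(3,4) by simp
    then show "mat_adjoint (complexify X a) = complexify X a"
      using d(3,4) by (intro eq_matI) (auto simp: complexify_def)
  qed (use d in \<open>auto simp: complexify_def\<close>)
next
  assume X: "complexify X \<in> SM n"
  note d = SM_D[OF X]
  have dX: "dim_row (X a) = n" "dim_col (X a) = n" for a
    using d(3,4)[of a] by (simp_all add: complexify_def)
  show "X \<in> SM n"
  proof (rule SM_I)
    fix a
    have "X a $$ (j, i) = X a $$ (i, j)" if "i < n" "j < n" for i j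
      using arg_cong[OF d(2)[of a], of "\<lambda>M. M $$ (i, j)"] that dX[of a] by (simp add: complexify_def)
    then show "mat_adjoint (X a) = X a"
      using dX by (intro eq_matI) auto
  qed (use dX in \<open>auto intro: carrier_matI\<close>)
qed

lemma complexify_block_tuple:
  assumes "\<And>a. X a \<in> carrier_mat n n" "\<And>a. \<beta> a \<in> carrier_mat n l" "\<And>a. \<gamma> a \<in> carrier_mat l l"
  shows "complexify (block_tuple X \<beta> \<gamma>) = block_tuple (complexify X) (complexify \<beta>) (complexify \<gamma>)"
  using carrier_matD[OF assms(1)] carrier_matD[OF assms(2)] carrier_matD[OF assms(3)]
  by (intro ext eq_matI) (auto simp: complexify_def block_tuple_def)

context hilbert_space_over
begin

lemma tensor_form_hermitian:
  assumes T: "\<And>x y. ip (T x) y = ip x (T y)" and M: "M \<in> carrier_mat n n" "mat_adjoint M = M"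
  shows "conjugate (tensor_form n T M v) = tensor_form n T M v"
proof -
  have M': "conjugate (M $$ (j, k)) = M $$ (k, j)" if "j < n" "k < n" for j k
    using arg_cong[OF M(2), of "\<lambda>A. A $$ (k, j)"] that M(1) by simp
  have "conjugate (tensor_form n T M v) = (\<Sum>j<n. \<Sum>k<n. M $$ (k, j) * ip (T (v j)) (v k))"
    unfolding tensor_form_def sum_conjugate[OF finite_lessThan]
    by (intro sum.cong refl) (simp add: conjugate_dist_mul M' T ip_conjugate[symmetric])
  also have "\<dots> = tensor_form n T M v"
    unfolding tensor_form_def by (rule sum.swap)
  finally show ?thesis .
qed

end

text \<open>
  For real coefficients the real form is the real part of the complex one, which is real because the
  pencil is self-adjoint.
\<close>

lemma gen_free_spectrahedron_complexify_iff:
  fixes smul :: "complex \<Rightarrow> 'k::banach \<Rightarrow> 'k" and A :: "'g::finite \<Rightarrow> 'k \<Rightarrow> 'k"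
  assumes H: "hilbert_space_over smul ip" and A: "\<And>a. compact_selfadjoint smul ip (A a)"
  shows "X \<in> level (gen_free_spectrahedron (*\<^sub>R) (\<lambda>x y. Re (ip x y)) A) n \<longleftrightarrow>
    complexify X \<in> level (gen_free_spectrahedron smul ip A) n"
proof (cases "X \<in> SM n")
  case False
  then show ?thesis by (simp add: level_def complexify_SM_iff)
next
  case X: True
  interpret C: hilbert_space_over smul ip by (rule H)
  interpret R: hilbert_space_over "(*\<^sub>R)" "\<lambda>x y. Re (ip x y)" by (rule hilbert_space_over_real_part[OF H])
  have X': "complexify X \<in> SM n" using X by (simp add: complexify_SM_iff)
  have re: "Re (C.tensor_form n T (map_mat complex_of_real M) v) = R.tensor_form n T M v"
    if "M \<in> carrier_mat n n" for T M v
    unfolding C.tensor_form_def R.tensor_form_def using that by simp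
  have one: "map_mat complex_of_real (1\<^sub>m n) = 1\<^sub>m n" by (rule eq_matI) auto
  have sa: "ip (A a x) y = ip x (A a y)" for a x y
    using A[of a] by (simp add: compact_selfadjoint_def)
  have form: "0 \<le> C.tensor_form n id (1\<^sub>m n) v - (\<Sum>a\<in>UNIV. C.tensor_form n (A a) (complexify X a) v) \<longleftrightarrow>
      0 \<le> R.tensor_form n id (1\<^sub>m n) v - (\<Sum>a\<in>UNIV. R.tensor_form n (A a) (X a) v)" for v
  proof -
    have "Im (C.tensor_form n id (1\<^sub>m n) v) = 0"
      using arg_cong[OF C.tensor_form_hermitian[of id "1\<^sub>m n" n v], of Im] by simp
    moreover have "Im (C.tensor_form n (A a) (complexify X a) v) = 0" for a
      using arg_cong[OF C.tensor_form_hermitian[OF sa SM_D(1,2)[OF X']], of Im a a v] by simp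
    moreover have "Re (C.tensor_form n id (1\<^sub>m n) v) = R.tensor_form n id (1\<^sub>m n) v"
      using re[of "1\<^sub>m n" id v] unfolding one by simp
    moreover have "Re (C.tensor_form n (A a) (complexify X a) v) = R.tensor_form n (A a) (X a) v" for a
      unfolding complexify_def by (rule re[OF SM_D(1)[OF X]])
    ultimately show ?thesis by (simp add: less_eq_complex_def)
  qed
  show ?thesis
    unfolding C.gen_free_spectrahedron_level_iff R.gen_free_spectrahedron_level_iff
    using X X' form by simp
qed

lemma psd_of_real:
  assumes M: "(M :: real mat) \<in> carrier_mat n n" and psd: "psd n (map_mat complex_of_real M)"
  shows "psd n M"
proof -
  let ?N = "map_mat complex_of_real M"
  have "mat_adjoint M = M"
  proof (rule eq_matI)
    fix i j assume "i < dim_row M" "j < dim_col M"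
    then have ij: "i < n" "j < n" using M by auto
    have "mat_adjoint ?N $$ (i, j) = ?N $$ (i, j)" using psd by (simp add: psd_def)
    then show "mat_adjoint M $$ (i, j) = M $$ (i, j)"
      using ij carrier_matD[OF M] by simp
  qed (use M in auto)
  moreover have "0 \<le> (M *\<^sub>v v) \<bullet>c v" if v: "v \<in> carrier_vec n" for v
  proof -
    let ?w = "map_vec complex_of_real v"
    have "(?N *\<^sub>v ?w) \<bullet>c ?w = of_real ((M *\<^sub>v v) \<bullet> v)"
    proof -
      have "?N *\<^sub>v ?w = map_vec complex_of_real (M *\<^sub>v v)"
        by (rule of_real_hom.mult_mat_vec_hom[OF M v, symmetric])
      moreover have "conjugate ?w = ?w" by (intro eq_vecI) auto
      moreover have "M *\<^sub>v v \<in> carrier_vec n" using M v by (rule mult_mat_vec_carrier)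
      ultimately show ?thesis
        using v carrier_matD[OF M]
        by (simp add: scalar_prod_def del: index_mult_mat_vec)
    qed
    moreover have "0 \<le> (?N *\<^sub>v ?w) \<bullet>c ?w"
      using psd v by (simp add: psd_def)
    moreover have "conjugate v = v" by (intro eq_vecI) auto
    ultimately show ?thesis by (simp add: less_eq_complex_def)
  qed
  ultimately show ?thesis using M by (simp add: psd_def)
qed

lemma bounded_tuples_complexify:
  fixes K :: "('g::finite \<Rightarrow> complex mat) set"
  assumes bounded: "bounded_tuples K"
    and K': "\<And>X n. X \<in> level K' n \<Longrightarrow> complexify X \<in> level K n"
  shows "bounded_tuples K'"
proof -
  obtain C :: real where C: "\<And>n X. X \<in> level K n \<Longrightarrow>
      psd n (of_real C \<cdot>\<^sub>m 1\<^sub>m n - mat_sum n n (\<lambda>a. X a * X a) UNIV)"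
    using bounded by (auto simp: bounded_tuples_def)
  have "psd n (C \<cdot>\<^sub>m 1\<^sub>m n - mat_sum n n (\<lambda>a. X a * X a) UNIV)" if X: "X \<in> level K' n" for n X
  proof -
    note XS = levelD(1)[OF X]
    let ?M = "C \<cdot>\<^sub>m 1\<^sub>m n - mat_sum n n (\<lambda>a. X a * X a) UNIV"
    let ?N = "of_real C \<cdot>\<^sub>m 1\<^sub>m n - mat_sum n n (\<lambda>a. complexify X a * complexify X a) UNIV"
    have M: "?M \<in> carrier_mat n n" by (intro minus_carrier_mat mat_sum_carrier)
    have "complexify X a * complexify X a = map_mat complex_of_real (X a * X a)" for a
      unfolding complexify_def by (rule of_real_hom.mat_hom_mult[OF SM_D(1)[OF XS] SM_D(1)[OF XS], symmetric])
    then have N: "?N = map_mat complex_of_real ?M"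
      using SM_D(3,4)[OF XS] by (intro eq_matI) (auto simp: mat_sum_def simp del: index_mult_mat(1))
    show ?thesis
      using psd_of_real[OF M] C[OF K'[OF X]] unfolding N by blast
  qed
  then show ?thesis by (auto simp: bounded_tuples_def)
qed

context matrix_convex_set
begin

text \<open>
  The midpoint is the compression of \<open>X \<oplus> Y\<close> by the normalised block column of two identity matrices.
\<close>

lemma level_midpoint:
  assumes X: "X \<in> level K n" and Y: "Y \<in> level K n"
  shows "(\<lambda>a. of_real (1 / 2) \<cdot>\<^sub>m (X a + Y a)) \<in> level K n"
proof -
  note XS = levelD(1)[OF X] and YS = levelD(1)[OF Y]
  note d = SM_D(3,4)[OF XS] SM_D(3,4)[OF YS]
  let ?s = "of_real (1 / sqrt 2) :: 'f"
  have ss: "?s * ?s = of_real (1 / 2)" unfolding of_real_mult[symmetric] by simp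
  have half: "2 * of_real (1 / 2) = (1 :: 'f)"
  proof -
    have "2 * of_real (1 / 2) = (of_real (2 * (1 / 2)) :: 'f)"
      by (simp only: of_real_mult of_real_numeral)
    then show ?thesis by simp
  qed
  let ?V = "vstack (?s \<cdot>\<^sub>m 1\<^sub>m n) (?s \<cdot>\<^sub>m 1\<^sub>m n) :: 'f mat"
  have c: "?s \<cdot>\<^sub>m 1\<^sub>m n \<in> carrier_mat n n" by simp
  have adj: "mat_adjoint (?s \<cdot>\<^sub>m 1\<^sub>m n) = (?s \<cdot>\<^sub>m 1\<^sub>m n :: 'f mat)"
    by (rule eq_matI) (auto simp: conjugate_of_real simp del: of_real_divide)
  have "mat_adjoint ?V * ?V = ?s \<cdot>\<^sub>m 1\<^sub>m n * (?s \<cdot>\<^sub>m 1\<^sub>m n) + ?s \<cdot>\<^sub>m 1\<^sub>m n * (?s \<cdot>\<^sub>m 1\<^sub>m n)"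
    unfolding mat_adjoint_vstack[OF c c] adj by (rule hstack_mult_vstack) (rule c)+
  also have "\<dots> = 1\<^sub>m n"
    by (rule eq_matI) (auto simp: mult_smult_mat ss half simp del: of_real_divide)
  finally have V: "isometry (n + n) n ?V"
    using c by (auto simp: isometry_def)
  have "compression ?V (direct_sum X Y) = (\<lambda>a. of_real (1 / 2) \<cdot>\<^sub>m (X a + Y a))"
  proof
    fix a
    have "compression (?s \<cdot>\<^sub>m 1\<^sub>m n) Z a = of_real (1 / 2) \<cdot>\<^sub>m Z a" if "Z \<in> SM n" for Z :: "'g \<Rightarrow> 'f mat"
      unfolding compression_def adj using SM_D(3,4)[OF that]
      by (simp add: mult_smult_mat smult_smult_mat ss del: of_real_divide)
    then show "compression ?V (direct_sum X Y) a = of_real (1 / 2) \<cdot>\<^sub>m (X a + Y a)"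
      unfolding compression_direct_sum(1)[OF XS YS c c] using XS YS d
      by (intro eq_matI) (auto simp: distrib_left)
  qed
  then show ?thesis
    using compression_closed[OF direct_sum_closed[OF X Y] V level_pos[OF X]] by simp
qed

lemma block_tuple_compression:
  assumes Z: "block_tuple X \<beta> \<gamma> \<in> level K (m + l)" and X: "X \<in> SM m" and \<beta>: "\<And>a. \<beta> a \<in> carrier_mat m l"
    and \<gamma>: "\<gamma> \<in> SM l" and V: "isometry m n V" and U: "unitary l U" and n: "1 \<le> n"
  shows "block_tuple (compression V X) (\<lambda>a. mat_adjoint V * \<beta> a * U) (compression U \<gamma>) \<in> level K (n + l)"
proof -
  note cV = isometryD[OF V]
  have cU: "U \<in> carrier_mat l l" "mat_adjoint U * U = 1\<^sub>m l" using U by (auto simp: unitary_def)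
  note d = SM_D(3,4)[OF X] SM_D(3,4)[OF \<gamma>] carrier_matD[OF \<beta>] carrier_matD[OF cV(1)] carrier_matD[OF cU(1)]
  let ?W = "vstack V (0\<^sub>m l n)" and ?W' = "vstack (0\<^sub>m m l) U"
  have c0: "0\<^sub>m l n \<in> carrier_mat l n" "0\<^sub>m m l \<in> carrier_mat m l" by auto
  have adjW: "mat_adjoint ?W = hstack (mat_adjoint V) (0\<^sub>m n l)"
    unfolding mat_adjoint_vstack[OF cV(1) c0(1)] by simp
  have adjW': "mat_adjoint ?W' = hstack (0\<^sub>m l m) (mat_adjoint U)"
    unfolding mat_adjoint_vstack[OF c0(2) cU(1)] by simp
  have WW: "isometry (m + l) n ?W"
  proof -
    have "mat_adjoint ?W * ?W = 1\<^sub>m n"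
      unfolding adjW using cV by (subst hstack_mult_vstack[of _ n m _ l _ n]) auto
    then show ?thesis using cV by (auto simp: isometry_def)
  qed
  have WW': "isometry (m + l) l ?W'"
  proof -
    have "mat_adjoint ?W' * ?W' = 1\<^sub>m l"
      unfolding adjW' using cU by (subst hstack_mult_vstack[of _ l m _ l _ l]) auto
    then show ?thesis using cU by (auto simp: isometry_def)
  qed
  have orth: "mat_adjoint ?W * ?W' = 0\<^sub>m n l"
    unfolding adjW using cV cU by (subst hstack_mult_vstack[of _ n m _ l _ l]) auto
  note blocks = SM_D(1)[OF X] \<beta> mat_adjoint_carrier[OF \<beta>] SM_D(1)[OF \<gamma>]
  have ZW': "block_tuple X \<beta> \<gamma> a * ?W' = vstack (\<beta> a * U) (\<gamma> a * U)" for a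
    unfolding block_tuple_def four_block_mult_vstack[OF blocks c0(2) cU(1)]
    by (simp add: d add_zero_mat)
  have ZW: "block_tuple X \<beta> \<gamma> a * ?W = vstack (X a * V) (mat_adjoint (\<beta> a) * V)" for a
    unfolding block_tuple_def four_block_mult_vstack[OF blocks cV(1) c0(1)]
    by (simp add: d add_zero_mat)
  have dZ: "dim_row (block_tuple X \<beta> \<gamma> a) = m + l" "dim_col (block_tuple X \<beta> \<gamma> a) = m + l" for a
    by (simp_all add: block_tuple_def d)
  have dW: "dim_row ?W = m + l" "dim_row ?W' = m + l" "dim_col ?W = n" "dim_col ?W' = l"
    by (simp_all add: vstack_def d)
  have "compression ?W (block_tuple X \<beta> \<gamma>) a = compression V X a" for a
  proof -
    have "compression ?W (block_tuple X \<beta> \<gamma>) a = mat_adjoint ?W * (block_tuple X \<beta> \<gamma> a * ?W)"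
      by (simp add: compression_def mult_mat_assoc dZ dW)
    also have "\<dots> = mat_adjoint V * (X a * V)"
      unfolding ZW adjW by (subst hstack_mult_vstack[of _ n m _ l _ n]) (auto simp: d intro!: carrier_matI)
    finally show ?thesis by (simp add: compression_def mult_mat_assoc d)
  qed
  moreover have "mat_adjoint ?W * block_tuple X \<beta> \<gamma> a * ?W' = mat_adjoint V * \<beta> a * U" for a
  proof -
    have "mat_adjoint ?W * block_tuple X \<beta> \<gamma> a * ?W' = mat_adjoint ?W * (block_tuple X \<beta> \<gamma> a * ?W')"
      by (simp add: mult_mat_assoc dZ dW)
    also have "\<dots> = mat_adjoint V * (\<beta> a * U)"
      unfolding ZW' adjW by (subst hstack_mult_vstack[of _ n m _ l _ l]) (auto simp: d intro!: carrier_matI)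
    finally show ?thesis by (simp add: mult_mat_assoc d)
  qed
  moreover have "compression ?W' (block_tuple X \<beta> \<gamma>) a = compression U \<gamma> a" for a
  proof -
    have "compression ?W' (block_tuple X \<beta> \<gamma>) a = mat_adjoint ?W' * (block_tuple X \<beta> \<gamma> a * ?W')"
      by (simp add: compression_def mult_mat_assoc dZ dW)
    also have "\<dots> = mat_adjoint U * (\<gamma> a * U)"
      unfolding ZW' adjW' by (subst hstack_mult_vstack[of _ l m _ l _ l]) (auto simp: d intro!: carrier_matI)
    finally show ?thesis by (simp add: compression_def mult_mat_assoc d)
  qed
  ultimately have "compression (hstack ?W ?W') (block_tuple X \<beta> \<gamma>) =
      block_tuple (compression V X) (\<lambda>a. mat_adjoint V * \<beta> a * U) (compression U \<gamma>)"
    unfolding compression_hstack[OF levelD(1)[OF Z] isometryD(1)[OF WW] isometryD(1)[OF WW']]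
    by (simp add: block_tuple_def)
  moreover have "compression (hstack ?W ?W') (block_tuple X \<beta> \<gamma>) \<in> level K (n + l)"
    by (rule compression_closed[OF Z isometry_hstack[OF WW WW' orth]]) (use n in simp)
  ultimately show ?thesis by simp
qed

end

section \<open>Realification of complex tuples\<close>

lemma map_conjugate_mult:
  assumes "dim_col A = dim_row B"
  shows "map_mat conjugate (A * B) = map_mat conjugate A * map_mat conjugate (B :: 'f::conjugatable_field mat)"
  using assms
  by (intro eq_matI) (auto simp: scalar_prod_def sum_conjugate conjugate_dist_mul intro!: sum.cong)

lemma map_conjugate_adjoint: "map_mat conjugate (mat_adjoint A) = mat_adjoint (map_mat conjugate A)"
  by (rule eq_matI) auto

definition conj_tuple :: "('g \<Rightarrow> 'f::conjugatable_field mat) \<Rightarrow> 'g \<Rightarrow> 'f mat" where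
  "conj_tuple X = (\<lambda>a. map_mat conjugate (X a))"

lemma conj_tuple_SM: "X \<in> SM n \<Longrightarrow> conj_tuple X \<in> SM n"
  by (intro SM_I) (auto simp: conj_tuple_def SM_D map_conjugate_adjoint[symmetric])

text \<open>
  Conjugating a real tuple by the unitary whose two block columns are this isometry and its complex
  conjugate decouples it into a tuple and its complex conjugate.
\<close>

definition half_rotation :: "nat \<Rightarrow> complex mat" where
  "half_rotation n = vstack (of_real (1 / sqrt 2) \<cdot>\<^sub>m 1\<^sub>m n) ((- \<i> * of_real (1 / sqrt 2)) \<cdot>\<^sub>m 1\<^sub>m n)"

lemma half_rotation_isometry:
  "isometry (n + n) n (half_rotation n)"
  "isometry (n + n) n (map_mat conjugate (half_rotation n))"
  "mat_adjoint (half_rotation n) * map_mat conjugate (half_rotation n) = 0\<^sub>m n n"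
proof -
  define s where "s = complex_of_real (1 / sqrt 2)"
  have s: "cnj s = s" "s * s = 1 / 2" "2 * (s * s) = 1"
    unfolding s_def of_real_mult[symmetric] by simp_all
  have i_s: "\<i> * s * (\<i> * s) = - (1 / 2)"
  proof -
    have "\<i> * s * (\<i> * s) = (\<i> * \<i>) * (s * s)" by (simp only: mult_ac)
    then show ?thesis by (simp add: s)
  qed
  have c: "z \<cdot>\<^sub>m 1\<^sub>m n \<in> carrier_mat n n" for z :: complex by simp
  have h: "half_rotation n = vstack (s \<cdot>\<^sub>m 1\<^sub>m n) ((- \<i> * s) \<cdot>\<^sub>m 1\<^sub>m n)"
    by (simp add: half_rotation_def s_def)
  have hc: "map_mat conjugate (half_rotation n) = vstack (s \<cdot>\<^sub>m 1\<^sub>m n) ((\<i> * s) \<cdot>\<^sub>m 1\<^sub>m n)"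
    unfolding h by (rule eq_matI) (auto simp: vstack_def s)
  have adj: "mat_adjoint (z \<cdot>\<^sub>m 1\<^sub>m n) = cnj z \<cdot>\<^sub>m 1\<^sub>m n" for z
    by (rule eq_matI) auto
  have mult: "mat_adjoint (vstack (z \<cdot>\<^sub>m 1\<^sub>m n) (w \<cdot>\<^sub>m 1\<^sub>m n)) * vstack (z' \<cdot>\<^sub>m 1\<^sub>m n) (w' \<cdot>\<^sub>m 1\<^sub>m n) =
      (cnj z * z' + cnj w * w') \<cdot>\<^sub>m 1\<^sub>m n" for z w z' w'
    unfolding mat_adjoint_vstack[OF c c] adj
    by (subst hstack_mult_vstack[OF c c c c])
      (auto simp: mult_smult_mat smult_smult_mat algebra_simps intro!: eq_matI)
  have "half_rotation n \<in> carrier_mat (n + n) n" unfolding h using vstack_carrier[OF c c] .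
  moreover have "mat_adjoint (half_rotation n) * half_rotation n = 1\<^sub>m n"
    unfolding h mult by (rule eq_matI) (auto simp: s i_s)
  ultimately show "isometry (n + n) n (half_rotation n)" by (simp add: isometry_def)
  have "map_mat conjugate (half_rotation n) \<in> carrier_mat (n + n) n"
    unfolding hc using vstack_carrier[OF c c] .
  moreover have "mat_adjoint (map_mat conjugate (half_rotation n)) * map_mat conjugate (half_rotation n) = 1\<^sub>m n"
    unfolding hc mult by (rule eq_matI) (auto simp: s i_s)
  ultimately show "isometry (n + n) n (map_mat conjugate (half_rotation n))" by (simp add: isometry_def)
  show "mat_adjoint (half_rotation n) * map_mat conjugate (half_rotation n) = 0\<^sub>m n n"
    unfolding hc unfolding h mult by (rule eq_matI) (auto simp: s i_s)
qed

locale complexified_set = matrix_convex_set K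
  for K :: "('g \<Rightarrow> complex mat) set" +
  fixes K' :: "('g \<Rightarrow> real mat) set"
  assumes real_points: "X \<in> level K' n \<longleftrightarrow> complexify X \<in> level K n"
    and conjugation_closed: "closed_under_conjugation K"
begin

lemma conj_tuple_level: "X \<in> level K n \<Longrightarrow> conj_tuple X \<in> level K n"
  using conjugation_closed conj_tuple_SM[of X n]
  by (auto simp: level_def closed_under_conjugation_def conj_tuple_def)

text \<open>
  For \<open>W = half_rotation n\<close> and its complex conjugate \<open>W\<^sup>-\<close>, the tuple \<open>W X W\<^sup>* + W\<^sup>- X\<^sup>- (W\<^sup>-)\<^sup>*\<close> is a sum of complex
  conjugates, hence real, and it is unitarily equivalent to \<open>X \<oplus> X\<^sup>-\<close>.
\<close>

lemma realification:
  assumes X: "X \<in> level K n"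
  shows "\<exists>R \<in> level K' (n + n). compression (half_rotation n) (complexify R) = X"
proof -
  note XS = levelD(1)[OF X]
  have X': "conj_tuple X \<in> level K n" by (rule conj_tuple_level[OF X])
  note X'S = levelD(1)[OF X']
  let ?W = "half_rotation n" and ?W' = "map_mat conjugate (half_rotation n)"
  note W = half_rotation_isometry(1)[of n] and W' = half_rotation_isometry(2)[of n]
    and orth = half_rotation_isometry(3)[of n]
  note cW = isometryD[OF W] and cW' = isometryD[OF W']
  note d = SM_D(3,4)[OF XS] SM_D(3,4)[OF X'S] carrier_matD[OF cW(1)] carrier_matD[OF cW'(1)]
  have adjs: "mat_adjoint ?W \<in> carrier_mat n (n + n)" "mat_adjoint ?W' \<in> carrier_mat n (n + n)"
    using cW cW' by auto
  let ?T = "vstack (mat_adjoint ?W) (mat_adjoint ?W')"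
  have "unitary (n + n) (hstack ?W ?W')"
    by (rule isometry_square_imp_unitary[OF isometry_hstack[OF W W' orth]])
  moreover have T: "?T = mat_adjoint (hstack ?W ?W')"
    by (rule mat_adjoint_hstack[OF cW(1) cW'(1), symmetric])
  ultimately have isoT: "isometry (n + n) (n + n) ?T"
    by (auto simp: unitary_def isometry_def)
  define C where "C = compression ?T (direct_sum X (conj_tuple X))"
  have C: "C \<in> level K (n + n)"
    unfolding C_def using compression_closed[OF direct_sum_closed[OF X X'] isoT] level_pos[OF X] by simp
  define R where "R = (\<lambda>a. map_mat Re (C a))"
  have "complexify R = C"
  proof
    fix a
    let ?M = "?W * X a * mat_adjoint ?W"
    have M: "dim_row ?M = n + n" "dim_col ?M = n + n" by (simp_all add: d)
    have "C a = ?M + ?W' * conj_tuple X a * mat_adjoint ?W'"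
      unfolding C_def compression_direct_sum(1)[OF XS X'S adjs] by (simp add: compression_def)
    also have "?W' * conj_tuple X a * mat_adjoint ?W' = map_mat conjugate ?M"
      by (simp only: map_conjugate_mult map_conjugate_adjoint conj_tuple_def d
          index_mult_mat(2,3) dim_mat_adjoint)
    finally have Ca: "C a = ?M + map_mat conjugate ?M" .
    show "complexify R a = C a"
      unfolding complexify_def R_def Ca
    proof (rule eq_matI)
      fix i j assume "i < dim_row (?M + map_mat conjugate ?M)" "j < dim_col (?M + map_mat conjugate ?M)"
      then have "i < n + n" "j < n + n" using M by auto
      then show "map_mat complex_of_real (map_mat Re (?M + map_mat conjugate ?M)) $$ (i, j) =
          (?M + map_mat conjugate ?M) $$ (i, j)"
        using M by (simp add: complex_eq_iff del: index_mult_mat(1))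
    qed simp_all
  qed
  moreover have "compression ?W C = X"
  proof -
    have T1: "?T * ?W = vstack (1\<^sub>m n) (0\<^sub>m n n)"
    proof -
      have "mat_adjoint ?W' * ?W = 0\<^sub>m n n"
        using arg_cong[OF orth, of mat_adjoint] by (simp add: mat_algebra d)
      then show ?thesis by (simp only: vstack_mult[OF cW(1) adjs] cW)
    qed
    have "compression ?W C = compression (?T * ?W) (direct_sum X (conj_tuple X))"
      unfolding C_def
      by (rule compression_mult[OF levelD(1)[OF direct_sum_closed[OF X X']] isometryD(1)[OF isoT] cW(1), symmetric])
    also have "\<dots> = X"
    proof
      fix a
      have "compression (0\<^sub>m n n) (conj_tuple X) a = 0\<^sub>m n n"
        by (simp add: compression_def d)
      then show "compression (?T * ?W) (direct_sum X (conj_tuple X)) a = X a"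
        unfolding T1 compression_direct_sum(1)[OF XS X'S one_carrier_mat zero_carrier_mat]
        by (simp add: compression_one[OF XS] d add_zero_mat)
    qed
    finally show ?thesis .
  qed
  ultimately show ?thesis
    using C real_points by metis
qed

text \<open>
  The average of a dilation of a real tuple and its complex conjugate is a real dilation.
\<close>

lemma real_part_of_dilation_vanishes:
  assumes Y: "arveson_extreme_point K' m Y" and l: "1 \<le> l"
    and \<beta>: "\<And>a. \<beta> a \<in> carrier_mat m l" and \<gamma>: "\<gamma> \<in> SM l"
    and Z: "block_tuple (complexify Y) \<beta> \<gamma> \<in> level K (m + l)"
  shows "map_mat Re (\<beta> a) = 0\<^sub>m m l"
proof -
  let ?Z = "block_tuple (complexify Y) \<beta> \<gamma>"
  let ?\<beta> = "\<lambda>a. map_mat Re (\<beta> a)" and ?\<gamma> = "\<lambda>a. map_mat Re (\<gamma> a)"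
  have YS: "Y \<in> SM m" using Y by (simp add: arveson_extreme_point_def level_def)
  note d = SM_D(3,4)[OF YS] SM_D(3,4)[OF \<gamma>] carrier_matD[OF \<beta>]
  have "complexify (block_tuple Y ?\<beta> ?\<gamma>) = (\<lambda>a. of_real (1 / 2) \<cdot>\<^sub>m (?Z a + conj_tuple ?Z a))"
    by (intro ext eq_matI) (auto simp: complexify_def block_tuple_def conj_tuple_def d complex_eq_iff)
  also have "\<dots> \<in> level K (m + l)"
    by (rule level_midpoint[OF Z conj_tuple_level[OF Z]])
  finally have "block_tuple Y ?\<beta> ?\<gamma> \<in> level K' (m + l)" by (simp add: real_points)
  moreover have "?\<beta> \<in> mat_tuples m l" using \<beta> by (simp add: mat_tuples_def)
  moreover have "?\<gamma> \<in> SM l"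
  proof (rule SM_I)
    fix a
    have "cnj (\<gamma> a $$ (j, i)) = \<gamma> a $$ (i, j)" if "i < l" "j < l" for i j
      using arg_cong[OF SM_D(2)[OF \<gamma>], of "\<lambda>M. M $$ (i, j)" a] that d by simp
    then have "Re (\<gamma> a $$ (j, i)) = Re (\<gamma> a $$ (i, j))" if "i < l" "j < l" for i j
      using that by (metis complex_cnj(1) cnj.sel(1))
    then show "mat_adjoint (?\<gamma> a) = ?\<gamma> a"
      by (intro eq_matI) (auto simp: d)
  qed (use SM_D(1)[OF \<gamma>] in simp)
  ultimately have "?\<beta> = (\<lambda>_. 0\<^sub>m m l)"
    using Y l unfolding arveson_extreme_point_def by blast
  then show ?thesis by (rule fun_cong)
qed

text \<open>
  Multiplying the added columns by \<open>\<i>\<close> turns their imaginary parts into real parts, up to sign.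
\<close>

lemma arveson_extreme_complexify:
  assumes Y: "arveson_extreme_point K' m Y"
  shows "arveson_extreme_point K m (complexify Y)"
  unfolding arveson_extreme_point_def
proof (intro conjI allI impI ballI)
  show cY: "complexify Y \<in> level K m"
    using Y by (simp add: arveson_extreme_point_def real_points)
  fix l \<beta> \<gamma>
  assume l: "1 \<le> l" and \<beta>': "\<beta> \<in> mat_tuples m l" and \<gamma>: "\<gamma> \<in> SM l"
    and Z: "block_tuple (complexify Y) \<beta> \<gamma> \<in> level K (m + l)"
  have \<beta>: "\<beta> a \<in> carrier_mat m l" for a using \<beta>' by (simp add: mat_tuples_def)
  note d = carrier_matD[OF \<beta>]
  have m: "1 \<le> m" using level_pos[OF cY] .
  have adj: "mat_adjoint (\<i> \<cdot>\<^sub>m 1\<^sub>m l) = (- \<i>) \<cdot>\<^sub>m 1\<^sub>m l" by (rule eq_matI) auto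
  have U: "unitary l (\<i> \<cdot>\<^sub>m 1\<^sub>m l)"
    unfolding unitary_def adj by (auto simp: mult_smult_mat smult_smult_mat intro!: eq_matI)
  have one: "isometry m m (1\<^sub>m m :: complex mat)" by (simp add: isometry_def)
  have "block_tuple (compression (1\<^sub>m m) (complexify Y)) (\<lambda>a. mat_adjoint (1\<^sub>m m) * \<beta> a * (\<i> \<cdot>\<^sub>m 1\<^sub>m l))
      (compression (\<i> \<cdot>\<^sub>m 1\<^sub>m l) \<gamma>) \<in> level K (m + l)"
    by (rule block_tuple_compression[OF Z levelD(1)[OF cY] \<beta> \<gamma> one U m])
  moreover have "(\<lambda>a. mat_adjoint (1\<^sub>m m) * \<beta> a * (\<i> \<cdot>\<^sub>m 1\<^sub>m l)) = (\<lambda>a. \<i> \<cdot>\<^sub>m \<beta> a)"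
    by (intro ext) (simp add: mult_smult_mat d)
  ultimately have Z': "block_tuple (complexify Y) (\<lambda>a. \<i> \<cdot>\<^sub>m \<beta> a) (compression (\<i> \<cdot>\<^sub>m 1\<^sub>m l) \<gamma>) \<in> level K (m + l)"
    by (simp add: compression_one[OF levelD(1)[OF cY]])
  have \<gamma>': "compression (\<i> \<cdot>\<^sub>m 1\<^sub>m l) \<gamma> \<in> SM l"
    by (rule compression_SM[OF \<gamma>]) simp
  have i\<beta>: "\<i> \<cdot>\<^sub>m \<beta> a \<in> carrier_mat m l" for a using \<beta> by simp
  show "\<beta> = (\<lambda>_. 0\<^sub>m m l)"
  proof (intro ext eq_matI)
    fix a i j assume "i < dim_row (0\<^sub>m m l :: complex mat)" "j < dim_col (0\<^sub>m m l :: complex mat)"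
    then have ij: "i < m" "j < l" by auto
    have "Re (\<beta> a $$ (i, j)) = 0"
      using arg_cong[OF real_part_of_dilation_vanishes[OF Y l \<beta> \<gamma> Z, of a], of "\<lambda>M. M $$ (i, j)"] ij d
      by simp
    moreover have "Im (\<beta> a $$ (i, j)) = 0"
      using arg_cong[OF real_part_of_dilation_vanishes[OF Y l i\<beta> \<gamma>' Z', of a], of "\<lambda>M. M $$ (i, j)"] ij d
      by simp
    ultimately show "\<beta> a $$ (i, j) = 0\<^sub>m m l $$ (i, j)"
      using ij by (simp add: complex_eq_iff)
  qed (use d in auto)
qed

end

section \<open>Real and complex dimension\<close>

text \<open>
  The two halves of a real column of length \<open>2n\<close> become real and imaginary part of a column of length
  \<open>n\<close>. Up to a factor this is compression by the half rotation.
\<close>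

definition complex_coords :: "nat \<Rightarrow> ('g \<times> nat \<Rightarrow> real) \<Rightarrow> 'g \<times> nat \<Rightarrow> complex" where
  "complex_coords n f = (\<lambda>(a, k). if k < n then of_real (f (a, k)) + \<i> * of_real (f (a, n + k)) else 0)"

text \<open>
  Restriction of scalars: complex functions as a real vector space.
\<close>

definition real_scale_fun :: "real \<Rightarrow> ('i \<Rightarrow> complex) \<Rightarrow> 'i \<Rightarrow> complex" where
  "real_scale_fun r f = (\<lambda>x. of_real r * f x)"

interpretation real_fun_space: vector_space real_scale_fun
  by unfold_locales (auto simp: real_scale_fun_def algebra_simps fun_eq_iff)

lemma linear_complex_coords: "Vector_Spaces.linear scale_fun real_scale_fun (complex_coords n)"
  by unfold_locales
    (auto simp: complex_coords_def scale_fun_def real_scale_fun_def fun_eq_iff algebra_simps)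

lemma complex_span_subset_real_span:
  "fun_space.span C \<subseteq> real_fun_space.span (C \<union> scale_fun \<i> ` C)" (is "_ \<subseteq> ?S")
proof (rule fun_space.span_minimal)
  show "C \<subseteq> ?S" using real_fun_space.span_superset by blast
  have i: "scale_fun \<i> f \<in> ?S" if "f \<in> ?S" for f
    using that
  proof (induction rule: real_fun_space.span_induct_alt)
    case base
    show ?case
      unfolding fun_space.scale_zero_right by (rule real_fun_space.span_zero)
  next
    case (step c x y)
    have "scale_fun \<i> x \<in> ?S"
    proof (cases "x \<in> C")
      case True
      then show ?thesis by (intro real_fun_space.span_base) blast
    next
      case False
      then obtain z where z: "z \<in> C" "x = scale_fun \<i> z" using step by blast
      have "scale_fun \<i> x = real_scale_fun (-1) z"
        by (auto simp: z(2) scale_fun_def real_scale_fun_def fun_eq_iff)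
      then show ?thesis
        using z(1) by (auto intro: real_fun_space.span_neg real_fun_space.span_base)
    qed
    moreover have "scale_fun \<i> (real_scale_fun c x + y) = real_scale_fun c (scale_fun \<i> x) + scale_fun \<i> y"
      by (auto simp: scale_fun_def real_scale_fun_def fun_eq_iff algebra_simps)
    ultimately show ?case
      using step(2) by (simp only: real_fun_space.span_add real_fun_space.span_scale)
  qed
  show "fun_space.subspace ?S"
  proof (rule fun_space.subspaceI)
    show "0 \<in> ?S" by (rule real_fun_space.span_zero)
    show "x + y \<in> ?S" if "x \<in> ?S" "y \<in> ?S" for x y
      using that by (rule real_fun_space.span_add)
    show "scale_fun c x \<in> ?S" if "x \<in> ?S" for c x
    proof -
      have "scale_fun c x = real_scale_fun (Re c) x + real_scale_fun (Im c) (scale_fun \<i> x)"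
        by (auto simp: scale_fun_def real_scale_fun_def fun_eq_iff complex_eq_iff)
      then show ?thesis
        using that i by (simp only: real_fun_space.span_add real_fun_space.span_scale)
    qed
  qed
qed

lemma dim_le_twice_complex_dim:
  fixes V :: "('g::finite \<times> nat \<Rightarrow> real) set" and S :: "('g \<times> nat \<Rightarrow> complex) set"
  assumes V: "\<And>f a k. f \<in> V \<Longrightarrow> n + n \<le> k \<Longrightarrow> f (a, k) = 0" "fun_space.subspace V"
    and S: "\<And>f a k. f \<in> S \<Longrightarrow> n \<le> k \<Longrightarrow> f (a, k) = 0"
    and img: "complex_coords n ` V \<subseteq> S"
  shows "fun_space.dim V \<le> 2 * fun_space.dim S"
proof -
  interpret \<phi>: Vector_Spaces.linear scale_fun real_scale_fun "complex_coords n"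
    by (rule linear_complex_coords)
  obtain B where B: "B \<subseteq> V" "fun_space.independent B" "V \<subseteq> fun_space.span B" "card B = fun_space.dim V"
    using fun_space.basis_exists by blast
  obtain C where C: "C \<subseteq> S" "fun_space.independent C" "S \<subseteq> fun_space.span C" "card C = fun_space.dim S"
    using fun_space.basis_exists by blast
  obtain T where T: "finite T" "S \<subseteq> fun_space.span T"
    by (rule supported_in_finite_span[of S n]) (simp_all add: S)
  have "finite C" using fun_space.independent_span_bound[OF T(1) C(2)] C(1) T(2) by blast
  have inj: "inj_on (complex_coords n) V"
  proof (rule inj_onI)
    fix f h assume f: "f \<in> V" and h: "h \<in> V" and eq: "complex_coords n f = complex_coords n h"
    show "f = h"
    proof
      fix i :: "'g \<times> nat"
      obtain a k where i: "i = (a, k)" by (cases i)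
      have eq': "f (a, j) = h (a, j) \<and> f (a, n + j) = h (a, n + j)" if "j < n" for j
        using fun_cong[OF eq, of "(a, j)"] that by (simp add: complex_coords_def complex_eq_iff)
      consider "k < n" | "n \<le> k" "k < n + n" | "n + n \<le> k" by linarith
      then show "f i = h i"
      proof cases
        case 1
        then show ?thesis using eq'[of k] by (simp add: i)
      next
        case 2
        then show ?thesis using eq'[of "k - n"] by (simp add: i)
      next
        case 3
        then show ?thesis using V(1)[OF f] V(1)[OF h] by (simp add: i)
      qed
    qed
  qed
  have span: "fun_space.span B \<subseteq> V" using fun_space.span_minimal[OF B(1) V(2)] .
  have ind: "real_fun_space.independent (complex_coords n ` B)"
    using B(2) inj_on_subset[OF inj span] by (rule \<phi>.independent_injective_image)
  have sub: "complex_coords n ` B \<subseteq> real_fun_space.span (C \<union> scale_fun \<i> ` C)"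
    using img B(1) C(3) complex_span_subset_real_span by blast
  have fin: "finite (C \<union> scale_fun \<i> ` C)" using \<open>finite C\<close> by simp
  have "card (complex_coords n ` B) \<le> card (C \<union> scale_fun \<i> ` C)"
    using real_fun_space.independent_span_bound[OF fin ind sub] by simp
  also have "\<dots> \<le> card C + card (scale_fun \<i> ` C)" by (rule card_Un_le)
  also have "\<dots> \<le> 2 * card C" using card_image_le[OF \<open>finite C\<close>, of "scale_fun \<i>"] by simp
  also have "card (complex_coords n ` B) = card B"
    using inj_on_subset[OF inj B(1)] by (rule card_image)
  finally show ?thesis using B(4) C(4) by simp
qed

section \<open>The dilation subspace of the realification\<close>

lemma block_tuple_SM:
  assumes X: "X \<in> SM n" and \<beta>: "\<And>a. \<beta> a \<in> carrier_mat n l" and \<gamma>: "\<gamma> \<in> SM l"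
  shows "block_tuple X \<beta> \<gamma> \<in> SM (n + l)"
proof (rule SM_I)
  fix a
  note d = SM_D(3,4)[OF X] SM_D(3,4)[OF \<gamma>] carrier_matD[OF \<beta>]
  show "block_tuple X \<beta> \<gamma> a \<in> carrier_mat (n + l) (n + l)"
    by (intro carrier_matI) (simp_all add: block_tuple_def d)
  have X': "conjugate (X a $$ (j, i)) = X a $$ (i, j)" if "i < n" "j < n" for i j
    using arg_cong[OF SM_D(2)[OF X, of a], of "\<lambda>M. M $$ (i, j)"] that by (simp add: d)
  have \<gamma>': "conjugate (\<gamma> a $$ (j, i)) = \<gamma> a $$ (i, j)" if "i < l" "j < l" for i j
    using arg_cong[OF SM_D(2)[OF \<gamma>, of a], of "\<lambda>M. M $$ (i, j)"] that by (simp add: d)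
  show "mat_adjoint (block_tuple X \<beta> \<gamma> a) = block_tuple X \<beta> \<gamma> a"
    by (rule eq_matI) (auto simp: block_tuple_def d X' \<gamma>')
qed

lemma column_coords_half_rotation:
  assumes \<beta>: "\<And>a. \<beta> a \<in> carrier_mat (n + n) 1"
  shows "column_coords (\<lambda>a. mat_adjoint (half_rotation n) * complexify \<beta> a) =
    scale_fun (of_real (1 / sqrt 2)) (complex_coords n (column_coords \<beta>))"
proof
  fix i :: "'a \<times> nat"
  obtain a k where i: "i = (a, k)" by (cases i)
  define s where "s = complex_of_real (1 / sqrt 2)"
  have s: "cnj s = s" by (simp add: s_def)
  note V = isometryD(1)[OF half_rotation_isometry(1)[of n]]
  note d = carrier_matD[OF V] carrier_matD[OF \<beta>]
  show "column_coords (\<lambda>a. mat_adjoint (half_rotation n) * complexify \<beta> a) i =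
    scale_fun (of_real (1 / sqrt 2)) (complex_coords n (column_coords \<beta>)) i"
  proof (cases "k < n")
    case True
    have "(mat_adjoint (half_rotation n) * complexify \<beta> a) $$ (k, 0) =
        (\<Sum>p<n + n. mat_adjoint (half_rotation n) $$ (k, p) * complexify \<beta> a $$ (p, 0))"
      using True by (intro index_mult_mat_sum) (auto simp: d complexify_def intro!: carrier_matI)
    also have "\<dots> = (\<Sum>p<n. if p = k then s * of_real (\<beta> a $$ (p, 0)) else 0) +
        (\<Sum>p<n. if p = k then \<i> * s * of_real (\<beta> a $$ (n + p, 0)) else 0)"
      unfolding sum_lessThan_add using True
      by (intro arg_cong2[of _ _ _ _ "(+)"] sum.cong)
        (auto simp: d complexify_def half_rotation_def vstack_def s s_def[symmetric] simp del: of_real_divide)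
    also have "\<dots> = s * (of_real (\<beta> a $$ (k, 0)) + \<i> * of_real (\<beta> a $$ (n + k, 0)))"
      using True by (simp add: sum.delta algebra_simps)
    finally show ?thesis
      using True by (simp add: i column_coords_def complex_coords_def scale_fun_def d s_def[symmetric] del: of_real_divide)
  next
    case False
    then show ?thesis by (simp add: i column_coords_def complex_coords_def scale_fun_def d)
  qed
qed

context complexified_set
begin

text \<open>
  Compressing a dilation of the realification by the half rotation, with the added coordinate kept,
  gives a dilation of \<open>X\<close>.
\<close>

lemma complex_coords_dilation_subspace:
  fixes R :: "'g \<Rightarrow> real mat"
  assumes R: "R \<in> level K' (n + n)" and RX: "compression (half_rotation n) (complexify R) = X"
  shows "complex_coords n ` dilation_subspace K' (n + n) R \<subseteq> dilation_subspace K n X"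
proof -
  interpret \<phi>: Vector_Spaces.linear scale_fun real_scale_fun "complex_coords n :: ('g \<times> nat \<Rightarrow> real) \<Rightarrow> _"
    by (rule linear_complex_coords)
  let ?S = "dilation_subspace K n X"
  have S: "fun_space.subspace ?S"
    unfolding dilation_subspace_def by (rule fun_space.subspace_span)
  have cR: "complexify R \<in> level K (n + n)" using R by (simp add: real_points)
  have n: "1 \<le> n" using level_pos[OF cR] by simp
  have "fun_space.subspace {f. complex_coords n f \<in> ?S}"
  proof (rule fun_space.subspaceI)
    show "0 \<in> {f. complex_coords n f \<in> ?S}"
      using fun_space.subspace_0[OF S] by (simp only: \<phi>.zero mem_Collect_eq)
    show "f + h \<in> {f. complex_coords n f \<in> ?S}"
      if "f \<in> {f. complex_coords n f \<in> ?S}" "h \<in> {f. complex_coords n f \<in> ?S}" for f h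
      using fun_space.subspace_add[OF S] that by (simp only: \<phi>.add mem_Collect_eq)
    show "scale_fun c f \<in> {f. complex_coords n f \<in> ?S}"
      if "f \<in> {f. complex_coords n f \<in> ?S}" for c f
    proof -
      have "complex_coords n (scale_fun c f) = scale_fun (of_real c) (complex_coords n f)"
        unfolding \<phi>.scale by (simp add: real_scale_fun_def scale_fun_def)
      then show ?thesis using fun_space.subspace_scale[OF S] that by simp
    qed
  qed
  moreover have "complex_coords n (column_coords \<beta>) \<in> ?S"
    if \<beta>': "\<beta> \<in> mat_tuples (n + n) 1" and Z: "block_tuple R \<beta> (\<lambda>a. mat 1 1 (\<lambda>_. c a)) \<in> K'" for \<beta> c
  proof -
    let ?\<gamma> = "\<lambda>a. mat 1 1 (\<lambda>_. c a)"
    have \<beta>: "\<beta> a \<in> carrier_mat (n + n) 1" for a using \<beta>' by (simp add: mat_tuples_def)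
    have \<gamma>: "?\<gamma> \<in> SM 1" by (rule SM_I) (auto intro!: eq_matI)
    have RS: "R \<in> SM (n + n)" by (rule levelD(1)[OF R])
    have "block_tuple R \<beta> ?\<gamma> \<in> level K' (n + n + 1)"
      unfolding level_def using Z block_tuple_SM[of R "n + n" \<beta> 1 ?\<gamma>, OF RS \<beta> \<gamma>] by blast
    then have "complexify (block_tuple R \<beta> ?\<gamma>) \<in> level K (n + n + 1)"
      by (simp only: real_points)
    moreover have "complexify (block_tuple R \<beta> ?\<gamma>) = block_tuple (complexify R) (complexify \<beta>) (complexify ?\<gamma>)"
      by (rule complexify_block_tuple[of R "n + n" \<beta> 1 ?\<gamma>, OF SM_D(1)[OF RS] \<beta> SM_D(1)[OF \<gamma>]])
    ultimately have "block_tuple (complexify R) (complexify \<beta>) (complexify ?\<gamma>) \<in> level K (n + n + 1)"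
      by simp
    moreover have "complexify \<beta> a \<in> carrier_mat (n + n) 1" for a
      using \<beta> by (simp add: complexify_def)
    moreover have "complexify ?\<gamma> \<in> SM 1" using \<gamma> by (simp add: complexify_SM_iff)
    moreover have "unitary 1 (1\<^sub>m 1 :: complex mat)" by (simp add: unitary_def)
    ultimately have "block_tuple (compression (half_rotation n) (complexify R))
        (\<lambda>a. mat_adjoint (half_rotation n) * complexify \<beta> a * 1\<^sub>m 1) (compression (1\<^sub>m 1) (complexify ?\<gamma>)) \<in> level K (n + 1)"
      by (intro block_tuple_compression[OF _ levelD(1)[OF cR] _ _ half_rotation_isometry(1) _ n])
    moreover have "compression (1\<^sub>m 1) (complexify ?\<gamma>) = (\<lambda>a. mat 1 1 (\<lambda>_. of_real (c a)))"
      unfolding compression_one[OF \<open>complexify ?\<gamma> \<in> SM 1\<close>]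
      by (intro ext eq_matI) (auto simp: complexify_def)
    moreover have "(\<lambda>a. mat_adjoint (half_rotation n) * complexify \<beta> a * 1\<^sub>m 1) =
        (\<lambda>a. mat_adjoint (half_rotation n) * complexify \<beta> a)"
      using carrier_matD[OF \<beta>] by (intro ext right_mult_one_mat') (simp add: complexify_def)
    ultimately have "block_tuple X (\<lambda>a. mat_adjoint (half_rotation n) * complexify \<beta> a)
        (\<lambda>a. mat 1 1 (\<lambda>_. of_real (c a))) \<in> K"
      unfolding RX by (simp only: levelD(2))
    moreover have "(\<lambda>a. mat_adjoint (half_rotation n) * complexify \<beta> a) \<in> mat_tuples n 1"
      using carrier_matD[OF \<beta>] carrier_matD[OF isometryD(1)[OF half_rotation_isometry(1)[of n]]]
      by (auto simp: mat_tuples_def complexify_def intro!: carrier_matI)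
    ultimately have "column_coords (\<lambda>a. mat_adjoint (half_rotation n) * complexify \<beta> a) \<in> ?S"
      unfolding dilation_subspace_def by (intro fun_space.span_base imageI) blast
    then have "scale_fun (of_real (sqrt 2)) (scale_fun (of_real (1 / sqrt 2)) (complex_coords n (column_coords \<beta>))) \<in> ?S"
      unfolding column_coords_half_rotation[OF \<beta>] by (rule fun_space.subspace_scale[OF S])
    moreover have "complex_of_real (sqrt 2) * of_real (1 / sqrt 2) = 1"
      unfolding of_real_mult[symmetric] by simp
    ultimately show ?thesis
      unfolding fun_space.scale_scale by (simp only: fun_space.scale_one)
  qed
  ultimately have "dilation_subspace K' (n + n) R \<subseteq> {f. complex_coords n f \<in> ?S}"
    unfolding dilation_subspace_def[of K'] by (intro fun_space.span_minimal) auto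
  then show ?thesis by blast
qed

end

section \<open>Extreme dilations and decompositions over both fields\<close>

lemma real_case:
  fixes smul :: "real \<Rightarrow> 'h::banach \<Rightarrow> 'h" and A :: "'g::finite \<Rightarrow> 'h \<Rightarrow> 'h"
  assumes H: "hilbert_space_over smul ip" and A: "\<And>a. compact_selfadjoint smul ip (A a)"
    and D: "D = gen_free_spectrahedron smul ip A" and bounded: "bounded_tuples D"
  shows "matrix_convex_set D"
    and "X \<in> level D n \<Longrightarrow> \<exists>l \<le> dilation_dim D n X. \<exists>Y. dilation D n l X Y \<and> arveson_extreme_point D (n + l) Y"
proof -
  have smul: "smul = (*\<^sub>R)"
    using hilbert_space_over.smul_of_real[OF H] by (auto simp: fun_eq_iff)
  show "matrix_convex_set D"
    unfolding D using A by (intro matrix_convex_gen_free_spectrahedron[OF H]) (simp add: compact_selfadjoint_def)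
  have "real_spectrahedron ip A"
    using H A unfolding smul by (intro real_spectrahedron.intro)
  then show "X \<in> level D n \<Longrightarrow> \<exists>l \<le> dilation_dim D n X. \<exists>Y. dilation D n l X Y \<and> arveson_extreme_point D (n + l) Y"
    using real_spectrahedron.real_arveson_extreme_dilation[of ip A X n] bounded unfolding D smul by blast
qed

lemma complex_case:
  fixes smul :: "complex \<Rightarrow> 'k::banach \<Rightarrow> 'k" and A :: "'g::finite \<Rightarrow> 'k \<Rightarrow> 'k"
  assumes H: "hilbert_space_over smul ip" and A: "\<And>a. compact_selfadjoint smul ip (A a)"
    and D: "D = gen_free_spectrahedron smul ip A" and bounded: "bounded_tuples D"
    and conj: "closed_under_conjugation D"
  shows "matrix_convex_set D"
    and "X \<in> level D n \<Longrightarrow>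
      \<exists>l \<le> n + 2 * dilation_dim D n X. \<exists>Y. dilation D n l X Y \<and> arveson_extreme_point D (n + l) Y"
proof -
  show mcs: "matrix_convex_set D"
    unfolding D using A by (intro matrix_convex_gen_free_spectrahedron[OF H]) (simp add: compact_selfadjoint_def)
  let ?ip = "\<lambda>x y. Re (ip x y)"
  define D' where "D' = gen_free_spectrahedron (*\<^sub>R) ?ip A"
  have real_points: "Z \<in> level D' m \<longleftrightarrow> complexify Z \<in> level D m" for Z m
    unfolding D'_def D by (rule gen_free_spectrahedron_complexify_iff[OF H A])
  interpret complexified_set D D'
    using mcs real_points conj by (simp add: complexified_set_def complexified_set_axioms_def)
  assume X: "X \<in> level D n"
  obtain R where R: "R \<in> level D' (n + n)" "compression (half_rotation n) (complexify R) = X"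
    using realification[OF X] by blast
  have "bounded_tuples D'"
    using bounded_tuples_complexify[OF bounded] real_points by blast
  from real_case(2)[OF hilbert_space_over_real_part[OF H] compact_selfadjoint_real_part[OF H A] D'_def this R(1)]
  obtain l Y where l: "l \<le> dilation_dim D' (n + n) R" and RY: "dilation D' (n + n) l R Y"
    and Y: "arveson_extreme_point D' (n + n + l) Y" by blast
  have "dilation_dim D' (n + n) R \<le> 2 * dilation_dim D n X"
    unfolding dilation_dim_def
  proof (rule dim_le_twice_complex_dim)
    show "fun_space.subspace (dilation_subspace D' (n + n) R)"
      unfolding dilation_subspace_def by (rule fun_space.subspace_span)
    show "complex_coords n ` dilation_subspace D' (n + n) R \<subseteq> dilation_subspace D n X"
      by (rule complex_coords_dilation_subspace[OF R])
  qed (auto intro: dilation_subspace_supported)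
  then have bound: "n + l \<le> n + 2 * dilation_dim D n X" using l by simp
  have rigid: "rigid (n + n + l) (complexify Y)"
    by (rule arveson_extreme_imp_rigid[OF arveson_extreme_complexify[OF Y]])
  let ?I = "vstack (1\<^sub>m (n + n)) (0\<^sub>m l (n + n)) :: complex mat"
  obtain \<beta> \<gamma> where \<beta>: "\<beta> \<in> mat_tuples (n + n) l" and \<gamma>: "\<gamma> \<in> SM l" and Yb: "Y = block_tuple R \<beta> \<gamma>"
    using RY unfolding dilation_def by blast
  have RS: "R \<in> SM (n + n)" by (rule levelD(1)[OF R(1)])
  have \<beta>c: "\<beta> a \<in> carrier_mat (n + n) l" for a using \<beta> by (simp add: mat_tuples_def)
  have "complexify Y = block_tuple (complexify R) (complexify \<beta>) (complexify \<gamma>)"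
    unfolding Yb by (rule complexify_block_tuple[of R "n + n" \<beta> l \<gamma>, OF SM_D(1)[OF RS] \<beta>c SM_D(1)[OF \<gamma>]])
  moreover have "complexify \<beta> \<in> mat_tuples (n + n) l"
    using \<beta>c by (simp add: complexify_def mat_tuples_def)
  moreover have "complexify R \<in> SM (n + n)" "complexify \<gamma> \<in> SM l"
    using RS \<gamma> by (simp_all add: complexify_SM_iff)
  ultimately have "compression ?I (complexify Y) = complexify R"
    by (simp only: block_tuple_inclusion(2))
  then have XY: "compression (?I * half_rotation n) (complexify Y) = X"
    using compression_mult[OF levelD(1)[OF rigid_level[OF rigid]] isometryD(1)[OF isometry_inclusion]
        isometryD(1)[OF half_rotation_isometry(1)]] R(2) by simp
  have "isometry (n + n + l) n (?I * half_rotation n)"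
    by (rule isometry_mult[OF isometry_inclusion half_rotation_isometry(1)])
  from rigid_compression_dilates[OF rigid this]
  have "\<exists>Y'. dilation D n (n + l) X Y' \<and> arveson_extreme_point D (n + (n + l)) Y'"
    unfolding XY by (simp add: add.assoc)
  then show "\<exists>l \<le> n + 2 * dilation_dim D n X. \<exists>Y. dilation D n l X Y \<and> arveson_extreme_point D (n + l) Y"
    using bound by blast
qed

lemma (in matrix_convex_set) dilation_and_decomposition:
  assumes "\<And>n X. X \<in> level K n \<Longrightarrow>
      \<exists>l \<le> b n X. \<exists>Y. dilation K n l X Y \<and> arveson_extreme_point K (n + l) Y"
  shows "X \<in> level K n \<Longrightarrow> \<exists>l \<le> b n X. (\<exists>Y. dilation K n l X Y \<and> arveson_extreme_point K (n + l) Y) \<and>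
      (\<exists>k ns V F. matrix_convex_combination n k ns V F X \<and>
        (\<forall>i<k. free_extreme_point K (ns i) (F i)) \<and> (\<Sum>i<k. ns i) \<le> n + l)"
    and "K = matrix_convex_hull {F. \<exists>m. free_extreme_point K m F}"
proof -
  show *: "\<exists>l \<le> b n X. (\<exists>Y. dilation K n l X Y \<and> arveson_extreme_point K (n + l) Y) \<and>
      (\<exists>k ns V F. matrix_convex_combination n k ns V F X \<and>
        (\<forall>i<k. free_extreme_point K (ns i) (F i)) \<and> (\<Sum>i<k. ns i) \<le> n + l)"
    if X: "X \<in> level K n" for n X
  proof -
    obtain l Y where l: "l \<le> b n X" and Y: "dilation K n l X Y" "arveson_extreme_point K (n + l) Y"
      using assms[OF X] by blast
    show ?thesis
      using l Y dilation_to_arveson_extreme_decomposition[OF Y levelD(1)[OF X]] by blast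
  qed
  show "K = matrix_convex_hull {F. \<exists>m. free_extreme_point K m F}"
    using * by (intro eq_matrix_convex_hull_free_extreme) blast
qed

theorem theorem2p3:
  shows
   "(\<forall>(smul :: real \<Rightarrow> 'h::banach \<Rightarrow> 'h) ip (A :: 'g::finite \<Rightarrow> 'h \<Rightarrow> 'h) D.
       separable_infinite_dim_hilbert_space_over smul ip \<and>
       (\<forall>a. compact_selfadjoint smul ip (A a)) \<and>
       D = gen_free_spectrahedron smul ip A \<and>
       bounded_tuples D \<and> closed_under_conjugation D \<longrightarrow>
       (\<forall>n. \<forall>X \<in> level D n. \<exists>l.
          l \<le> dilation_dim D n X \<and> dilation_dim D n X \<le> n * CARD('g) \<and>
          (\<exists>Y. dilation D n l X Y \<and> arveson_extreme_point D (n + l) Y) \<and>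
          (\<exists>k ns V F.
             matrix_convex_combination n k ns V F X \<and>
             (\<forall>i<k. free_extreme_point D (ns i) (F i)) \<and>
             (\<Sum>i<k. ns i) \<le> n + l)) \<and>
       D = matrix_convex_hull {F. \<exists>m. free_extreme_point D m F}) \<and>
    (\<forall>(smul :: complex \<Rightarrow> 'k::banach \<Rightarrow> 'k) ip (A :: 'g \<Rightarrow> 'k \<Rightarrow> 'k) D.
       separable_infinite_dim_hilbert_space_over smul ip \<and>
       (\<forall>a. compact_selfadjoint smul ip (A a)) \<and>
       D = gen_free_spectrahedron smul ip A \<and>
       bounded_tuples D \<and> closed_under_conjugation D \<longrightarrow>
       (\<forall>n. \<forall>X \<in> level D n. \<exists>l.
          l \<le> n + 2 * dilation_dim D n X \<and>
          n + 2 * dilation_dim D n X \<le> n + 2 * n * CARD('g) \<and>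
          (\<exists>Y. dilation D n l X Y \<and> arveson_extreme_point D (n + l) Y) \<and>
          (\<exists>k ns V F.
             matrix_convex_combination n k ns V F X \<and>
             (\<forall>i<k. free_extreme_point D (ns i) (F i)) \<and>
             (\<Sum>i<k. ns i) \<le> n + l)) \<and>
       D = matrix_convex_hull {F. \<exists>m. free_extreme_point D m F})"
proof (intro conjI allI impI ballI; elim conjE)
  fix smul :: "real \<Rightarrow> 'h \<Rightarrow> 'h" and ip and A :: "'g \<Rightarrow> 'h \<Rightarrow> 'h" and D
  assume sep: "separable_infinite_dim_hilbert_space_over smul ip"
    and A: "\<forall>a. compact_selfadjoint smul ip (A a)"
    and D: "D = gen_free_spectrahedron smul ip A" and bounded: "bounded_tuples D"
  have H: "hilbert_space_over smul ip"
    using sep by (rule separable_infinite_dim_hilbert_space_over.axioms(1))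
  note dil = real_case[OF H spec[OF A] D bounded]
  interpret matrix_convex_set D by (rule dil(1))
  note result = dilation_and_decomposition[of "dilation_dim D", OF dil(2)]
  show "\<exists>l. l \<le> dilation_dim D n X \<and> dilation_dim D n X \<le> n * CARD('g) \<and>
      (\<exists>Y. dilation D n l X Y \<and> arveson_extreme_point D (n + l) Y) \<and>
      (\<exists>k ns V F. matrix_convex_combination n k ns V F X \<and>
         (\<forall>i<k. free_extreme_point D (ns i) (F i)) \<and> (\<Sum>i<k. ns i) \<le> n + l)"
    if "X \<in> level D n" for n X
    using result(1)[OF _ that] dilation_dim_le[of D n X] by blast
  show "D = matrix_convex_hull {F. \<exists>m. free_extreme_point D m F}"
    by (rule result(2))
next
  fix smul :: "complex \<Rightarrow> 'k \<Rightarrow> 'k" and ip and A :: "'g \<Rightarrow> 'k \<Rightarrow> 'k" and D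
  assume sep: "separable_infinite_dim_hilbert_space_over smul ip"
    and A: "\<forall>a. compact_selfadjoint smul ip (A a)"
    and D: "D = gen_free_spectrahedron smul ip A" and bounded: "bounded_tuples D"
    and conj: "closed_under_conjugation D"
  have H: "hilbert_space_over smul ip"
    using sep by (rule separable_infinite_dim_hilbert_space_over.axioms(1))
  note dil = complex_case[OF H spec[OF A] D bounded conj]
  interpret matrix_convex_set D by (rule dil(1))
  note result = dilation_and_decomposition[of "\<lambda>n X. n + 2 * dilation_dim D n X", OF dil(2)]
  show "\<exists>l. l \<le> n + 2 * dilation_dim D n X \<and> n + 2 * dilation_dim D n X \<le> n + 2 * n * CARD('g) \<and>
      (\<exists>Y. dilation D n l X Y \<and> arveson_extreme_point D (n + l) Y) \<and>
      (\<exists>k ns V F. matrix_convex_combination n k ns V F X \<and>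
         (\<forall>i<k. free_extreme_point D (ns i) (F i)) \<and> (\<Sum>i<k. ns i) \<le> n + l)"
    if "X \<in> level D n" for n X
  proof -
    have "n + 2 * dilation_dim D n X \<le> n + 2 * n * CARD('g)"
      using dilation_dim_le[of D n X] by simp
    then show ?thesis using result(1)[OF _ that] by blast
  qed
  show "D = matrix_convex_hull {F. \<exists>m. free_extreme_point D m F}"
    by (rule result(2))
qed

end
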